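(* If $M$ is a strongly noetherian gcd-monoid satisfying the $3$-Ore condition and containing finitely many basic elements, then the word problem for the enveloping group $U(M)$ is decidable.
   Context: For $a,b$ in a monoid $M$: $a$ left divides $b$ if $b=ax$ for some $x$ ($b$ is a right multiple of $a$); $a$ right divides $b$ if $b=xa$ for some $x$ ($b$ is a left multiple of $a$). A gcd-monoid is a cancellative monoid with no nontrivial invertible element in which any two elements admit a left gcd and a right gcd. In a gcd-monoid, two elements with a common right (resp. left) multiple have a unique right lcm $a\vee b$ (resp. left lcm). A cancellative monoid $M$ is strongly noetherian if there is a map $\lambda:M\to\mathbb N$ with $\lambda(ab)\ge\lambda(a)+\lambda(b)$ for all $a,b$ and $\lambda(a)>0$ for every non-invertible $a$. $3$-Ore condition: any three elements of $M$ that pairwise admit a common right (resp. left) multiple admit a global common right (resp. left) multiple (both versions are required). An atom is a non-invertible element that is not a product of two non-invertible elements. An element is right basic if it lies in the smallest subset of $M$ containing the atoms and closed under the operation sending $(a,b)$ such that $a\vee b$ exists to the element $a'$ with $a\vee b=ba'$; left basic elements are defined symmetrically using left lcms; an element is basic if it is right or left basic. $U(M)$ is the universal group of $M$; the word problem is taken with respect to the (finite) generating set given by the atoms of $M$. *)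

theory Defs
  imports "HOL-Algebra.Divisibility" "HOL-Algebra.Generated_Groups" "HOL-Library.Nat_Bijection"
begin

section \<open>Gcd-monoids\<close>

text \<open>
  In a possibly noncommutative monoid, the library's \<open>a divides b\<close> (that is, \<open>b = a \<otimes> x\<close> for
  some \<open>x\<close>) is left divisibility, so \<open>gcdof\<close> is the left gcd and \<open>lcmof\<close> is the right lcm.
  The symmetric notions are obtained by passing to the opposite monoid.
\<close>

definition opp :: "('a, 'b) monoid_scheme \<Rightarrow> ('a, 'b) monoid_scheme" where
  "opp M = M\<lparr>mult := \<lambda>x y. y \<otimes>\<^bsub>M\<^esub> x\<rparr>"

lemma opp_simps [simp]:
  "carrier (opp M) = carrier M" "\<one>\<^bsub>opp M\<^esub> = \<one>\<^bsub>M\<^esub>" "x \<otimes>\<^bsub>opp M\<^esub> y = y \<otimes>\<^bsub>M\<^esub> x"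
  by (simp_all add: opp_def)

lemma divides_opp_iff: "a divides\<^bsub>opp M\<^esub> b \<longleftrightarrow> (\<exists>x\<in>carrier M. b = x \<otimes>\<^bsub>M\<^esub> a)"
  by (simp add: factor_def)

definition gcd_monoid :: "('a, 'b) monoid_scheme \<Rightarrow> bool" where
  "gcd_monoid M \<longleftrightarrow>
     monoid_cancel M \<and> Units M = {\<one>\<^bsub>M\<^esub>} \<and>
     (\<forall>a\<in>carrier M. \<forall>b\<in>carrier M.
        (\<exists>d\<in>carrier M. d gcdof\<^bsub>M\<^esub> a b) \<and> (\<exists>d\<in>carrier M. d gcdof\<^bsub>opp M\<^esub> a b))"

definition strongly_noetherian :: "('a, 'b) monoid_scheme \<Rightarrow> bool" where
  "strongly_noetherian M \<longleftrightarrow>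
     (\<exists>l :: 'a \<Rightarrow> nat.
        (\<forall>a\<in>carrier M. \<forall>b\<in>carrier M. l (a \<otimes>\<^bsub>M\<^esub> b) \<ge> l a + l b) \<and>
        (\<forall>a\<in>carrier M - Units M. l a > 0))"

definition common_right_multiple :: "('a, 'b) monoid_scheme \<Rightarrow> 'a set \<Rightarrow> bool" where
  "common_right_multiple M A \<longleftrightarrow> (\<exists>m\<in>carrier M. \<forall>a\<in>A. a divides\<^bsub>M\<^esub> m)"

definition right_three_Ore :: "('a, 'b) monoid_scheme \<Rightarrow> bool" where
  "right_three_Ore M \<longleftrightarrow>
     (\<forall>a\<in>carrier M. \<forall>b\<in>carrier M. \<forall>c\<in>carrier M.
        common_right_multiple M {a, b} \<and> common_right_multiple M {b, c} \<and>
        common_right_multiple M {a, c} \<longrightarrow> common_right_multiple M {a, b, c})"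

definition three_Ore :: "('a, 'b) monoid_scheme \<Rightarrow> bool" where
  "three_Ore M \<longleftrightarrow> right_three_Ore M \<and> right_three_Ore (opp M)"

definition atoms :: "('a, 'b) monoid_scheme \<Rightarrow> 'a set" where
  "atoms M = {a \<in> carrier M - Units M.
     \<not> (\<exists>b\<in>carrier M - Units M. \<exists>c\<in>carrier M - Units M. a = b \<otimes>\<^bsub>M\<^esub> c)}"

inductive_set right_basic :: "('a, 'b) monoid_scheme \<Rightarrow> 'a set" for M where
  atom: "a \<in> atoms M \<Longrightarrow> a \<in> right_basic M"
| lcm: "\<lbrakk>a \<in> right_basic M; b \<in> right_basic M; m \<in> carrier M; m lcmof\<^bsub>M\<^esub> a b;
         a' \<in> carrier M; m = b \<otimes>\<^bsub>M\<^esub> a'\<rbrakk> \<Longrightarrow> a' \<in> right_basic M"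

definition basic_elements :: "('a, 'b) monoid_scheme \<Rightarrow> 'a set" where
  "basic_elements M = right_basic M \<union> right_basic (opp M)"


section \<open>The enveloping group\<close>

text \<open>
  A word is a list of letters \<open>(a, e)\<close>; the letter \<open>(a, True)\<close> stands for \<open>a\<close> and \<open>(a, False)\<close>
  for its formal inverse. The enveloping group is presented by the generators \<open>carrier M\<close> and
  all the relations \<open>a \<cdot> b = a \<otimes> b\<close>.
\<close>

inductive_set env_rel ::
    "('a, 'b) monoid_scheme \<Rightarrow> (('a \<times> bool) list \<times> ('a \<times> bool) list) set" for M where
  refl: "set u \<subseteq> carrier M \<times> UNIV \<Longrightarrow> (u, u) \<in> env_rel M"
| sym: "(u, v) \<in> env_rel M \<Longrightarrow> (v, u) \<in> env_rel M"
| trans: "(u, v) \<in> env_rel M \<Longrightarrow> (v, w) \<in> env_rel M \<Longrightarrow> (u, w) \<in> env_rel M"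
| cancel: "\<lbrakk>a \<in> carrier M; set u \<subseteq> carrier M \<times> UNIV; set v \<subseteq> carrier M \<times> UNIV\<rbrakk> \<Longrightarrow>
     (u @ [(a, e), (a, \<not> e)] @ v, u @ v) \<in> env_rel M"
| mult: "\<lbrakk>a \<in> carrier M; b \<in> carrier M;
          set u \<subseteq> carrier M \<times> UNIV; set v \<subseteq> carrier M \<times> UNIV\<rbrakk> \<Longrightarrow>
     (u @ [(a, True), (b, True)] @ v, u @ [(a \<otimes>\<^bsub>M\<^esub> b, True)] @ v) \<in> env_rel M"

definition enveloping_group :: "('a, 'b) monoid_scheme \<Rightarrow> ('a \<times> bool) list set monoid" where
  "enveloping_group M =
     \<lparr>carrier = {w. set w \<subseteq> carrier M \<times> UNIV} // env_rel M,
      mult = \<lambda>X Y. \<Union>u\<in>X. \<Union>v\<in>Y. env_rel M `` {u @ v},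
      one = env_rel M `` {[]}\<rparr>"

definition env_map :: "('a, 'b) monoid_scheme \<Rightarrow> 'a \<Rightarrow> ('a \<times> bool) list set" where
  "env_map M a = env_rel M `` {[(a, True)]}"

definition letter_value ::
    "('g, 'c) monoid_scheme \<Rightarrow> ('x \<Rightarrow> 'g) \<Rightarrow> 'x \<times> bool \<Rightarrow> 'g" where
  "letter_value G f = (\<lambda>(x, e). if e then f x else inv\<^bsub>G\<^esub> (f x))"

definition word_value ::
    "('g, 'c) monoid_scheme \<Rightarrow> ('x \<Rightarrow> 'g) \<Rightarrow> ('x \<times> bool) list \<Rightarrow> 'g" where
  "word_value G f w = foldr (\<lambda>l g. letter_value G f l \<otimes>\<^bsub>G\<^esub> g) w \<one>\<^bsub>G\<^esub>"

lemma env_rel_words: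
  "monoid M \<Longrightarrow> (u, v) \<in> env_rel M \<Longrightarrow> set u \<subseteq> carrier M \<times> UNIV \<and> set v \<subseteq> carrier M \<times> UNIV"
  by (erule env_rel.induct) (auto intro: monoid.m_closed)

lemma equiv_env_rel:
  assumes "monoid M"
  shows "equiv {w. set w \<subseteq> carrier M \<times> UNIV} (env_rel M)"
proof (rule equivI)
  show "env_rel M \<subseteq> {w. set w \<subseteq> carrier M \<times> UNIV} \<times> {w. set w \<subseteq> carrier M \<times> UNIV}"
    by (auto dest!: env_rel_words[OF assms])
  show "refl_on {w. set w \<subseteq> carrier M \<times> UNIV} (env_rel M)"
    by (rule refl_onI) (blast intro: env_rel.refl)
  show "sym (env_rel M)" by (rule symI) (rule env_rel.sym)
  show "trans (env_rel M)" by (rule transI) (rule env_rel.trans)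
qed

lemma env_rel_append_left:
  assumes "(u, v) \<in> env_rel M" "set s \<subseteq> carrier M \<times> UNIV"
  shows "(s @ u, s @ v) \<in> env_rel M"
  using assms
proof (induction rule: env_rel.induct)
  case (refl u)
  then show ?case by (intro env_rel.refl) auto
next
  case (cancel a u v e)
  then show ?case using env_rel.cancel[of a M "s @ u" v e] by simp
next
  case (mult a b u v)
  then show ?case using env_rel.mult[of a M b "s @ u" v] by simp
qed (blast intro: env_rel.sym env_rel.trans)+

lemma env_rel_append_right:
  assumes "(u, v) \<in> env_rel M" "set s \<subseteq> carrier M \<times> UNIV"
  shows "(u @ s, v @ s) \<in> env_rel M"
  using assms
proof (induction rule: env_rel.induct)
  case (refl u)
  then show ?case by (intro env_rel.refl) auto
next
  case (cancel a u v e)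
  then show ?case using env_rel.cancel[of a M u "v @ s" e] by simp
next
  case (mult a b u v)
  then show ?case using env_rel.mult[of a M b u "v @ s"] by simp
qed (blast intro: env_rel.sym env_rel.trans)+

lemma env_rel_append:
  assumes "monoid M" "(u, u') \<in> env_rel M" "(v, v') \<in> env_rel M"
  shows "(u @ v, u' @ v') \<in> env_rel M"
proof -
  have "(u @ v, u' @ v) \<in> env_rel M"
    using assms env_rel_words by (blast intro: env_rel_append_right)
  moreover have "(u' @ v, u' @ v') \<in> env_rel M"
    using assms env_rel_words by (blast intro: env_rel_append_left)
  ultimately show ?thesis by (rule env_rel.trans)
qed

lemma env_rel_class_eq:
  assumes "monoid M" "(u, v) \<in> env_rel M"
  shows "env_rel M `` {u} = env_rel M `` {v}"
  by (rule equiv_class_eq[OF equiv_env_rel[OF assms(1)] assms(2)])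

lemma enveloping_mult:
  assumes M: "monoid M" and uv: "set u \<subseteq> carrier M \<times> UNIV" "set v \<subseteq> carrier M \<times> UNIV"
  shows "env_rel M `` {u} \<otimes>\<^bsub>enveloping_group M\<^esub> env_rel M `` {v} = env_rel M `` {u @ v}"
proof -
  have eq: "env_rel M `` {u' @ v'} = env_rel M `` {u @ v}"
    if "u' \<in> env_rel M `` {u}" "v' \<in> env_rel M `` {v}" for u' v'
    using that env_rel_class_eq[OF M env_rel_append[OF M], of u u' v v'] by simp
  have "u \<in> env_rel M `` {u}" "v \<in> env_rel M `` {v}"
    using uv by (auto intro: env_rel.refl)
  then have "(\<Union>u'\<in>env_rel M `` {u}. \<Union>v'\<in>env_rel M `` {v}. env_rel M `` {u' @ v'}) =
      env_rel M `` {u @ v}"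
    using eq by blast
  then show ?thesis by (simp add: enveloping_group_def)
qed

lemma enveloping_one: "\<one>\<^bsub>enveloping_group M\<^esub> = env_rel M `` {[]}"
  by (simp add: enveloping_group_def)

lemma enveloping_class_closed:
  "set w \<subseteq> carrier M \<times> UNIV \<Longrightarrow> env_rel M `` {w} \<in> carrier (enveloping_group M)"
  by (simp add: enveloping_group_def quotientI)

lemma enveloping_carrierE:
  assumes "X \<in> carrier (enveloping_group M)"
  obtains w where "set w \<subseteq> carrier M \<times> UNIV" "X = env_rel M `` {w}"
  using assms by (auto simp: enveloping_group_def elim: quotientE)

lemma env_rel_inverse:
  "set w \<subseteq> carrier M \<times> UNIV \<Longrightarrow>
     (map (\<lambda>(a, e). (a, \<not> e)) (rev w) @ w, []) \<in> env_rel M"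
proof (induction w)
  case (Cons x w)
  obtain a e where x: "x = (a, e)" by (cases x)
  let ?r = "map (\<lambda>(a, e). (a, \<not> e)) (rev w)"
  have "set ?r \<subseteq> carrier M \<times> UNIV" using Cons.prems by auto
  then have "(?r @ [(a, \<not> e), (a, \<not> \<not> e)] @ w, ?r @ w) \<in> env_rel M"
    using Cons.prems x by (intro env_rel.cancel) auto
  moreover have "(?r @ w, []) \<in> env_rel M" using Cons by simp
  ultimately have "(?r @ [(a, \<not> e), (a, \<not> \<not> e)] @ w, []) \<in> env_rel M"
    by (rule env_rel.trans)
  then show ?case using x by simp
qed (simp add: env_rel.refl)

lemma group_enveloping_group:
  assumes M: "monoid M"
  shows "group (enveloping_group M)"
proof (rule groupI)
  fix X Y assume "X \<in> carrier (enveloping_group M)" "Y \<in> carrier (enveloping_group M)"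
  then show "X \<otimes>\<^bsub>enveloping_group M\<^esub> Y \<in> carrier (enveloping_group M)"
    by (elim enveloping_carrierE) (auto simp: enveloping_mult[OF M] intro!: enveloping_class_closed)
next
  show "\<one>\<^bsub>enveloping_group M\<^esub> \<in> carrier (enveloping_group M)"
    by (simp add: enveloping_one enveloping_class_closed)
next
  fix X Y Z
  assume "X \<in> carrier (enveloping_group M)" "Y \<in> carrier (enveloping_group M)"
    "Z \<in> carrier (enveloping_group M)"
  then show "X \<otimes>\<^bsub>enveloping_group M\<^esub> Y \<otimes>\<^bsub>enveloping_group M\<^esub> Z =
      X \<otimes>\<^bsub>enveloping_group M\<^esub> (Y \<otimes>\<^bsub>enveloping_group M\<^esub> Z)"
    by (elim enveloping_carrierE) (simp add: enveloping_mult[OF M])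
next
  fix X assume "X \<in> carrier (enveloping_group M)"
  then show "\<one>\<^bsub>enveloping_group M\<^esub> \<otimes>\<^bsub>enveloping_group M\<^esub> X = X"
    by (elim enveloping_carrierE) (simp add: enveloping_mult[OF M] enveloping_one)
next
  fix X assume "X \<in> carrier (enveloping_group M)"
  then obtain w where w: "set w \<subseteq> carrier M \<times> UNIV" "X = env_rel M `` {w}"
    by (rule enveloping_carrierE)
  let ?r = "map (\<lambda>(a, e). (a, \<not> e)) (rev w)"
  have r: "set ?r \<subseteq> carrier M \<times> UNIV" using w by auto
  have "env_rel M `` {?r} \<otimes>\<^bsub>enveloping_group M\<^esub> X = \<one>\<^bsub>enveloping_group M\<^esub>"
    using env_rel_class_eq[OF M env_rel_inverse[OF w(1)]] w r
    by (simp only: enveloping_mult[OF M r w(1)] enveloping_one w(2))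
  then show "\<exists>Y\<in>carrier (enveloping_group M).
      Y \<otimes>\<^bsub>enveloping_group M\<^esub> X = \<one>\<^bsub>enveloping_group M\<^esub>"
    using enveloping_class_closed[OF r] by blast
qed

lemma env_map_hom:
  assumes M: "monoid M"
  shows "env_map M \<in> hom M (enveloping_group M)"
proof (rule homI)
  show "env_map M a \<in> carrier (enveloping_group M)" if "a \<in> carrier M" for a
    using that by (simp add: env_map_def enveloping_class_closed)
  show "env_map M (a \<otimes>\<^bsub>M\<^esub> b) = env_map M a \<otimes>\<^bsub>enveloping_group M\<^esub> env_map M b"
    if "a \<in> carrier M" "b \<in> carrier M" for a b
    using that env_rel_class_eq[OF M env_rel.mult[of a M b "[]" "[]"]]
    by (simp add: env_map_def enveloping_mult[OF M])
qed

context
  fixes M :: "('a, 'b) monoid_scheme" and H :: "('h, 'c) monoid_scheme" and f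
  assumes M: "monoid M" and H: "group H" and f: "f \<in> hom M H"
begin

interpretation H: group H by (rule H)

lemma letter_value_closed: "fst l \<in> carrier M \<Longrightarrow> letter_value H f l \<in> carrier H"
  using hom_in_carrier[OF f] by (auto simp: letter_value_def split: prod.splits)

lemma word_value_closed: "set w \<subseteq> carrier M \<times> UNIV \<Longrightarrow> word_value H f w \<in> carrier H"
  by (induction w) (auto simp: word_value_def intro!: letter_value_closed)

lemma word_value_append:
  "set u \<subseteq> carrier M \<times> UNIV \<Longrightarrow> set v \<subseteq> carrier M \<times> UNIV \<Longrightarrow>
     word_value H f (u @ v) = word_value H f u \<otimes>\<^bsub>H\<^esub> word_value H f v"
proof (induction u)
  case Nil
  then show ?case using word_value_closed[of v] by (simp add: word_value_def)
next
  case (Cons l u)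
  then have "word_value H f (u @ v) = word_value H f u \<otimes>\<^bsub>H\<^esub> word_value H f v" by simp
  moreover have "letter_value H f l \<in> carrier H" "word_value H f u \<in> carrier H"
    "word_value H f v \<in> carrier H"
    using Cons.prems by (auto intro!: letter_value_closed word_value_closed)
  ultimately show ?case by (simp add: word_value_def H.m_assoc)
qed

lemma word_value_env_rel: "(u, v) \<in> env_rel M \<Longrightarrow> word_value H f u = word_value H f v"
proof (induction rule: env_rel.induct)
  case (cancel a u v e)
  have "word_value H f [(a, e), (a, \<not> e)] = \<one>\<^bsub>H\<^esub>"
    using hom_in_carrier[OF f cancel(1)] by (auto simp: word_value_def letter_value_def)
  moreover have "set ([(a, e), (a, \<not> e)] @ v) \<subseteq> carrier M \<times> UNIV"
    "set [(a, e), (a, \<not> e)] \<subseteq> carrier M \<times> UNIV" using cancel by auto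
  ultimately show ?case
    using cancel word_value_closed[of v] by (simp only: word_value_append H.l_one)
next
  case (mult a b u v)
  have "word_value H f [(a, True), (b, True)] = word_value H f [(a \<otimes>\<^bsub>M\<^esub> b, True)]"
    using hom_in_carrier[OF f] hom_mult[OF f] mult M
    by (simp add: word_value_def letter_value_def)
  moreover have "set ([(a, True), (b, True)] @ v) \<subseteq> carrier M \<times> UNIV"
    "set ([(a \<otimes>\<^bsub>M\<^esub> b, True)] @ v) \<subseteq> carrier M \<times> UNIV"
    "set [(a, True), (b, True)] \<subseteq> carrier M \<times> UNIV"
    "set [(a \<otimes>\<^bsub>M\<^esub> b, True)] \<subseteq> carrier M \<times> UNIV"
    using mult monoid.m_closed[OF M] by auto
  ultimately show ?case using mult by (simp only: word_value_append)
qed auto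

theorem enveloping_group_universal:
  "\<exists>h. h \<in> hom (enveloping_group M) H \<and> (\<forall>a\<in>carrier M. h (env_map M a) = f a) \<and>
     (\<forall>k. k \<in> hom (enveloping_group M) H \<longrightarrow> (\<forall>a\<in>carrier M. k (env_map M a) = f a) \<longrightarrow>
        (\<forall>X\<in>carrier (enveloping_group M). k X = h X))"
proof -
  define h where "h X = word_value H f (SOME w. w \<in> X)" for X
  have h: "h (env_rel M `` {w}) = word_value H f w" if "set w \<subseteq> carrier M \<times> UNIV" for w
  proof -
    have "w \<in> env_rel M `` {w}" using that by (simp add: env_rel.refl)
    then have "(SOME v. v \<in> env_rel M `` {w}) \<in> env_rel M `` {w}" by (rule someI)
    then show ?thesis unfolding h_def using word_value_env_rel by force
  qed
  have "h \<in> hom (enveloping_group M) H"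
  proof (rule homI)
    fix X Y assume "X \<in> carrier (enveloping_group M)" "Y \<in> carrier (enveloping_group M)"
    then show "h (X \<otimes>\<^bsub>enveloping_group M\<^esub> Y) = h X \<otimes>\<^bsub>H\<^esub> h Y"
      by (elim enveloping_carrierE) (simp add: enveloping_mult[OF M] h word_value_append)
  next
    fix X assume "X \<in> carrier (enveloping_group M)"
    then show "h X \<in> carrier H"
      by (elim enveloping_carrierE) (simp add: h word_value_closed)
  qed
  moreover have "h (env_map M a) = f a" if "a \<in> carrier M" for a
    using that hom_in_carrier[OF f that]
    by (simp add: env_map_def h word_value_def letter_value_def)
  moreover have "k X = h X"
    if k: "k \<in> hom (enveloping_group M) H" "\<forall>a\<in>carrier M. k (env_map M a) = f a"
      and X: "X \<in> carrier (enveloping_group M)" for k X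
  proof -
    interpret E: group "enveloping_group M" by (rule group_enveloping_group[OF M])
    interpret k: group_hom "enveloping_group M" H k by unfold_locales (rule k(1))
    have letter: "k (env_rel M `` {[(a, e)]}) = letter_value H f (a, e)"
      if a: "a \<in> carrier M" for a e
    proof (cases e)
      case True
      then show ?thesis using k(2) a by (simp add: env_map_def letter_value_def)
    next
      case False
      have "(env_rel M `` {[(a, False)]}) \<otimes>\<^bsub>enveloping_group M\<^esub> env_map M a =
          \<one>\<^bsub>enveloping_group M\<^esub>"
        using a env_rel_class_eq[OF M env_rel.cancel[of a M "[]" "[]" False]]
        by (simp add: env_map_def enveloping_mult[OF M] enveloping_one)
      then have "inv\<^bsub>enveloping_group M\<^esub> (env_map M a) = env_rel M `` {[(a, False)]}"
        using a by (intro E.inv_equality) (auto simp: env_map_def enveloping_class_closed)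
      moreover have "k (inv\<^bsub>enveloping_group M\<^esub> (env_map M a)) = inv\<^bsub>H\<^esub> (k (env_map M a))"
        by (rule k.hom_inv[OF hom_in_carrier[OF env_map_hom[OF M] a]])
      ultimately show ?thesis using False a k(2) by (simp add: letter_value_def)
    qed
    have word: "k (env_rel M `` {w}) = word_value H f w" if "set w \<subseteq> carrier M \<times> UNIV" for w
      using that
    proof (induction w)
      case Nil
      then show ?case using k.hom_one by (simp add: word_value_def enveloping_one)
    next
      case (Cons l w)
      obtain a e where l: "l = (a, e)" by (cases l)
      have "env_rel M `` {l # w} =
          env_rel M `` {[l]} \<otimes>\<^bsub>enveloping_group M\<^esub> env_rel M `` {w}"
        using Cons.prems by (simp add: enveloping_mult[OF M])
      also have "k \<dots> = k (env_rel M `` {[l]}) \<otimes>\<^bsub>H\<^esub> k (env_rel M `` {w})"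
        using Cons.prems by (intro k.hom_mult enveloping_class_closed) auto
      finally show ?case using Cons letter l by (simp add: word_value_def)
    qed
    show ?thesis using X by (elim enveloping_carrierE) (simp add: word h)
  qed
  ultimately show ?thesis by blast
qed

end


section \<open>Recursive functions and decidability\<close>

text \<open>
  \<open>recursive_fn k f\<close>: the function \<open>f\<close> is a total recursive function of arity \<open>k\<close>, a \<open>k\<close>-tuple of
  arguments being a list of length \<open>k\<close>. Minimisation is only applied where it is total. Rule
  \<open>ext\<close> says that the values of \<open>f\<close> on lists of other lengths are irrelevant.
\<close>

inductive recursive_fn :: "nat \<Rightarrow> (nat list \<Rightarrow> nat) \<Rightarrow> bool" where
  zero: "recursive_fn k (\<lambda>xs. 0)"
| succ: "recursive_fn 1 (\<lambda>xs. Suc (xs ! 0))"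
| proj: "i < k \<Longrightarrow> recursive_fn k (\<lambda>xs. xs ! i)"
| comp: "\<lbrakk>recursive_fn (length gs) f; \<forall>g\<in>set gs. recursive_fn k g\<rbrakk> \<Longrightarrow>
     recursive_fn k (\<lambda>xs. f (map (\<lambda>g. g xs) gs))"
| prec: "\<lbrakk>recursive_fn k f; recursive_fn (k + 2) g\<rbrakk> \<Longrightarrow>
     recursive_fn (k + 1) (\<lambda>xs. rec_nat (f (tl xs)) (\<lambda>n r. g (n # r # tl xs)) (hd xs))"
| mu: "\<lbrakk>recursive_fn (k + 1) f; \<forall>xs. length xs = k \<longrightarrow> (\<exists>n. f (n # xs) = 0)\<rbrakk> \<Longrightarrow>
     recursive_fn k (\<lambda>xs. LEAST n. f (n # xs) = 0)"
| ext: "\<lbrakk>recursive_fn k f; \<forall>xs. length xs = k \<longrightarrow> g xs = f xs\<rbrakk> \<Longrightarrow> recursive_fn k g"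

definition decidable_set :: "nat set \<Rightarrow> bool" where
  "decidable_set A \<longleftrightarrow> (\<exists>f. recursive_fn 1 f \<and> (\<forall>n. f [n] = (if n \<in> A then 1 else 0)))"

text \<open>Words over the generators number \<open>0, 1, \<dots>\<close> and their inverses, coded as natural numbers.\<close>

definition encode_word :: "(nat \<times> bool) list \<Rightarrow> nat" where
  "encode_word w = list_encode (map (\<lambda>(i, e). 2 * i + of_bool e) w)"

lemma inj_encode_word: "inj encode_word"
proof -
  have "i = j \<and> (e \<longleftrightarrow> e')" if "2 * i + of_bool e = 2 * j + (of_bool e' :: nat)" for i j e e'
    using that by (cases e; cases e') (simp_all, presburger+)
  then have "inj (\<lambda>(i :: nat, e). 2 * i + of_bool e :: nat)"
    by (intro injI) (simp only: split_paired_all prod.case prod.inject)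
  then have "inj (map (\<lambda>(i :: nat, e). 2 * i + of_bool e :: nat))"
    by (rule inj_mapI)
  then show ?thesis
    by (simp add: inj_def encode_word_def list_encode_eq)
qed

definition word_problem :: "('g, 'c) monoid_scheme \<Rightarrow> 'g list \<Rightarrow> (nat \<times> bool) list set" where
  "word_problem G gs =
     {w. set w \<subseteq> {..<length gs} \<times> UNIV \<and> word_value G ((!) gs) w = \<one>\<^bsub>G\<^esub>}"

text \<open>
  The generating set of \<open>G\<close> is given as a family \<open>f\<close> indexed by \<open>S\<close>. Decidability does not depend
  on the order in which \<open>S\<close> is enumerated.
\<close>

definition word_problem_decidable ::
    "('g, 'c) monoid_scheme \<Rightarrow> 'x set \<Rightarrow> ('x \<Rightarrow> 'g) \<Rightarrow> bool" where
  "word_problem_decidable G S f \<longleftrightarrow>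
     finite S \<and> f ` S \<subseteq> carrier G \<and> generate G (f ` S) = carrier G \<and>
     (\<forall>xs. distinct xs \<and> set xs = S \<longrightarrow>
        decidable_set (encode_word ` word_problem G (map f xs)))"

end

theory Submission
  imports Defs "HOL-Library.More_List"
begin

text \<open>
  Elements of the enveloping group are represented by multifractions
  \<open>a 1 \<cdot> (a 2)\<^sup>-\<^sup>1 \<cdot> a 3 \<cdot> (a 4)\<^sup>-\<^sup>1 \<dots>\<close> and are simplified by Dehornoy's reduction, which pulls a
  divisor \<open>x\<close> of one entry through its neighbour by means of the lcm of \<open>x\<close> and that neighbour, and
  multiplies the remainder into the entry before. The 3-Ore condition makes this reduction
  locally confluent and noetherianity makes it terminate, so by Newman's lemma a word is trivial in
  the group if and only if every maximal reduction of its multifraction ends with the multifraction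
  whose entries are all \<open>\<one>\<close>. It suffices to pull atoms. The lcm of an atom with a word over
  the atoms is found letter by letter, the intermediate remainders being basic elements; hence one
  reduction step is carried out by a finite transducer, and iterating it until nothing changes is a
  recursive procedure.
\<close>

section \<open>Lcm squares\<close>

text \<open>Triviality in the group and reducibility to ones are compared in two directions of
  different nature. That reduction respects the group is an identity on partial products
  (\<open>step_mf_val\<close>). Conversely, each defining relation of the group must have both sides
  reduce to a common multifraction, and chaining relations needs joinability to be transitive: this
  is what confluence is for. Sequences are infinite with trailing ones, so a gap of two ones is
  closed by reduction itself and a word can be entered letter by letter without fixing the depth.
  Two critical pairs shape confluence. On one level, two divisors of the same entry have an lcm, and
  3-Ore carries it through the neighbour. On adjacent levels a common factor is left over, and a
  division one level lower removes it. The algorithm is not uniform in \<open>M\<close>: its tables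
  are computable because they are finite, without being constructed from \<open>M\<close>.
  Neighbouring entries multiply in opposite orders, so right and left basic elements both occur as
  states. No bound on the number of passes is computed; a minimisation, total by termination, looks
  for the fixed point.\<close>

lemma opp_opp [simp]: "opp (opp M) = M"
  by (simp add: opp_def)

lemma Units_opp [simp]: "Units (opp M) = Units M"
  by (auto simp: Units_def)

lemma atoms_opp [simp]: "atoms (opp M) = atoms M"
  by (auto simp: atoms_def)

lemma monoid_cancel_opp:
  assumes "monoid_cancel M"
  shows "monoid_cancel (opp M)"
proof -
  interpret monoid_cancel M by fact
  show ?thesis
    by (unfold_locales) (auto simp: m_assoc dest: l_cancel r_cancel)
qed

locale gcd_mon =
  fixes M :: "('a, 'b) monoid_scheme" (structure)
  assumes gcd_monoid: "gcd_monoid M"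

sublocale gcd_mon \<subseteq> monoid_cancel M
  using gcd_monoid by (simp add: gcd_monoid_def)

lemma gcd_mon_opp: "gcd_mon M \<Longrightarrow> gcd_mon (opp M)"
  by (auto simp: gcd_mon_def gcd_monoid_def monoid_cancel_opp)

text \<open>
  \<open>lcm_sq N a x x' b\<close>: the right lcm of \<open>a\<close> and \<open>x\<close> is \<open>a x' = x b\<close>.
\<close>

definition lcm_sq :: "('a, 'b) monoid_scheme \<Rightarrow> 'a \<Rightarrow> 'a \<Rightarrow> 'a \<Rightarrow> 'a \<Rightarrow> bool" where
  "lcm_sq N a x x' b \<longleftrightarrow>
     a \<in> carrier N \<and> x \<in> carrier N \<and> x' \<in> carrier N \<and> b \<in> carrier N \<and>
     a \<otimes>\<^bsub>N\<^esub> x' = x \<otimes>\<^bsub>N\<^esub> b \<and>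
     (\<forall>u\<in>carrier N. \<forall>v\<in>carrier N. a \<otimes>\<^bsub>N\<^esub> u = x \<otimes>\<^bsub>N\<^esub> v \<longrightarrow>
        (\<exists>w\<in>carrier N. u = x' \<otimes>\<^bsub>N\<^esub> w \<and> v = b \<otimes>\<^bsub>N\<^esub> w))"

lemma lcm_sqD:
  assumes "lcm_sq N a x x' b"
  shows "a \<in> carrier N" "x \<in> carrier N" "x' \<in> carrier N" "b \<in> carrier N"
    "a \<otimes>\<^bsub>N\<^esub> x' = x \<otimes>\<^bsub>N\<^esub> b"
  using assms by (auto simp: lcm_sq_def)

lemma lcm_sq_least:
  assumes "lcm_sq N a x x' b" "u \<in> carrier N" "v \<in> carrier N" "a \<otimes>\<^bsub>N\<^esub> u = x \<otimes>\<^bsub>N\<^esub> v"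
  obtains w where "w \<in> carrier N" "u = x' \<otimes>\<^bsub>N\<^esub> w" "v = b \<otimes>\<^bsub>N\<^esub> w"
  using assms by (auto simp: lcm_sq_def)

lemma lcm_sq_sym:
  assumes sq: "lcm_sq N a x x' b"
  shows "lcm_sq N x a b x'"
proof -
  have "\<exists>w\<in>carrier N. u = b \<otimes>\<^bsub>N\<^esub> w \<and> v = x' \<otimes>\<^bsub>N\<^esub> w"
    if "u \<in> carrier N" "v \<in> carrier N" "x \<otimes>\<^bsub>N\<^esub> u = a \<otimes>\<^bsub>N\<^esub> v" for u v
    using lcm_sq_least[OF sq that(2,1) that(3)[symmetric]] by blast
  then show ?thesis using lcm_sqD[OF sq] by (auto simp: lcm_sq_def)
qed

context gcd_mon
begin

lemma prod_one:
  assumes "a \<in> carrier M" "b \<in> carrier M" "a \<otimes> b = \<one>"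
  shows "a = \<one>" "b = \<one>"
proof -
  have "b \<otimes> a \<otimes> b = \<one> \<otimes> b"
    using assms by (simp add: m_assoc)
  then have "b \<otimes> a = \<one>"
    using assms by (intro r_cancel[of "b \<otimes> a" b \<one>]) auto
  then have "a \<in> Units M" "b \<in> Units M"
    using assms by (auto simp: Units_def)
  then show "a = \<one>" "b = \<one>"
    using gcd_monoid by (auto simp: gcd_monoid_def)
qed

lemma not_unit_iff: "a \<in> carrier M - Units M \<longleftrightarrow> a \<in> carrier M \<and> a \<noteq> \<one>"
  using gcd_monoid by (auto simp: gcd_monoid_def)

lemma atomsD:
  assumes "x \<in> atoms M"
  shows "x \<in> carrier M" "x \<noteq> \<one>"
  using assms not_unit_iff by (auto simp: atoms_def)

lemma ex_gcd:
  assumes "a \<in> carrier M" "b \<in> carrier M"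
  obtains d where "d \<in> carrier M" "d divides a" "d divides b"
    "\<And>y. y \<in> carrier M \<Longrightarrow> y divides a \<Longrightarrow> y divides b \<Longrightarrow> y divides d"
proof -
  obtain d where "d \<in> carrier M" "d gcdof a b"
    using gcd_monoid assms unfolding gcd_monoid_def by blast
  then show thesis
    using that by (auto simp: isgcd_def)
qed

text \<open>
  Start from any common multiple \<open>a u = x v\<close> and divide \<open>u\<close> and \<open>v\<close> by their right gcd; left gcds
  show that what remains divides every other common multiple.
\<close>

lemma ex_lcm_sq:
  assumes ax: "a \<in> carrier M" "x \<in> carrier M" and uv: "u \<in> carrier M" "v \<in> carrier M"
    and eq: "a \<otimes> u = x \<otimes> v"
  obtains x' b where "lcm_sq M a x x' b"
proof -
  interpret O: gcd_mon "opp M" using gcd_mon_axioms by (rule gcd_mon_opp)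
  obtain d where d: "d \<in> carrier M" "d divides\<^bsub>opp M\<^esub> u" "d divides\<^bsub>opp M\<^esub> v"
    "\<And>y. y \<in> carrier M \<Longrightarrow> y divides\<^bsub>opp M\<^esub> u \<Longrightarrow> y divides\<^bsub>opp M\<^esub> v \<Longrightarrow> y divides\<^bsub>opp M\<^esub> d"
    using O.ex_gcd[of u v] uv by auto
  obtain p q where p: "p \<in> carrier M" "u = p \<otimes> d" and q: "q \<in> carrier M" "v = q \<otimes> d"
    using d by (auto simp: divides_opp_iff)
  have "a \<otimes> p \<otimes> d = x \<otimes> q \<otimes> d"
    using eq p q d ax by (simp add: m_assoc)
  then have pq: "a \<otimes> p = x \<otimes> q"
    using p q d ax by (intro r_cancel[of "a \<otimes> p" d "x \<otimes> q"]) auto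
  have "\<exists>w\<in>carrier M. s = p \<otimes> w \<and> t = q \<otimes> w"
    if st: "s \<in> carrier M" "t \<in> carrier M" "a \<otimes> s = x \<otimes> t" for s t
  proof -
    obtain g where g: "g \<in> carrier M" "g divides (a \<otimes> p)" "g divides (a \<otimes> s)"
      "\<And>y. y \<in> carrier M \<Longrightarrow> y divides (a \<otimes> p) \<Longrightarrow> y divides (a \<otimes> s) \<Longrightarrow> y divides g"
      using ex_gcd[of "a \<otimes> p" "a \<otimes> s"] ax p st by auto
    have "a divides g" by (rule g(4)[OF ax(1)]) (use p(1) st(1) in \<open>blast intro: dividesI\<close>)+
    then obtain k where k: "k \<in> carrier M" "g = a \<otimes> k" by (auto simp: factor_def)
    have "x divides g" by (rule g(4)[OF ax(2)]) (use q(1) pq st(2,3) in \<open>blast intro: dividesI\<close>)+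
    then obtain m where m: "m \<in> carrier M" "g = x \<otimes> m" by (auto simp: factor_def)
    obtain r where r: "r \<in> carrier M" "a \<otimes> p = g \<otimes> r" using g by (auto simp: factor_def)
    have pr: "p = k \<otimes> r"
      using r k ax p by (intro l_cancel[of a p "k \<otimes> r"]) (auto simp: m_assoc)
    have qr: "q = m \<otimes> r"
      using r m ax q pq by (intro l_cancel[of x q "m \<otimes> r"]) (auto simp: m_assoc)
    \<comment> \<open>\<open>u = k \<otimes> (r \<otimes> d)\<close> and
      \<open>v = m \<otimes> (r \<otimes> d)\<close>, so \<open>r \<otimes> d\<close> right divides
      both and hence their right gcd \<open>d\<close>. This forces \<open>r = \<one>\<close>, that
      is, the left gcd \<open>g\<close> of the two multiples is \<open>a \<otimes> p\<close>
      itself.\<close>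
    have "r \<otimes> d divides\<^bsub>opp M\<^esub> d"
      using d r k m p q pr qr by (intro d(4)) (auto simp: divides_opp_iff m_assoc)
    then obtain t' where t': "t' \<in> carrier M" "d = t' \<otimes> (r \<otimes> d)"
      by (auto simp: divides_opp_iff)
    then have "\<one> \<otimes> d = t' \<otimes> r \<otimes> d" using d r by (simp add: m_assoc)
    then have "\<one> = t' \<otimes> r"
      using t' r d by (intro r_cancel[of \<one> d "t' \<otimes> r"]) auto
    then have "r = \<one>" using prod_one[of t' r] t' r by simp
    then have "g = a \<otimes> p" using r g by simp
    then obtain w where w: "w \<in> carrier M" "a \<otimes> s = a \<otimes> p \<otimes> w"
      using g by (auto simp: factor_def)
    have "s = p \<otimes> w"
      using w ax p st by (intro l_cancel[of a s "p \<otimes> w"]) (auto simp: m_assoc)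
    moreover have "t = q \<otimes> w"
      using w ax q st pq by (intro l_cancel[of x t "q \<otimes> w"]) (auto simp: m_assoc)
    ultimately show ?thesis using w by blast
  qed
  then have "lcm_sq M a x p q" using ax p q pq by (auto simp: lcm_sq_def)
  then show thesis by (rule that)
qed

lemma lcm_sq_unique:
  assumes 1: "lcm_sq M a x x' b" and 2: "lcm_sq M a x y c"
  shows "x' = y" "b = c"
proof -
  note D = lcm_sqD[OF 1] lcm_sqD[OF 2]
  obtain w where w: "w \<in> carrier M" "y = x' \<otimes> w" "c = b \<otimes> w"
    using lcm_sq_least[OF 1] D by metis
  obtain v where v: "v \<in> carrier M" "x' = y \<otimes> v" "b = c \<otimes> v"
    using lcm_sq_least[OF 2] D by metis
  have "x' = x' \<otimes> w \<otimes> v"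
    by (subst w(2)[symmetric]) (rule v(2))
  then have "x' \<otimes> \<one> = x' \<otimes> (w \<otimes> v)"
    using w(1) v(1) D by (simp add: m_assoc)
  then have "\<one> = w \<otimes> v"
    using w(1) v(1) D by (intro l_cancel[of x' \<one> "w \<otimes> v"]) auto
  then have "w = \<one>" using prod_one[of w v] w(1) v(1) by simp
  then show "x' = y" "b = c" using w D by auto
qed

lemma lcm_sq_one: "a \<in> carrier M \<Longrightarrow> lcm_sq M a \<one> \<one> a"
  by (auto simp: lcm_sq_def)

text \<open>Divisibility becomes a special square, the one with remainder \<open>\<one>\<close>; so
  cancelling a common divisor and pulling through an lcm can be treated by one rule.\<close>

lemma lcm_sq_divides:
  assumes "x \<in> carrier M" "b \<in> carrier M"
  shows "lcm_sq M (x \<otimes> b) x \<one> b"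
  using assms unfolding lcm_sq_def by (auto simp: m_assoc dest: l_cancel)

text \<open>The squares share the side \<open>x1\<close>: what remains of \<open>x\<close> after
  \<open>c\<close> is carried on to \<open>y\<close>. With its converse \<open>lcm_sq_split\<close>
  this makes the lcm with a product computable factor by factor.\<close>

lemma lcm_sq_paste:
  assumes 1: "lcm_sq M c x x1 d" and 2: "lcm_sq M y x1 x' e"
  shows "lcm_sq M (c \<otimes> y) x x' (d \<otimes> e)"
proof -
  note D = lcm_sqD[OF 1] lcm_sqD[OF 2]
  have "c \<otimes> y \<otimes> x' = x \<otimes> (d \<otimes> e)"
    using D by (metis m_assoc)
  moreover have "\<exists>w\<in>carrier M. u = x' \<otimes> w \<and> v = d \<otimes> e \<otimes> w"
    if uv: "u \<in> carrier M" "v \<in> carrier M" "c \<otimes> y \<otimes> u = x \<otimes> v" for u v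
  proof -
    obtain w where w: "w \<in> carrier M" "y \<otimes> u = x1 \<otimes> w" "v = d \<otimes> w"
      using lcm_sq_least[OF 1, of "y \<otimes> u" v] D uv by (metis m_assoc m_closed)
    obtain z where "z \<in> carrier M" "u = x' \<otimes> z" "w = e \<otimes> z"
      using lcm_sq_least[OF 2, of u w] w uv by blast
    then show ?thesis using w D by (auto simp: m_assoc)
  qed
  ultimately show ?thesis using D by (auto simp: lcm_sq_def)
qed

text \<open>The big common multiple is also one of \<open>c\<close> and \<open>x\<close>, so the
  inner lcms exist; pasting them and uniqueness identify the result with the given square.\<close>

lemma lcm_sq_split:
  assumes 1: "lcm_sq M (c \<otimes> y) x x' b" and c: "c \<in> carrier M" "y \<in> carrier M"
  obtains x1 d e where "lcm_sq M c x x1 d" "lcm_sq M y x1 x' e" "b = d \<otimes> e"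
proof -
  note D = lcm_sqD[OF 1]
  have eq: "c \<otimes> (y \<otimes> x') = x \<otimes> b" using D c by (simp add: m_assoc)
  obtain x1 d where 2: "lcm_sq M c x x1 d"
    using ex_lcm_sq[OF c(1) D(2) _ _ eq] D c by auto
  obtain w where w: "w \<in> carrier M" "y \<otimes> x' = x1 \<otimes> w" "b = d \<otimes> w"
    using lcm_sq_least[OF 2 _ _ eq] D c by auto
  obtain x'' e where 3: "lcm_sq M y x1 x'' e"
    using ex_lcm_sq[OF c(2) _ D(3) w(1,2)] lcm_sqD[OF 2] by auto
  have "x' = x''" "b = d \<otimes> e"
    using lcm_sq_unique[OF 1 lcm_sq_paste[OF 2 3]] by auto
  then show thesis using that 2 3 by simp
qed

text \<open>Connects squares with \<open>lcmof\<close>, in which \<open>right_basic\<close> is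
  phrased.\<close>

lemma lcm_sq_iff_lcmof:
  assumes "a \<in> carrier M" "x \<in> carrier M" "x' \<in> carrier M" "b \<in> carrier M" "a \<otimes> x' = x \<otimes> b"
  shows "lcm_sq M a x x' b \<longleftrightarrow> (x \<otimes> b) lcmof a x"
proof
  assume "lcm_sq M a x x' b"
  then show "(x \<otimes> b) lcmof a x"
    unfolding islcm_def
  proof (intro conjI ballI impI)
    show "a divides (x \<otimes> b)" "x divides (x \<otimes> b)"
      using assms by (metis dividesI)+
    fix y assume y: "y \<in> carrier M" "a divides y \<and> x divides y"
    then obtain u v where uv: "u \<in> carrier M" "v \<in> carrier M" "y = a \<otimes> u" "y = x \<otimes> v"
      by (auto simp: factor_def)
    then obtain w where "w \<in> carrier M" "v = b \<otimes> w"
      using lcm_sq_least[OF \<open>lcm_sq M a x x' b\<close>, of u v] by metis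
    then show "(x \<otimes> b) divides y"
      using uv assms by (intro dividesI[of w]) (simp_all add: m_assoc)
  qed
next
  assume lcm: "(x \<otimes> b) lcmof a x"
  have "\<exists>w\<in>carrier M. u = x' \<otimes> w \<and> v = b \<otimes> w"
    if uv: "u \<in> carrier M" "v \<in> carrier M" "a \<otimes> u = x \<otimes> v" for u v
  proof -
    have "(x \<otimes> b) divides (x \<otimes> v)"
      using lcm uv(3) assms(2) uv(1,2) unfolding islcm_def
      by (metis assms(1) dividesI m_closed)
    then obtain w where w: "w \<in> carrier M" "x \<otimes> v = x \<otimes> b \<otimes> w" by (auto simp: factor_def)
    have "v = b \<otimes> w"
      using w assms uv by (intro l_cancel[of x v "b \<otimes> w"]) (auto simp: m_assoc)
    moreover have "u = x' \<otimes> w"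
      using w assms uv by (intro l_cancel[of a u "x' \<otimes> w"]) (auto simp: m_assoc[symmetric])
    ultimately show ?thesis using w by blast
  qed
  then show "lcm_sq M a x x' b" using assms by (auto simp: lcm_sq_def)
qed

end

section \<open>Critical pairs: squares on adjacent levels and on the same level\<close>

context gcd_mon
begin

text \<open>Here \<open>C \<otimes> y\<close> is an entry through which \<open>x\<close> is pulled,
  while its factor \<open>y\<close> is pulled in the other direction through the neighbour
  \<open>A\<close>. After the first move only the part \<open>e\<close> of \<open>b\<close> can
  still be pulled back; compared with the other order of moves, both affected entries lack the same
  left factor \<open>z\<close>.\<close>

lemma adjacent_squares:
  assumes 1: "lcm_sq M (C \<otimes> y) x x' b" and 2: "lcm_sq (opp M) A y y' b'" and C: "C \<in> carrier M"
  obtains x1 d e f g z where "lcm_sq M C x x1 d" "e \<in> carrier M" "b = d \<otimes> e"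
    "lcm_sq (opp M) (A \<otimes> x') e f g" "z \<in> carrier M" "y' = z \<otimes> f" "b' \<otimes> x1 = z \<otimes> g"
proof -
  interpret O: gcd_mon "opp M" using gcd_mon_axioms by (rule gcd_mon_opp)
  note D = lcm_sqD[OF 1] lcm_sqD[OF 2, simplified]
  obtain x1 d e where 3: "lcm_sq M C x x1 d" "lcm_sq M y x1 x' e" "b = d \<otimes> e"
    using lcm_sq_split[OF 1 C D(7)] by blast
  note E = lcm_sqD[OF 3(1)] lcm_sqD[OF 3(2)]
  have "y' \<otimes> (A \<otimes> x') = y' \<otimes> A \<otimes> x'" using D(6,8) E(8) by (simp add: m_assoc)
  also have "\<dots> = b' \<otimes> y \<otimes> x'" using D(10) by simp
  also have "\<dots> = b' \<otimes> (y \<otimes> x')" using D(9) E(6,8) by (simp add: m_assoc)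
  also have "\<dots> = b' \<otimes> x1 \<otimes> e" using D(9) E(6-10) by (simp add: m_assoc)
  finally have eq: "y' \<otimes> (A \<otimes> x') = b' \<otimes> x1 \<otimes> e" .
  obtain f g where 4: "lcm_sq (opp M) (A \<otimes> x') e f g"
    using O.ex_lcm_sq[of "A \<otimes> x'" e y' "b' \<otimes> x1"] eq D E by auto
  obtain z where "z \<in> carrier M" "y' = z \<otimes> f" "b' \<otimes> x1 = z \<otimes> g"
    using lcm_sq_least[OF 4, of y' "b' \<otimes> x1"] eq D E by auto
  then show thesis using that 3 4 E by blast
qed

end

locale ore_mon = gcd_mon +
  assumes three_Ore: "three_Ore M"

lemma ore_mon_opp: "ore_mon M \<Longrightarrow> ore_mon (opp M)"
  by (auto simp: ore_mon_def ore_mon_axioms_def three_Ore_def gcd_mon_opp)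

context ore_mon
begin

lemma common_multiple_three:
  assumes "a \<in> carrier M" "x \<in> carrier M" "y \<in> carrier M"
    and "u1 \<in> carrier M" "v1 \<in> carrier M" "a \<otimes> u1 = x \<otimes> v1"
    and "u2 \<in> carrier M" "v2 \<in> carrier M" "a \<otimes> u2 = y \<otimes> v2"
    and "u3 \<in> carrier M" "v3 \<in> carrier M" "x \<otimes> u3 = y \<otimes> v3"
  obtains p q r where "p \<in> carrier M" "q \<in> carrier M" "r \<in> carrier M"
    "a \<otimes> p = x \<otimes> q" "a \<otimes> p = y \<otimes> r"
proof -
  have pair: "common_right_multiple M {s, t}"
    if "s \<in> carrier M" "u \<in> carrier M" "v \<in> carrier M" "s \<otimes> u = t \<otimes> v" for s t u v
    unfolding common_right_multiple_def
  proof (rule bexI[of _ "s \<otimes> u"])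
    show "\<forall>r\<in>{s, t}. r divides (s \<otimes> u)"
      using that by (metis dividesI insertE singletonD)
  qed (use that(1,2) in blast)
  have "common_right_multiple M {a, x, y}"
    using three_Ore pair[of a u1 v1 x] pair[of x u3 v3 y] pair[of a u2 v2 y] assms
    unfolding three_Ore_def right_three_Ore_def by blast
  then show thesis
    using that unfolding common_right_multiple_def factor_def by force
qed

text \<open>
  The only place where the 3-Ore condition is used: \<open>a\<close>, \<open>x\<close> and \<open>y\<close> have pairwise common
  multiples, hence the lcms of \<open>a, x\<close> and of \<open>a, y\<close> both extend to the lcm of all three.
\<close>

lemma parallel_squares:
  assumes 1: "lcm_sq M a x x' b" and 2: "lcm_sq M a y y' b'"
    and c: "c \<in> carrier M" "c' \<in> carrier M" "x \<otimes> c = y \<otimes> c'"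
  obtains p q e s t d where "lcm_sq M b p s d" "lcm_sq M b' q t d" "x' \<otimes> s = y' \<otimes> t"
    "e \<in> carrier M" "c = p \<otimes> e" "c' = q \<otimes> e" "x' = \<one> \<Longrightarrow> y' = \<one> \<Longrightarrow> s = \<one> \<and> t = \<one>"
proof -
  note D = lcm_sqD[OF 1] lcm_sqD[OF 2]
  obtain p q where 3: "lcm_sq M x y p q" using ex_lcm_sq[OF D(2,7) c] by blast
  note E = lcm_sqD[OF 3]
  obtain e where e: "e \<in> carrier M" "c = p \<otimes> e" "c' = q \<otimes> e"
    using lcm_sq_least[OF 3 c] by blast
  obtain p0 q0 r0 where m: "p0 \<in> carrier M" "q0 \<in> carrier M" "r0 \<in> carrier M"
    "a \<otimes> p0 = x \<otimes> q0" "a \<otimes> p0 = y \<otimes> r0"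
    using common_multiple_three[OF D(1,2,7) D(3,4,5) D(8,9,10) c] by blast
  then obtain h where h: "h \<in> carrier M" "q0 = p \<otimes> h"
    using lcm_sq_least[OF 3, of q0 r0] by auto
  have "a \<otimes> p0 = x \<otimes> p \<otimes> h" using m(4) h E(1,3) by (simp add: m_assoc)
  then obtain z d where 4: "lcm_sq M a (x \<otimes> p) z d"
    using ex_lcm_sq[of a "x \<otimes> p" p0 h] D E m h by auto
  \<comment> \<open>Splitting the square of \<open>a\<close> against
    \<open>x \<otimes> p = x1 \<otimes> p1\<close> reproduces the given square of \<open>a\<close>
    against \<open>x1\<close>, by uniqueness; the second half is the wanted extension with the
    common corner \<open>d\<close>.\<close>
  have ext: "\<exists>s. lcm_sq M b0 p1 s d \<and> z = x0 \<otimes> s"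
    if sq: "lcm_sq M a x1 x0 b0" "p1 \<in> carrier M" "x \<otimes> p = x1 \<otimes> p1" for x1 x0 b0 p1
  proof -
    have "lcm_sq M (x1 \<otimes> p1) a d z" using lcm_sq_sym[OF 4] sq(3) by simp
    then obtain g h s where g: "lcm_sq M x1 a g h" "lcm_sq M p1 g d s" "z = h \<otimes> s"
      using lcm_sq_split[of x1 p1 a d z] sq(2) lcm_sqD(2)[OF sq(1)] by blast
    have "g = b0" "h = x0" using lcm_sq_unique[OF g(1) lcm_sq_sym[OF sq(1)]] by auto
    then show ?thesis using lcm_sq_sym[OF g(2)] g(3) by blast
  qed
  obtain s where s: "lcm_sq M b p s d" "z = x' \<otimes> s" using ext[OF 1, of p] E by auto
  obtain t where t: "lcm_sq M b' q t d" "z = y' \<otimes> t" using ext[OF 2, of q] E by auto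
  \<comment> \<open>If \<open>x\<close> and \<open>y\<close> both divide \<open>a\<close>, so does
    their lcm, and nothing remains of \<open>p\<close> and \<open>q\<close>. This serves the lowest
    level, where the dummy must not change.\<close>
  have "s = \<one> \<and> t = \<one>" if "x' = \<one>" "y' = \<one>"
  proof -
    have "x \<otimes> b = y \<otimes> b'" using D that by simp
    then obtain w where w: "w \<in> carrier M" "b = p \<otimes> w" "b' = q \<otimes> w"
      using lcm_sq_least[OF 3 D(4,9)] by blast
    have "lcm_sq M b p \<one> w" "lcm_sq M b' q \<one> w"
      using lcm_sq_divides[of p w] lcm_sq_divides[of q w] w E by auto
    then show ?thesis using lcm_sq_unique(1) s(1) t(1) by blast
  qed
  then show thesis using that[OF s(1) t(1) _ e] s t by simp
qed

end

section \<open>Multifraction reduction\<close>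

text \<open>
  The sequence \<open>a\<close> stands for the multifraction \<open>a 1 / a 2 / a 3 / \<dots>\<close>, that is, for the product
  \<open>a 1 \<cdot> (a 2)\<^sup>-\<^sup>1 \<cdot> a 3 \<cdot> (a 4)\<^sup>-\<^sup>1 \<dots>\<close>; almost all entries are \<open>\<one>\<close>, and \<open>a 0 = \<one>\<close> is a dummy.
  The entries of odd index are multiplied in \<open>M\<close>, those of even index in \<open>opp M\<close>; this makes the
  reduction rules of the two parities the same. Keeping the dummy constant (\<open>x' = \<one>\<close> if \<open>i = 0\<close>)
  turns the lowest rule into the simplification of \<open>a 1 / a 2\<close> by a common right divisor.
\<close>

definition lev :: "('a, 'b) monoid_scheme \<Rightarrow> nat \<Rightarrow> ('a, 'b) monoid_scheme" where
  "lev M i = (if even i then opp M else M)"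

lemma lev_simps [simp]:
  "carrier (lev M i) = carrier M" "\<one>\<^bsub>lev M i\<^esub> = \<one>\<^bsub>M\<^esub>"
  by (simp_all add: lev_def)

lemma lev_Suc: "lev M (Suc i) = opp (lev M i)"
  by (simp add: lev_def)

inductive step :: "('a, 'b) monoid_scheme \<Rightarrow> nat \<Rightarrow> 'a \<Rightarrow> (nat \<Rightarrow> 'a) \<Rightarrow> (nat \<Rightarrow> 'a) \<Rightarrow> bool"
  for M i x a where
  "\<lbrakk>lcm_sq (lev M i) (a (Suc i)) x x' b; c \<in> carrier M; a (Suc (Suc i)) = x \<otimes>\<^bsub>lev M i\<^esub> c;
    i = 0 \<longrightarrow> x' = \<one>\<^bsub>M\<^esub>\<rbrakk> \<Longrightarrow>
   step M i x a (a(i := a i \<otimes>\<^bsub>lev M i\<^esub> x', Suc i := b, Suc (Suc i) := c))"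

text \<open>A step with \<open>x = \<one>\<close> changes nothing; excluding it is what allows
  termination.\<close>

definition red :: "('a, 'b) monoid_scheme \<Rightarrow> (nat \<Rightarrow> 'a) \<Rightarrow> (nat \<Rightarrow> 'a) \<Rightarrow> bool" where
  "red M a b \<longleftrightarrow> (\<exists>i x. x \<noteq> \<one>\<^bsub>M\<^esub> \<and> step M i x a b)"

definition mf :: "('a, 'b) monoid_scheme \<Rightarrow> nat \<Rightarrow> (nat \<Rightarrow> 'a) set" where
  "mf M n = {a. (\<forall>k. a k \<in> carrier M) \<and> a 0 = \<one>\<^bsub>M\<^esub> \<and> (\<forall>k>n. a k = \<one>\<^bsub>M\<^esub>)}"

lemma stepI:
  assumes "lcm_sq (lev M i) (a (Suc i)) x x' b" "c \<in> carrier M"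
    "a (Suc (Suc i)) = x \<otimes>\<^bsub>lev M i\<^esub> c" "i = 0 \<Longrightarrow> x' = \<one>\<^bsub>M\<^esub>"
    "a' = a(i := a i \<otimes>\<^bsub>lev M i\<^esub> x', Suc i := b, Suc (Suc i) := c)"
  shows "step M i x a a'"
  unfolding assms(5) by (rule step.intros) (use assms in auto)

lemma gcd_mon_lev: "gcd_mon M \<Longrightarrow> gcd_mon (lev M i)"
  by (simp add: lev_def gcd_mon_opp)

lemma ore_mon_lev: "ore_mon M \<Longrightarrow> ore_mon (lev M i)"
  by (simp add: lev_def ore_mon_opp)

context gcd_mon
begin

text \<open>The divisors that close a confluence diagram may turn out to be \<open>\<one>\<close>;
  such a step is the identity and counts as a reduction of length zero.\<close>

lemma step_imp_red:
  assumes a: "a \<in> mf M n" and "step M i x a b"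
  shows "(red M)\<^sup>*\<^sup>* a b"
proof (cases "x = \<one>")
  case False
  then have "red M a b" using assms by (auto simp: red_def)
  then show ?thesis by blast
next
  case True
  interpret L: gcd_mon "lev M i" using gcd_mon_axioms by (rule gcd_mon_lev)
  have a: "a k \<in> carrier M" for k using a by (simp add: mf_def)
  from assms(2) have "b = a"
  proof cases
    case (1 x' b' c)
    have "x' = \<one>" "b' = a (Suc i)"
      using L.lcm_sq_unique[OF 1(2) L.lcm_sq_one[of "a (Suc i)", simplified, folded True]] a True
      by auto
    then show ?thesis using 1 True a L.l_one L.r_one by (auto simp: fun_eq_iff)
  qed
  then show ?thesis by simp
qed

text \<open>Nothing spreads beyond \<open>n\<close>: where the entry to be divided is
  \<open>\<one>\<close>, the divisor is \<open>\<one>\<close> and the step is the identity.\<close>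

lemma step_mf:
  assumes a: "a \<in> mf M n" and "step M i x a b"
  shows "b \<in> mf M n"
  using assms(2)
proof cases
  case (1 x' b' c)
  interpret L: gcd_mon "lev M i" using gcd_mon_axioms by (rule gcd_mon_lev)
  note D = lcm_sqD[OF 1(2), simplified]
  have car: "a k \<in> carrier M" for k using a by (simp add: mf_def)
  have "b k \<in> carrier M" for k
    using 1 D car L.m_closed by auto
  moreover have "b 0 = \<one>" using 1 a L.r_one by (auto simp: mf_def)
  moreover have "b k = \<one>" if k: "k > n" for k
  proof -
    have z: "a k = \<one>" "a (Suc k) = \<one>" "a (Suc (Suc k)) = \<one>" using k a by (auto simp: mf_def)
    have *: "x = \<one> \<and> c = \<one>" if "a (Suc (Suc i)) = \<one>"
      using L.prod_one[of x c] that 1 D by simp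
    have **: "x' = \<one> \<and> b' = a (Suc i)" if "x = \<one>"
      using L.lcm_sq_unique[OF 1(2)[unfolded that] L.lcm_sq_one[of "a (Suc i)", unfolded lev_simps]] car
      by simp
    consider "k = i" | "k = Suc i" | "k = Suc (Suc i)" | "k \<notin> {i, Suc i, Suc (Suc i)}" by blast
    then show ?thesis
    proof cases
      case 1
      then show ?thesis using \<open>b = _\<close> z * ** L.l_one by simp
    next
      case 2
      then show ?thesis using \<open>b = _\<close> z * ** by simp
    next
      case 3
      then show ?thesis using \<open>b = _\<close> z * by simp
    next
      case 4
      then show ?thesis using \<open>b = _\<close> z by simp
    qed
  qed
  ultimately show ?thesis by (simp add: mf_def)
qed

lemma red_mf: "a \<in> mf M n \<Longrightarrow> red M a b \<Longrightarrow> b \<in> mf M n"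
  unfolding red_def using step_mf by blast

lemma reds_mf: "(red M)\<^sup>*\<^sup>* a b \<Longrightarrow> a \<in> mf M n \<Longrightarrow> b \<in> mf M n"
  by (induction rule: rtranclp_induct) (auto intro: red_mf)

end

section \<open>Local confluence of the reduction\<close>

context ore_mon
begin

text \<open>The distance of the levels decides. From three on, the steps act on disjoint entries; at
  two they act on opposite ends of one entry; at zero \<open>parallel_squares\<close> applies, at
  one \<open>adjacent_squares\<close>.\<close>

lemma local_confluence_le:
  assumes a: "a \<in> mf M n" and up: "step M i x a b" and low: "step M j y a b'" and le: "j \<le> i"
  shows "\<exists>d. (red M)\<^sup>*\<^sup>* b d \<and> (red M)\<^sup>*\<^sup>* b' d"
proof -
  have mf: "b \<in> mf M n" "b' \<in> mf M n" using step_mf a up low by blast+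
  have car: "a k \<in> carrier M" for k using a by (simp add: mf_def)
  interpret L: ore_mon "lev M i" using ore_mon_axioms by (rule ore_mon_lev)
  from up obtain x' bx cx where u: "lcm_sq (lev M i) (a (Suc i)) x x' bx" "cx \<in> carrier M"
    "a (Suc (Suc i)) = x \<otimes>\<^bsub>lev M i\<^esub> cx" "i = 0 \<longrightarrow> x' = \<one>"
    "b = a(i := a i \<otimes>\<^bsub>lev M i\<^esub> x', Suc i := bx, Suc (Suc i) := cx)"
    by (auto elim: step.cases)
  from low obtain y' by' cy where l: "lcm_sq (lev M j) (a (Suc j)) y y' by'" "cy \<in> carrier M"
    "a (Suc (Suc j)) = y \<otimes>\<^bsub>lev M j\<^esub> cy" "j = 0 \<longrightarrow> y' = \<one>"
    "b' = a(j := a j \<otimes>\<^bsub>lev M j\<^esub> y', Suc j := by', Suc (Suc j) := cy)"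
    by (auto elim: step.cases)
  note U = lcm_sqD[OF u(1), simplified]
  note W = lcm_sqD[OF l(1), simplified]
  consider (same) "j = i" | (adj) "i = Suc j" | (two) "i = Suc (Suc j)"
    | (far) "i > Suc (Suc j)"
    using le by linarith
  then show ?thesis
  proof cases
    case same
    have l': "lcm_sq (lev M i) (a (Suc i)) y y' by'" "x \<otimes>\<^bsub>lev M i\<^esub> cx = y \<otimes>\<^bsub>lev M i\<^esub> cy"
      using l(1,3) u(3) same by auto
    obtain p q e s t d where *: "lcm_sq (lev M i) bx p s d" "lcm_sq (lev M i) by' q t d"
      "x' \<otimes>\<^bsub>lev M i\<^esub> s = y' \<otimes>\<^bsub>lev M i\<^esub> t" "e \<in> carrier M"
      "cx = p \<otimes>\<^bsub>lev M i\<^esub> e" "cy = q \<otimes>\<^bsub>lev M i\<^esub> e" "x' = \<one> \<Longrightarrow> y' = \<one> \<Longrightarrow> s = \<one> \<and> t = \<one>"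
      by (rule L.parallel_squares[OF u(1) l'(1) _ _ l'(2), unfolded lev_simps, OF u(2) l(2)])
        (rule that)
    note E = lcm_sqD[OF *(1), simplified] lcm_sqD[OF *(2), simplified]
    let ?d = "a(i := a i \<otimes>\<^bsub>lev M i\<^esub> (x' \<otimes>\<^bsub>lev M i\<^esub> s), Suc i := d, Suc (Suc i) := e)"
    have assoc: "a i \<otimes>\<^bsub>lev M i\<^esub> x' \<otimes>\<^bsub>lev M i\<^esub> s = a i \<otimes>\<^bsub>lev M i\<^esub> (x' \<otimes>\<^bsub>lev M i\<^esub> s)"
      "a i \<otimes>\<^bsub>lev M i\<^esub> y' \<otimes>\<^bsub>lev M i\<^esub> t = a i \<otimes>\<^bsub>lev M i\<^esub> (x' \<otimes>\<^bsub>lev M i\<^esub> s)"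
      using U(3) W(3) E(3,8) car L.m_assoc *(3) by simp_all
    have st: "s = \<one> \<and> t = \<one>" if "i = 0" using *(7) u(4) l(4) same that by simp
    have "step M i p b ?d"
      by (rule stepI[where x' = s and b = d and c = e])
        (use *(1,4,5) u(5) st assoc(1) in \<open>simp_all add: fun_eq_iff\<close>)
    moreover have "step M i q b' ?d"
      by (rule stepI[where x' = t and b = d and c = e])
        (use *(2,4,6) l(5) st assoc(2) same in \<open>simp_all add: fun_eq_iff\<close>)
    ultimately show ?thesis using step_imp_red mf by blast
  next
    case two
    have lev: "lev M i = lev M j" using two by (simp add: lev_Suc)
    have prod: "cy \<otimes>\<^bsub>lev M j\<^esub> x' \<in> carrier M"
      "y \<otimes>\<^bsub>lev M j\<^esub> cy \<otimes>\<^bsub>lev M j\<^esub> x' = y \<otimes>\<^bsub>lev M j\<^esub> (cy \<otimes>\<^bsub>lev M j\<^esub> x')"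
      using L.m_closed[of cy x'] L.m_assoc[of y cy x'] l(2) U W unfolding lev by simp_all
    note u = u[unfolded lev]
    let ?d = "b(j := b j \<otimes>\<^bsub>lev M j\<^esub> y', Suc j := by', Suc (Suc j) := cy \<otimes>\<^bsub>lev M j\<^esub> x')"
    have "step M j y b ?d"
      by (rule stepI[where x' = y' and b = by' and c = "cy \<otimes>\<^bsub>lev M j\<^esub> x'"])
        (use u(5) l(1,3,4) two prod in simp_all)
    moreover have "step M i x b' ?d"
      by (rule stepI[where x' = x' and b = bx and c = cx, unfolded lev])
        (use u l(5) two in \<open>simp_all add: fun_eq_iff lev_Suc\<close>)
    ultimately show ?thesis using step_imp_red mf by blast
  next
    case far
    let ?d = "b(j := b j \<otimes>\<^bsub>lev M j\<^esub> y', Suc j := by', Suc (Suc j) := cy)"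
    have "step M j y b ?d"
      by (rule stepI[where x' = y' and b = by' and c = cy]) (use u(5) l(1-4) far in simp_all)
    moreover have "step M i x b' ?d"
      by (rule stepI[where x' = x' and b = bx and c = cx])
        (use u l(5) far in \<open>simp_all add: fun_eq_iff\<close>)
    ultimately show ?thesis using step_imp_red mf by blast
  next
    case adj
    have lev: "lev M j = opp (lev M i)" using adj by (simp add: lev_Suc)
    have sq: "lcm_sq (lev M i) (cy \<otimes>\<^bsub>lev M i\<^esub> y) x x' bx" "lcm_sq (opp (lev M i)) (a i) y y' by'"
      using u(1) l(1,3) adj lev by auto
    obtain x1 d e f g z where *: "lcm_sq (lev M i) cy x x1 d" "e \<in> carrier M"
      "bx = d \<otimes>\<^bsub>lev M i\<^esub> e" "lcm_sq (opp (lev M i)) (a i \<otimes>\<^bsub>lev M i\<^esub> x') e f g" "z \<in> carrier M"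
      "y' = z \<otimes>\<^bsub>lev M i\<^esub> f" "by' \<otimes>\<^bsub>lev M i\<^esub> x1 = z \<otimes>\<^bsub>lev M i\<^esub> g"
      by (rule L.adjacent_squares[OF sq, unfolded lev_simps, OF l(2)]) (rule that)
    note E = lcm_sqD[OF *(1), simplified] lcm_sqD[OF *(4), simplified]
    \<comment> \<open>At \<open>j = 0\<close> the remainder \<open>y'\<close> is
      \<open>\<one>\<close>, and so are its factors; the dummy entry is not touched.\<close>
    have y0: "z = \<one> \<and> f = \<one>" if "j = 0" using L.prod_one[of z f] * E l that by simp
    let ?d = "a(j := f \<otimes>\<^bsub>lev M i\<^esub> a j, i := g, Suc i := d, Suc (Suc i) := cx)"
    let ?e = "a(j := y' \<otimes>\<^bsub>lev M i\<^esub> a j, i := by' \<otimes>\<^bsub>lev M i\<^esub> x1, Suc i := d, Suc (Suc i) := cx)"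
    have "step M j e b ?d"
      by (rule stepI[where x' = f and b = g and c = d])
        (use u(5) *(3,4) E(4) y0 lev adj in \<open>simp_all add: fun_eq_iff\<close>)
    then have "(red M)\<^sup>*\<^sup>* b ?d" using step_imp_red mf by blast
    moreover have s: "step M i x b' ?e"
      by (rule stepI[where x' = x1 and b = d and c = cx])
        (use u(2,3) l(5) *(1) lev adj in \<open>simp_all add: fun_eq_iff\<close>)
    then have "(red M)\<^sup>*\<^sup>* b' ?e" using step_imp_red mf by blast
    \<comment> \<open>The two results differ by the common factor \<open>z\<close> of entries
      \<open>j\<close> and \<open>i\<close>. One more division, at level \<open>j - 1\<close>,
      removes it; for \<open>j = 0\<close> there is nothing to remove.\<close>
    moreover have "(red M)\<^sup>*\<^sup>* ?e ?d"
    proof (cases j)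
      case 0
      then have "?e = ?d" using y0 * E car L.l_one L.m_closed by (auto simp: fun_eq_iff)
      then show ?thesis by simp
    next
      case (Suc k)
      have lev': "lev M k = lev M i" using Suc adj by (simp add: lev_Suc)
      have "step M k z ?e ?d"
      proof (rule stepI[where x' = \<one> and b = "f \<otimes>\<^bsub>lev M i\<^esub> a j" and c = g])
        have "y' \<otimes>\<^bsub>lev M i\<^esub> a j = z \<otimes>\<^bsub>lev M i\<^esub> (f \<otimes>\<^bsub>lev M i\<^esub> a j)"
          using * E car L.m_assoc by simp
        then show "lcm_sq (lev M k) (?e (Suc k)) z \<one> (f \<otimes>\<^bsub>lev M i\<^esub> a j)"
          using L.lcm_sq_divides[of z "f \<otimes>\<^bsub>lev M i\<^esub> a j"] * E car L.m_closed Suc lev' adj by simp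
      qed (use * E car L.r_one Suc lev' adj in \<open>auto simp: fun_eq_iff\<close>)
      then show ?thesis using step_imp_red step_mf[OF mf(2) s] by blast
    qed
    ultimately show ?thesis by (meson rtranclp_trans)
  qed
qed

lemma local_confluence:
  assumes "a \<in> mf M n" "red M a b" "red M a c"
  shows "\<exists>d. (red M)\<^sup>*\<^sup>* b d \<and> (red M)\<^sup>*\<^sup>* c d"
proof -
  obtain i x j y where "step M i x a b" "step M j y a c" using assms by (auto simp: red_def)
  then show ?thesis
    using local_confluence_le[OF assms(1), of i x b j y c]
      local_confluence_le[OF assms(1), of j y c i x b] by (meson nle_le)
qed

end

subsection \<open>Termination and confluence\<close>

text \<open>Relative to a closed set \<open>S\<close>, because termination and local confluence are
  established only for sequences that are multifractions.\<close>

lemma newman: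
  assumes wf: "wf {(b, a). a \<in> S \<and> R a b}"
    and closed: "\<And>a b. a \<in> S \<Longrightarrow> R a b \<Longrightarrow> b \<in> S"
    and local: "\<And>a b c. a \<in> S \<Longrightarrow> R a b \<Longrightarrow> R a c \<Longrightarrow> \<exists>d. R\<^sup>*\<^sup>* b d \<and> R\<^sup>*\<^sup>* c d"
  shows "a \<in> S \<Longrightarrow> R\<^sup>*\<^sup>* a b \<Longrightarrow> R\<^sup>*\<^sup>* a c \<Longrightarrow> \<exists>d. R\<^sup>*\<^sup>* b d \<and> R\<^sup>*\<^sup>* c d"
proof (induction a arbitrary: b c rule: wf_induct_rule[OF wf])
  case (1 a)
  show ?case
  proof (cases "a = b \<or> a = c")
    case True
    then show ?thesis using 1 by blast
  next
    case False
    obtain b1 c1 where b1: "R a b1" "R\<^sup>*\<^sup>* b1 b" and c1: "R a c1" "R\<^sup>*\<^sup>* c1 c"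
      using 1 False by (metis converse_rtranclpE)
    obtain d where d: "R\<^sup>*\<^sup>* b1 d" "R\<^sup>*\<^sup>* c1 d" using local 1 b1 c1 by blast
    obtain e where e: "R\<^sup>*\<^sup>* b e" "R\<^sup>*\<^sup>* d e" using 1 b1 d closed by blast
    have "R\<^sup>*\<^sup>* c1 e" using d e by simp
    then obtain f where "R\<^sup>*\<^sup>* e f" "R\<^sup>*\<^sup>* c f" using 1 c1 closed by blast
    then show ?thesis using e by (meson rtranclp_trans)
  qed
qed

definition mfs :: "('a, 'b) monoid_scheme \<Rightarrow> (nat \<Rightarrow> 'a) set" where
  "mfs M = (\<Union>n. mf M n)"

definition joinable :: "('a, 'b) monoid_scheme \<Rightarrow> (nat \<Rightarrow> 'a) \<Rightarrow> (nat \<Rightarrow> 'a) \<Rightarrow> bool" where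
  "joinable M a b \<longleftrightarrow> (\<exists>d. (red M)\<^sup>*\<^sup>* a d \<and> (red M)\<^sup>*\<^sup>* b d)"

locale noeth_ore_mon = ore_mon +
  assumes noeth: "strongly_noetherian M"

lemma noeth_ore_mon_opp: "noeth_ore_mon M \<Longrightarrow> noeth_ore_mon (opp M)"
  unfolding noeth_ore_mon_def noeth_ore_mon_axioms_def strongly_noetherian_def
  by (simp add: ore_mon_opp) (metis add.commute)

context noeth_ore_mon
begin

text \<open>
  A step at level \<open>i\<close> shortens entry \<open>i + 2\<close> and fixes all later ones, so the lengths of the
  entries, read from the right, decrease lexicographically.
\<close>

lemma wf_red_mf: "wf {(b, a). a \<in> mf M n \<and> red M a b}"
proof -
  obtain l :: "'a \<Rightarrow> nat" where
    l: "\<And>a b. a \<in> carrier M \<Longrightarrow> b \<in> carrier M \<Longrightarrow> l (a \<otimes> b) \<ge> l a + l b"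
       "\<And>a. a \<in> carrier M \<Longrightarrow> a \<noteq> \<one> \<Longrightarrow> l a > 0"
    using noeth not_unit_iff unfolding strongly_noetherian_def by metis
  define f where "f a = map (l \<circ> a) (rev [0..<Suc n])" for a
  have "(f b, f a) \<in> lex less_than" if a: "a \<in> mf M n" and red: "red M a b" for a b
  proof -
    from red obtain i x where x: "x \<noteq> \<one>" "step M i x a b" by (auto simp: red_def)
    from x(2) obtain x' b' c where u: "lcm_sq (lev M i) (a (Suc i)) x x' b'" "c \<in> carrier M"
      "a (Suc (Suc i)) = x \<otimes>\<^bsub>lev M i\<^esub> c"
      "b = a(i := a i \<otimes>\<^bsub>lev M i\<^esub> x', Suc i := b', Suc (Suc i) := c)"
      by (auto elim: step.cases)
    interpret L: gcd_mon "lev M i" using gcd_mon_axioms by (rule gcd_mon_lev)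
    have xc: "x \<in> carrier M" using lcm_sqD(2)[OF u(1)] by simp
    have "a (Suc (Suc i)) \<noteq> \<one>" using L.prod_one[of x c] xc u(2,3) x(1) by auto
    then have le: "Suc (Suc i) \<le> n" using a unfolding mf_def by (auto simp: not_le[symmetric])
    have "l c < l (a (Suc (Suc i)))"
      using l(1)[of x c] l(1)[of c x] l(2)[of x] xc u(2,3) x(1) by (auto simp: lev_def)
    then have less: "l (b (Suc (Suc i))) < l (a (Suc (Suc i)))" using u(4) by simp
    have "[0..<Suc n] = [0..<Suc (Suc i)] @ Suc (Suc i) # [Suc (Suc (Suc i))..<Suc n]"
      using le upt_add_eq_append[of 0 "Suc (Suc i)" "Suc n - Suc (Suc i)"]
        upt_conv_Cons[of "Suc (Suc i)" "Suc n"] by (simp del: upt_Suc)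
    then have split: "rev [0..<Suc n] =
        rev [Suc (Suc (Suc i))..<Suc n] @ Suc (Suc i) # rev [0..<Suc (Suc i)]"
      by (simp del: upt_Suc)
    have eq: "map (l \<circ> b) (rev [Suc (Suc (Suc i))..<Suc n]) =
        map (l \<circ> a) (rev [Suc (Suc (Suc i))..<Suc n])"
      using u(4) by (simp del: upt_Suc)
    show ?thesis
      unfolding f_def split map_append list.map eq
      by (rule lex_append_leftI) (use less in simp)
  qed
  then have "{(b, a). a \<in> mf M n \<and> red M a b} \<subseteq> inv_image (lex less_than) f" by auto
  then show ?thesis by (rule wf_subset[rotated]) (simp add: wf_lex)
qed

text \<open>A descending chain never leaves the depth \<open>n\<close> of its first member, so the
  bounded case suffices.\<close>

lemma wf_red: "wf {(b, a). a \<in> mfs M \<and> red M a b}"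
  unfolding wf_iff_no_infinite_down_chain
proof
  assume "\<exists>f. \<forall>i. (f (Suc i), f i) \<in> {(b, a). a \<in> mfs M \<and> red M a b}"
  then obtain f where f: "f i \<in> mfs M" "red M (f i) (f (Suc i))" for i by auto
  obtain n where "f 0 \<in> mf M n" using f by (auto simp: mfs_def)
  then have "f i \<in> mf M n" for i by (induction i) (auto intro: red_mf f)
  then have "\<forall>i. (f (Suc i), f i) \<in> {(b, a). a \<in> mf M n \<and> red M a b}" using f by auto
  then show False using wf_red_mf[of n] unfolding wf_iff_no_infinite_down_chain by blast
qed

lemma red_mfs: "a \<in> mfs M \<Longrightarrow> red M a b \<Longrightarrow> b \<in> mfs M"
  unfolding mfs_def using red_mf by blast

lemma confluence:
  assumes "a \<in> mfs M" "(red M)\<^sup>*\<^sup>* a b" "(red M)\<^sup>*\<^sup>* a c"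
  shows "joinable M b c"
  unfolding joinable_def
proof (rule newman[OF wf_red red_mfs _ assms])
  show "\<exists>d. (red M)\<^sup>*\<^sup>* b d \<and> (red M)\<^sup>*\<^sup>* c d" if "a \<in> mfs M" "red M a b" "red M a c" for a b c
    using that local_confluence by (auto simp: mfs_def)
qed

lemma joinable_refl: "joinable M a a"
  by (auto simp: joinable_def)

lemma joinable_sym: "joinable M a b \<Longrightarrow> joinable M b a"
  by (auto simp: joinable_def)

text \<open>Confluence at the middle term joins the two reducts. Only thus is joinability an
  equivalence that can absorb the group congruence.\<close>

lemma joinable_trans:
  assumes b: "b \<in> mfs M" and "joinable M a b" "joinable M b c"
  shows "joinable M a c"
proof -
  obtain d e where d: "(red M)\<^sup>*\<^sup>* a d" "(red M)\<^sup>*\<^sup>* b d" and e: "(red M)\<^sup>*\<^sup>* b e" "(red M)\<^sup>*\<^sup>* c e"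
    using assms by (auto simp: joinable_def)
  obtain f where "(red M)\<^sup>*\<^sup>* d f" "(red M)\<^sup>*\<^sup>* e f"
    using confluence[OF b d(2) e(1)] by (auto simp: joinable_def)
  then show ?thesis using d e unfolding joinable_def by (meson rtranclp_trans)
qed

lemma reds_joinable: "(red M)\<^sup>*\<^sup>* a b \<Longrightarrow> joinable M a b"
  by (auto simp: joinable_def)

lemma red_ones: "\<not> red M (\<lambda>_. \<one>) b"
proof
  assume "red M (\<lambda>_. \<one>) b"
  then obtain i x where x: "x \<noteq> \<one>" "step M i x (\<lambda>_. \<one>) b" by (auto simp: red_def)
  interpret L: gcd_mon "lev M i" using gcd_mon_axioms by (rule gcd_mon_lev)
  from x(2) show False
    by cases (use L.prod_one x(1) in \<open>auto dest!: lcm_sqD(2) simp: eq_commute[of \<one>]\<close>)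
qed

text \<open>The sequence of ones is irreducible, so by confluence any single maximal reduction gives
  the answer; the algorithm is free in its choice of steps.\<close>

lemma joinable_ones_iff:
  assumes a: "a \<in> mfs M" and b: "(red M)\<^sup>*\<^sup>* a b" and nf: "\<And>c. \<not> red M b c"
  shows "joinable M a (\<lambda>_. \<one>) \<longleftrightarrow> b = (\<lambda>_. \<one>)"
proof
  assume "joinable M a (\<lambda>_. \<one>)"
  then obtain d where d: "(red M)\<^sup>*\<^sup>* a d" "(red M)\<^sup>*\<^sup>* (\<lambda>_. \<one>) d" by (auto simp: joinable_def)
  have "d = (\<lambda>_. \<one>)" using d(2) red_ones by (metis converse_rtranclpE)
  then obtain e where "(red M)\<^sup>*\<^sup>* b e" "(red M)\<^sup>*\<^sup>* (\<lambda>_. \<one>) e"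
    using confluence[OF a b d(1)] by (auto simp: joinable_def)
  then show "b = (\<lambda>_. \<one>)" using nf red_ones by (metis converse_rtranclpE)
next
  assume "b = (\<lambda>_. \<one>)"
  then show "joinable M a (\<lambda>_. \<one>)" using b by (simp add: reds_joinable)
qed

end

subsection \<open>Words as multifractions\<close>

text \<open>Entries are prepended in pairs to preserve parity, on which the multiplication of each
  level depends.\<close>

definition push :: "('a, 'b) monoid_scheme \<Rightarrow> 'a \<Rightarrow> 'a \<Rightarrow> (nat \<Rightarrow> 'a) \<Rightarrow> nat \<Rightarrow> 'a" where
  "push M p q s k = (if k = 0 then \<one>\<^bsub>M\<^esub> else if k = 1 then p else if k = 2 then q else s (k - 2))"

text \<open>A gap of two ones after position \<open>j\<close>, again preserving parity. Reduction
  moves it to the right until it merges with the trailing ones.\<close>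

definition pad :: "('a, 'b) monoid_scheme \<Rightarrow> nat \<Rightarrow> (nat \<Rightarrow> 'a) \<Rightarrow> nat \<Rightarrow> 'a" where
  "pad M j s k = (if k \<le> j then s k else if k \<le> Suc (Suc j) then \<one>\<^bsub>M\<^esub> else s (k - 2))"

primrec word_mf :: "('a, 'b) monoid_scheme \<Rightarrow> ('a \<times> bool) list \<Rightarrow> nat \<Rightarrow> 'a" where
  "word_mf M [] = (\<lambda>_. \<one>\<^bsub>M\<^esub>)"
| "word_mf M (x # w) =
     (if snd x then push M (fst x) \<one>\<^bsub>M\<^esub> (word_mf M w) else push M \<one>\<^bsub>M\<^esub> (fst x) (word_mf M w))"

context noeth_ore_mon
begin

lemma push_mf:
  assumes "s \<in> mf M n" "p \<in> carrier M" "q \<in> carrier M"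
  shows "push M p q s \<in> mf M (Suc (Suc n))"
  using assms by (auto simp: mf_def push_def)

lemma pad_mf: "s \<in> mf M n \<Longrightarrow> pad M j s \<in> mf M (Suc (Suc n))"
  by (auto simp: mf_def pad_def)

lemma word_mf_mf: "set w \<subseteq> carrier M \<times> UNIV \<Longrightarrow> word_mf M w \<in> mf M (2 * length w)"
proof (induction w)
  case Nil
  then show ?case by (simp add: mf_def)
next
  case (Cons x w)
  then show ?case by (auto intro!: push_mf)
qed

lemma word_mf_mfs: "set w \<subseteq> carrier M \<times> UNIV \<Longrightarrow> word_mf M w \<in> mfs M"
  using word_mf_mf by (auto simp: mfs_def)

lemma step_push:
  assumes pq: "p \<in> carrier M" "q \<in> carrier M" and "step M i x s s'"
  shows "step M (Suc (Suc i)) x (push M p q s) (push M p q s')"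
  using assms(3)
proof cases
  case (1 x' b c)
  interpret L: gcd_mon "lev M i" using gcd_mon_axioms by (rule gcd_mon_lev)
  have "q \<otimes>\<^bsub>lev M i\<^esub> \<one> = q" using L.r_one[of q] pq by simp
  then show ?thesis
    by (intro stepI[where x' = x' and b = b and c = c])
      (use 1 in \<open>auto simp: push_def lev_Suc fun_eq_iff\<close>)
qed

lemma reds_push:
  assumes "p \<in> carrier M" "q \<in> carrier M" "(red M)\<^sup>*\<^sup>* s s'"
  shows "(red M)\<^sup>*\<^sup>* (push M p q s) (push M p q s')"
  using assms(3)
proof (induction rule: rtranclp_induct)
  case (step y z)
  then have "red M (push M p q y) (push M p q z)"
    using step_push[OF assms(1,2)] unfolding red_def by blast
  then show ?case using step by simp
qed simp

lemma joinable_push: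
  assumes "p \<in> carrier M" "q \<in> carrier M" "joinable M s s'"
  shows "joinable M (push M p q s) (push M p q s')"
  using assms reds_push unfolding joinable_def by meson

text \<open>The entry behind the gap is pulled whole through the second \<open>\<one>\<close> into
  the first one; the gap thereby moves one place on.\<close>

lemma reds_pad_Suc:
  assumes s: "s \<in> mf M n"
  shows "(red M)\<^sup>*\<^sup>* (pad M j s) (pad M (Suc j) s)"
proof -
  interpret L: gcd_mon "lev M (Suc j)" using gcd_mon_axioms by (rule gcd_mon_lev)
  have car: "s k \<in> carrier M" for k using s by (simp add: mf_def)
  have "step M (Suc j) (s (Suc j)) (pad M j s) (pad M (Suc j) s)"
  proof (rule stepI[where x' = "s (Suc j)" and b = \<one> and c = \<one>])
    show "lcm_sq (lev M (Suc j)) (pad M j s (Suc (Suc j))) (s (Suc j)) (s (Suc j)) \<one>"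
      using lcm_sq_sym[OF L.lcm_sq_one[of "s (Suc j)"]] car by (simp add: pad_def)
    show "pad M j s (Suc (Suc (Suc j))) = s (Suc j) \<otimes>\<^bsub>lev M (Suc j)\<^esub> \<one>"
      using L.r_one[of "s (Suc j)"] car by (simp add: pad_def)
    have "\<one> \<otimes>\<^bsub>lev M (Suc j)\<^esub> s (Suc j) = s (Suc j)"
      using L.l_one[of "s (Suc j)"] car by simp
    then show "pad M (Suc j) s = (pad M j s)(Suc j := pad M j s (Suc j) \<otimes>\<^bsub>lev M (Suc j)\<^esub> s (Suc j),
        Suc (Suc j) := \<one>, Suc (Suc (Suc j)) := \<one>)"
      by (auto simp: pad_def fun_eq_iff not_le less_Suc_eq le_Suc_eq)
  qed auto
  then show ?thesis using step_imp_red pad_mf[OF s] by blast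
qed

lemma reds_pad:
  assumes s: "s \<in> mf M n"
  shows "(red M)\<^sup>*\<^sup>* (pad M j s) s"
proof -
  have "(red M)\<^sup>*\<^sup>* (pad M j s) (pad M (j + m) s)" for m
    by (induction m) (simp, metis add_Suc_right reds_pad_Suc[OF s] rtranclp_trans)
  moreover have "pad M (j + n) s = s"
    using s by (auto simp: pad_def mf_def fun_eq_iff)
  ultimately show ?thesis by metis
qed

text \<open>For \<open>a\<close> followed by its inverse, the gap between them is closed and the
  lowest rule cancels \<open>a / a\<close>. In the other order the two entries are neighbours
  already and cancel at level 1, leaving only ones to be absorbed.\<close>

lemma joinable_cancel:
  assumes s: "s \<in> mf M n" and a: "a \<in> carrier M"
  shows "joinable M (push M a \<one> (push M \<one> a s)) s" "joinable M (push M \<one> a (push M a \<one> s)) s"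
proof -
  have car: "s k \<in> carrier M" for k using s by (simp add: mf_def)
  note mf = push_mf[OF push_mf[OF s]] push_mf[OF s]
  have pad0: "push M \<one> \<one> s = pad M 0 s" if "s \<in> mf M m" for s m
    using that by (auto simp: push_def pad_def mf_def fun_eq_iff)
  have "push M a \<one> (push M \<one> a s) = pad M 1 (push M a a s)"
    by (auto simp: push_def pad_def fun_eq_iff numeral_2_eq_2)
  then have "(red M)\<^sup>*\<^sup>* (push M a \<one> (push M \<one> a s)) (push M a a s)"
    using reds_pad[OF push_mf[OF s a a]] by simp
  moreover interpret O: gcd_mon "opp M" using gcd_mon_axioms by (rule gcd_mon_opp)
  have "step M 0 a (push M a a s) (push M \<one> \<one> s)"
    by (rule stepI[where x' = \<one> and b = \<one> and c = \<one>])
      (use O.lcm_sq_divides[of a \<one>] a in \<open>auto simp: lev_def push_def fun_eq_iff\<close>)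
  then have "(red M)\<^sup>*\<^sup>* (push M a a s) (push M \<one> \<one> s)"
    using step_imp_red[OF push_mf[OF s a a]] by blast
  moreover have "(red M)\<^sup>*\<^sup>* (push M \<one> \<one> s) s"
    using reds_pad[OF s] pad0[OF s] by simp
  ultimately show "joinable M (push M a \<one> (push M \<one> a s)) s"
    by (meson reds_joinable rtranclp_trans)
  have t: "push M \<one> \<one> s \<in> mf M (Suc (Suc n))" using s by (simp add: push_mf)
  have "step M 1 a (push M \<one> a (push M a \<one> s)) (push M \<one> \<one> (push M \<one> \<one> s))"
    by (rule stepI[where x' = \<one> and b = \<one> and c = \<one>])
      (use lcm_sq_divides[of a \<one>] a in \<open>auto simp: lev_def push_def fun_eq_iff numeral_2_eq_2\<close>)
  then have "(red M)\<^sup>*\<^sup>* (push M \<one> a (push M a \<one> s)) (push M \<one> \<one> (push M \<one> \<one> s))"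
    using step_imp_red[OF mf(1)] a by blast
  moreover have "(red M)\<^sup>*\<^sup>* (push M \<one> \<one> (push M \<one> \<one> s)) (push M \<one> \<one> s)"
    using reds_pad[OF t] pad0[OF t] by simp
  ultimately show "joinable M (push M \<one> a (push M a \<one> s)) s"
    using \<open>(red M)\<^sup>*\<^sup>* (push M \<one> \<one> s) s\<close> by (meson reds_joinable rtranclp_trans)
qed

text \<open>\<open>b\<close> is pulled whole through the trivial denominator of \<open>a\<close>;
  what is left is the product followed by a gap.\<close>

lemma joinable_mult:
  assumes s: "s \<in> mf M n" and a: "a \<in> carrier M" "b \<in> carrier M"
  shows "joinable M (push M a \<one> (push M b \<one> s)) (push M (a \<otimes> b) \<one> s)"
proof -
  have "step M 1 b (push M a \<one> (push M b \<one> s)) (pad M 2 (push M (a \<otimes> b) \<one> s))"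
    by (rule stepI[where x' = b and b = \<one> and c = \<one>])
      (use lcm_sq_sym[OF lcm_sq_one[of b]] a in
        \<open>auto simp: lev_def push_def pad_def fun_eq_iff numeral_2_eq_2\<close>)
  then have "(red M)\<^sup>*\<^sup>* (push M a \<one> (push M b \<one> s)) (pad M 2 (push M (a \<otimes> b) \<one> s))"
    using step_imp_red[OF push_mf[OF push_mf[OF s]]] a by blast
  moreover have "(red M)\<^sup>*\<^sup>* (pad M 2 (push M (a \<otimes> b) \<one> s)) (push M (a \<otimes> b) \<one> s)"
    using reds_pad[OF push_mf[OF s]] a by simp
  ultimately show ?thesis by (meson reds_joinable rtranclp_trans)
qed

lemma joinable_word_mf_append:
  assumes "set u \<subseteq> carrier M \<times> UNIV" "joinable M (word_mf M v) (word_mf M w)"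
  shows "joinable M (word_mf M (u @ v)) (word_mf M (u @ w))"
  using assms by (induction u) (auto intro: joinable_push)

text \<open>Each defining relation is realised by reductions behind a common prefix, and joinability
  is an equivalence. This is the direction that depends on confluence.\<close>

lemma env_rel_joinable: "(u, v) \<in> env_rel M \<Longrightarrow> joinable M (word_mf M u) (word_mf M v)"
proof (induction rule: env_rel.induct)
  case (refl u)
  show ?case by (rule joinable_refl)
next
  case (sym u v)
  then show ?case by (blast intro: joinable_sym)
next
  case (trans u v w)
  then show ?case
    using env_rel_words[OF monoid_axioms, of u v] by (blast intro: joinable_trans word_mf_mfs)
next
  case (cancel a u v e)
  show ?case
    by (rule joinable_word_mf_append)
      (use cancel joinable_cancel[OF word_mf_mf[of v]] in auto)
next
  case (mult a b u v)
  show ?case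
    by (rule joinable_word_mf_append)
      (use mult joinable_mult[OF word_mf_mf[of v]] in auto)
qed

end

subsection \<open>The element represented by a multifraction\<close>

text \<open>Product of the entries with index below the last argument, dummy included. For a
  multifraction these partial products are eventually constant, and only that eventual value is of
  interest.\<close>

primrec mf_val :: "('g, 'c) monoid_scheme \<Rightarrow> ('a \<Rightarrow> 'g) \<Rightarrow> (nat \<Rightarrow> 'a) \<Rightarrow> nat \<Rightarrow> 'g" where
  "mf_val G f a 0 = \<one>\<^bsub>G\<^esub>"
| "mf_val G f a (Suc n) = mf_val G f a n \<otimes>\<^bsub>G\<^esub> letter_value G f (a n, odd n)"

lemma (in group) div_swap:
  assumes "p \<in> carrier G" "x \<in> carrier G" "q \<in> carrier G" "b \<in> carrier G" "p \<otimes> x = q \<otimes> b"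
  shows "x \<otimes> inv b = inv p \<otimes> q"
proof -
  have "p \<otimes> (x \<otimes> inv b) = q" using assms by (simp add: m_assoc[symmetric]) (simp add: m_assoc)
  then show ?thesis using assms by (metis inv_solve_left inv_closed m_closed)
qed

context gcd_mon
begin

context
  fixes G :: "('g, 'c) monoid_scheme" and f
  assumes G: "group G" and f: "f \<in> hom M G"
begin

interpretation G: group G by (rule G)

lemma hom_image_closed: "a \<in> carrier M \<Longrightarrow> f a \<in> carrier G"
  using f by (rule hom_in_carrier)

lemma hom_one_group: "f \<one> = \<one>\<^bsub>G\<^esub>"
proof -
  have "f \<one> \<otimes>\<^bsub>G\<^esub> f \<one> = f \<one>" using hom_mult[OF f, of \<one> \<one>] by simp
  then show ?thesis using hom_image_closed by simp
qed

lemma letter_closed: "a \<in> carrier M \<Longrightarrow> letter_value G f (a, e) \<in> carrier G"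
  using hom_image_closed by (simp add: letter_value_def)

lemma mf_val_closed: "(\<And>k. a k \<in> carrier M) \<Longrightarrow> mf_val G f a n \<in> carrier G"
  by (induction n) (auto intro: letter_closed)

text \<open>The lcm equation, read in the group as in \<open>div_swap\<close>, moves
  \<open>x\<close> across the middle entry. Agreement holds once all three altered entries are
  multiplied in, hence \<open>i + 3\<close>.\<close>

lemma step_mf_val:
  assumes a: "a \<in> mf M m" and st: "step M i x a b"
  shows "mf_val G f a (i + 3 + n) = mf_val G f b (i + 3 + n)"
proof (induction n)
  case 0
  have car: "a k \<in> carrier M" for k using a by (simp add: mf_def)
  from st obtain x' b' c where u: "lcm_sq (lev M i) (a (Suc i)) x x' b'" "c \<in> carrier M"
    "a (Suc (Suc i)) = x \<otimes>\<^bsub>lev M i\<^esub> c"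
    "b = a(i := a i \<otimes>\<^bsub>lev M i\<^esub> x', Suc i := b', Suc (Suc i) := c)"
    by (auto elim: step.cases)
  note D = lcm_sqD[OF u(1)]
  have "mf_val G f b k = mf_val G f a k" if "k \<le> i" for k
    using that u(4) by (induction k) auto
  then have *: "mf_val G f b i = mf_val G f a i" by simp
  have b: "b i = a i \<otimes>\<^bsub>lev M i\<^esub> x'" "b (Suc i) = b'" "b (Suc (Suc i)) = c"
    using u(4) by simp_all
  have v: "mf_val G f a i \<in> carrier G" using mf_val_closed[of a] car by blast
  have c: "f (a i) \<in> carrier G" "f (a (Suc i)) \<in> carrier G" "f x \<in> carrier G" "f x' \<in> carrier G"
    "f b' \<in> carrier G" "f c \<in> carrier G"
    using D u(2) car by (auto intro: hom_image_closed)
  show ?case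
  proof (cases "even i")
    case True
    have e: "f x' \<otimes>\<^bsub>G\<^esub> f (a (Suc i)) = f b' \<otimes>\<^bsub>G\<^esub> f x"
      using D True hom_mult[OF f] car by (metis lev_def opp_simps(1,3))
    then have sw: "f (a (Suc i)) \<otimes>\<^bsub>G\<^esub> inv\<^bsub>G\<^esub> (f x) = inv\<^bsub>G\<^esub> (f x') \<otimes>\<^bsub>G\<^esub> f b'"
      using c by (intro G.div_swap) auto
    have "inv\<^bsub>G\<^esub> (f (a i)) \<otimes>\<^bsub>G\<^esub> f (a (Suc i)) \<otimes>\<^bsub>G\<^esub> inv\<^bsub>G\<^esub> (f c \<otimes>\<^bsub>G\<^esub> f x) =
        inv\<^bsub>G\<^esub> (f (a i)) \<otimes>\<^bsub>G\<^esub> (f (a (Suc i)) \<otimes>\<^bsub>G\<^esub> inv\<^bsub>G\<^esub> (f x)) \<otimes>\<^bsub>G\<^esub> inv\<^bsub>G\<^esub> (f c)"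
      using c by (simp add: G.m_assoc G.inv_mult_group)
    also have "\<dots> = inv\<^bsub>G\<^esub> (f x' \<otimes>\<^bsub>G\<^esub> f (a i)) \<otimes>\<^bsub>G\<^esub> f b' \<otimes>\<^bsub>G\<^esub> inv\<^bsub>G\<^esub> (f c)"
      unfolding sw using c by (simp add: G.m_assoc G.inv_mult_group)
    finally show ?thesis
      using True u(2,3) b D * v c hom_mult[OF f] car
      by (simp add: letter_value_def lev_def numeral_3_eq_3 G.m_assoc)
  next
    case False
    have e: "f (a (Suc i)) \<otimes>\<^bsub>G\<^esub> f x' = f x \<otimes>\<^bsub>G\<^esub> f b'"
      using D False hom_mult[OF f] car by (metis lev_def)
    then have sw: "f x' \<otimes>\<^bsub>G\<^esub> inv\<^bsub>G\<^esub> (f b') = inv\<^bsub>G\<^esub> (f (a (Suc i))) \<otimes>\<^bsub>G\<^esub> f x"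
      using c by (intro G.div_swap) auto
    have "f (a i) \<otimes>\<^bsub>G\<^esub> inv\<^bsub>G\<^esub> (f (a (Suc i))) \<otimes>\<^bsub>G\<^esub> (f x \<otimes>\<^bsub>G\<^esub> f c) =
        f (a i) \<otimes>\<^bsub>G\<^esub> (inv\<^bsub>G\<^esub> (f (a (Suc i))) \<otimes>\<^bsub>G\<^esub> f x) \<otimes>\<^bsub>G\<^esub> f c"
      using c by (simp add: G.m_assoc)
    also have "\<dots> = f (a i) \<otimes>\<^bsub>G\<^esub> f x' \<otimes>\<^bsub>G\<^esub> inv\<^bsub>G\<^esub> (f b') \<otimes>\<^bsub>G\<^esub> f c"
      unfolding sw[symmetric] using c by (simp add: G.m_assoc)
    finally show ?thesis
      using False u(2,3) b D * v c hom_mult[OF f] car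
      by (simp add: letter_value_def lev_def numeral_3_eq_3 G.m_assoc)
  qed
next
  case (Suc n)
  have "b (i + 3 + n) = a (i + 3 + n)" using st by cases auto
  then show ?case using Suc by (simp only: add_Suc_right mf_val.simps)
qed

text \<open>Each step preserves only the partial products beyond its own level, so a finite chain
  preserves them eventually.\<close>

lemma reds_mf_val:
  assumes "(red M)\<^sup>*\<^sup>* a b" "a \<in> mf M m"
  shows "\<forall>\<^sub>F n in sequentially. mf_val G f a n = mf_val G f b n"
  using assms
proof (induction rule: rtranclp_induct)
  case (step b c)
  then obtain i x where s: "step M i x b c" by (auto simp: red_def)
  have "\<forall>\<^sub>F n in sequentially. mf_val G f b n = mf_val G f c n"
  proof (rule eventually_sequentiallyI[of "i + 3"])
    fix n assume "i + 3 \<le> n"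
    then show "mf_val G f b n = mf_val G f c n"
      using step_mf_val[OF reds_mf[OF step(1,4)] s, of "n - (i + 3)"] by simp
  qed
  with step show ?case by (auto elim: eventually_elim2)
qed simp

lemma mf_val_ones: "mf_val G f (\<lambda>_. \<one>) n = \<one>\<^bsub>G\<^esub>"
proof (induction n)
  case (Suc n)
  have "letter_value G f (\<one>, e) = \<one>\<^bsub>G\<^esub>" for e by (simp add: letter_value_def hom_one_group)
  from this[of "odd n"] Suc show ?case by simp
qed simp

lemma mf_val_push:
  assumes s: "s \<in> mf M m" and pq: "p \<in> carrier M" "q \<in> carrier M"
  shows "mf_val G f (push M p q s) (n + 3) = f p \<otimes>\<^bsub>G\<^esub> (inv\<^bsub>G\<^esub> (f q) \<otimes>\<^bsub>G\<^esub> mf_val G f s (Suc n))"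
proof (induction n)
  case 0
  then show ?case
    using s pq hom_image_closed by (simp add: mf_def push_def numeral_3_eq_3 numeral_2_eq_2 letter_value_def hom_one_group)
next
  case (Suc n)
  have car: "s k \<in> carrier M" for k using s by (simp add: mf_def)
  have "push M p q s (n + 3) = s (Suc n)" by (simp add: push_def)
  then have "mf_val G f (push M p q s) (Suc n + 3) =
      mf_val G f (push M p q s) (n + 3) \<otimes>\<^bsub>G\<^esub> letter_value G f (s (Suc n), odd (Suc n))"
    using mf_val.simps(2)[of G f "push M p q s" "n + 3"] by simp
  then show ?case
    using Suc pq car mf_val_closed[of s "Suc n"] letter_closed[of "s (Suc n)"] hom_image_closed
    by (simp add: G.m_assoc mf_val.simps(2)[of _ _ _ "Suc n"] del: mf_val.simps(2))
qed

end

end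

context noeth_ore_mon
begin

lemma mf_val_word_mf:
  assumes G: "group G" and f: "f \<in> hom M G" and "set w \<subseteq> carrier M \<times> UNIV"
  shows "mf_val G f (word_mf M w) (2 * length w + Suc n) = word_value G f w"
  using assms(3)
proof (induction w)
  case Nil
  then show ?case using mf_val_ones[OF G f] by (simp add: word_value_def del: mf_val.simps)
next
  case (Cons x w)
  interpret G: group G by (rule G)
  have mf: "word_mf M w \<in> mf M (2 * length w)" using Cons by (intro word_mf_mf) auto
  have IH: "mf_val G f (word_mf M w) (Suc (2 * length w + n)) = word_value G f w"
    using Cons by simp
  have v: "word_value G f w \<in> carrier G"
    using Cons by (intro word_value_closed[OF monoid_axioms G f]) auto
  obtain a e where x: "x = (a, e)" "a \<in> carrier M" using Cons.prems by (cases x) auto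
  note push = mf_val_push[OF G f mf, of _ _ "2 * length w + n", unfolded IH]
  have "mf_val G f (word_mf M (x # w)) (2 * length w + n + 3) = word_value G f (x # w)"
    using push[of a \<one>] push[of \<one> a] x v hom_in_carrier[OF f] hom_one_group[OF G f]
    by (simp add: word_value_def letter_value_def del: mf_val.simps)
  moreover have "2 * length (x # w) + Suc n = 2 * length w + n + 3" by simp
  ultimately show ?case by (simp only:)
qed

lemma word_value_enveloping:
  assumes "set w \<subseteq> carrier M \<times> UNIV"
  shows "word_value (enveloping_group M) (env_map M) w = env_rel M `` {w}"
  using assms
proof (induction w)
  case Nil
  then show ?case by (simp add: word_value_def enveloping_one)
next
  case (Cons x w)
  interpret E: group "enveloping_group M" by (rule group_enveloping_group[OF monoid_axioms])
  obtain a e where x: "x = (a, e)" by (cases x)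
  have a: "a \<in> carrier M" using Cons x by auto
  have "letter_value (enveloping_group M) (env_map M) (a, e) = env_rel M `` {[(a, e)]}"
  proof (cases e)
    case True
    then show ?thesis by (simp add: letter_value_def env_map_def)
  next
    case False
    have "env_rel M `` {[(a, False)]} \<otimes>\<^bsub>enveloping_group M\<^esub> env_map M a =
        \<one>\<^bsub>enveloping_group M\<^esub>"
      using a env_rel_class_eq[OF monoid_axioms env_rel.cancel[of a M "[]" "[]" False]]
      by (simp add: env_map_def enveloping_mult[OF monoid_axioms] enveloping_one)
    then have "inv\<^bsub>enveloping_group M\<^esub> (env_map M a) = env_rel M `` {[(a, False)]}"
      using a by (intro E.inv_equality) (auto simp: env_map_def enveloping_class_closed)
    then show ?thesis using False by (simp add: letter_value_def)
  qed
  then show ?case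
    using Cons x enveloping_mult[OF monoid_axioms, of "[(a, e)]" w] by (simp add: word_value_def)
qed

text \<open>Forward, the congruence is contained in joinability. Backward, the ones are irreducible,
  so the word reduces to them, and its eventual partial product in the group is preserved.\<close>

theorem word_value_one_iff:
  assumes w: "set w \<subseteq> carrier M \<times> UNIV"
  shows "word_value (enveloping_group M) (env_map M) w = \<one>\<^bsub>enveloping_group M\<^esub> \<longleftrightarrow>
    joinable M (word_mf M w) (\<lambda>_. \<one>)"
proof
  assume "word_value (enveloping_group M) (env_map M) w = \<one>\<^bsub>enveloping_group M\<^esub>"
  then have "env_rel M `` {w} = env_rel M `` {[]}"
    using word_value_enveloping[OF w] by (simp add: enveloping_one)
  then have "(w, []) \<in> env_rel M"
    by (rule eq_equiv_class[OF _ equiv_env_rel[OF monoid_axioms]]) simp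
  then show "joinable M (word_mf M w) (\<lambda>_. \<one>)" using env_rel_joinable by fastforce
next
  let ?val = "mf_val (enveloping_group M) (env_map M)"
  note EG = group_enveloping_group[OF monoid_axioms] env_map_hom[OF monoid_axioms]
  assume "joinable M (word_mf M w) (\<lambda>_. \<one>)"
  then obtain d where d: "(red M)\<^sup>*\<^sup>* (word_mf M w) d" "(red M)\<^sup>*\<^sup>* (\<lambda>_. \<one>) d"
    by (auto simp: joinable_def)
  have "d = (\<lambda>_. \<one>)" using d(2) red_ones by (metis converse_rtranclpE)
  then have "\<forall>\<^sub>F n in sequentially. ?val (word_mf M w) n = \<one>\<^bsub>enveloping_group M\<^esub>"
    using reds_mf_val[OF EG d(1) word_mf_mf[OF w]] mf_val_ones[OF EG] by simp
  then obtain k where "\<And>n. n \<ge> k \<Longrightarrow> ?val (word_mf M w) n = \<one>\<^bsub>enveloping_group M\<^esub>"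
    by (auto simp: eventually_sequentially)
  from this[of "2 * length w + Suc k"] show
    "word_value (enveloping_group M) (env_map M) w = \<one>\<^bsub>enveloping_group M\<^esub>"
    using mf_val_word_mf[OF EG w, of k] by simp
qed

end

section \<open>Computable functions\<close>

text \<open>Codes are onto as well as injective: every number decodes to something, so no test for
  valid codes is ever needed and totality over all numbers is totality over all arguments.\<close>

class encodable =
  fixes enc :: "'a \<Rightarrow> nat"
  assumes bij_enc: "bij enc"

definition dec :: "nat \<Rightarrow> 'a::encodable" where
  "dec = inv_into UNIV enc"

lemma dec_enc [simp]: "dec (enc x) = x"
  by (simp add: dec_def bij_enc bij_is_inj)

lemma enc_dec [simp]: "enc (dec n) = n"
  unfolding dec_def by (rule f_inv_into_f) (use bij_enc in \<open>auto simp: bij_def\<close>)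

lemma enc_eq_iff [simp]: "enc x = enc y \<longleftrightarrow> x = y"
  using bij_enc by (auto simp: bij_def inj_def)

instantiation nat :: encodable
begin
definition enc_nat :: "nat \<Rightarrow> nat" where "enc_nat n = n"
instance by standard (simp add: enc_nat_def bij_def inj_def surj_def)
end

instantiation prod :: (encodable, encodable) encodable
begin
definition enc_prod :: "'a \<times> 'b \<Rightarrow> nat" where "enc_prod p = prod_encode (enc (fst p), enc (snd p))"
instance
proof
  have "surj (enc :: 'a \<times> 'b \<Rightarrow> nat)"
    by (rule surjI[of _ "\<lambda>n. (dec (fst (prod_decode n)), dec (snd (prod_decode n)))"])
      (simp add: enc_prod_def)
  then show "bij (enc :: 'a \<times> 'b \<Rightarrow> nat)"
    by (auto simp: bij_def inj_def enc_prod_def prod_eq_iff)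
qed
end

instantiation list :: (encodable) encodable
begin
definition enc_list :: "'a list \<Rightarrow> nat" where "enc_list xs = list_encode (map enc xs)"
instance
proof
  have "surj (enc :: 'a list \<Rightarrow> nat)"
    by (rule surjI[of _ "\<lambda>n. map dec (list_decode n)"]) (simp add: enc_list_def o_def)
  moreover have "inj (enc :: 'a list \<Rightarrow> nat)"
    by (auto simp: inj_def enc_list_def list_encode_eq dest!: map_injective[rotated])
  ultimately show "bij (enc :: 'a list \<Rightarrow> nat)" by (simp add: bij_def)
qed
end

lemma enc_Nil: "enc [] = 0"
  by (simp add: enc_list_def)

lemma enc_Cons: "enc (x # xs) = Suc (enc (x, xs))"
  by (simp add: enc_list_def enc_prod_def)

definition computable :: "('a::encodable \<Rightarrow> 'b::encodable) \<Rightarrow> bool" where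
  "computable f \<longleftrightarrow> recursive_fn (Suc 0) (\<lambda>xs. enc (f (dec (xs ! 0))))"

definition computable_pred :: "('a::encodable \<Rightarrow> bool) \<Rightarrow> bool" where
  "computable_pred P \<longleftrightarrow> computable (\<lambda>x. of_bool (P x) :: nat)"

subsection \<open>Arithmetic\<close>

lemma recursive_fn_comp1:
  assumes "recursive_fn (Suc 0) (\<lambda>xs. F (xs ! 0))" "recursive_fn k f"
  shows "recursive_fn k (\<lambda>xs. F (f xs))"
  using recursive_fn.comp[of "[f]" "\<lambda>xs. F (xs ! 0)" k] assms by simp

lemma recursive_fn_comp2:
  assumes "recursive_fn 2 (\<lambda>xs. F (xs ! 0) (xs ! 1))" "recursive_fn k f" "recursive_fn k g"
  shows "recursive_fn k (\<lambda>xs. F (f xs) (g xs))"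
  using recursive_fn.comp[of "[f, g]" "\<lambda>xs. F (xs ! 0) (xs ! 1)" k] assms
  by (simp add: numeral_2_eq_2)

lemma recursive_fn_Suc: "recursive_fn k f \<Longrightarrow> recursive_fn k (\<lambda>xs. Suc (f xs))"
  using recursive_fn_comp1[of Suc k f] recursive_fn.succ by simp

lemma recursive_fn_const: "recursive_fn k (\<lambda>xs. c)"
  by (induction c) (auto intro: recursive_fn.zero recursive_fn_Suc)

lemma length_2: "length xs = 2 \<longleftrightarrow> (\<exists>a b. xs = [a, b])"
  by (auto simp: numeral_2_eq_2 length_Suc_conv)

lemma recursive_fn_rec_nat:
  assumes f: "recursive_fn (Suc 0) (\<lambda>xs. f (xs ! 0))"
    and g: "recursive_fn 3 (\<lambda>xs. g (xs ! 0) (xs ! 1) (xs ! 2))"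
  shows "recursive_fn 2 (\<lambda>xs. rec_nat (f (xs ! 1)) (\<lambda>n r. g n r (xs ! 1)) (xs ! 0))"
proof -
  have "recursive_fn (1 + 1) (\<lambda>xs. rec_nat (f (tl xs ! 0))
      (\<lambda>n r. g ((n # r # tl xs) ! 0) ((n # r # tl xs) ! 1) ((n # r # tl xs) ! 2)) (hd xs))"
    using recursive_fn.prec[of 1 "\<lambda>xs. f (xs ! 0)" "\<lambda>xs. g (xs ! 0) (xs ! 1) (xs ! 2)"] assms
    by (simp add: numeral_3_eq_3)
  then have "recursive_fn 2 (\<lambda>xs. rec_nat (f (tl xs ! 0))
      (\<lambda>n r. g ((n # r # tl xs) ! 0) ((n # r # tl xs) ! 1) ((n # r # tl xs) ! 2)) (hd xs))"
    by (simp add: numeral_2_eq_2)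
  then show ?thesis
    by (rule recursive_fn.ext) (auto simp: length_2)
qed

lemma recursive_fn_add:
  assumes "recursive_fn k f" "recursive_fn k g"
  shows "recursive_fn k (\<lambda>xs. f xs + g xs)"
proof (rule recursive_fn_comp2[OF _ assms])
  have *: "rec_nat b (\<lambda>n r. Suc r) a = a + b" for a b :: nat by (induction a) auto
  show "recursive_fn 2 (\<lambda>xs. xs ! 0 + xs ! 1)"
    using recursive_fn_rec_nat[of "\<lambda>x. x" "\<lambda>n r _. Suc r"]
    by (simp add: * recursive_fn.proj recursive_fn_Suc)
qed

lemma recursive_fn_pred:
  assumes "recursive_fn k f"
  shows "recursive_fn k (\<lambda>xs. f xs - Suc 0)"
proof (rule recursive_fn_comp2[of "\<lambda>a b. a - Suc 0", OF _ assms assms])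
  have *: "rec_nat 0 (\<lambda>n r. n) a = a - Suc 0" for a :: nat by (cases a) auto
  show "recursive_fn 2 (\<lambda>xs. xs ! 0 - Suc 0)"
    using recursive_fn_rec_nat[of "\<lambda>x. 0" "\<lambda>n r _. n"]
    by (simp add: * recursive_fn.proj recursive_fn.zero)
qed

lemma recursive_fn_diff:
  assumes "recursive_fn k f" "recursive_fn k g"
  shows "recursive_fn k (\<lambda>xs. f xs - g xs)"
proof (rule recursive_fn_comp2[of "\<lambda>a b. b - a", OF _ assms(2,1)])
  have *: "rec_nat b (\<lambda>n r. r - Suc 0) a = b - a" for a b :: nat by (induction a) auto
  show "recursive_fn 2 (\<lambda>xs. xs ! 1 - xs ! 0)"
    using recursive_fn_rec_nat[of "\<lambda>x. x" "\<lambda>n r _. r - Suc 0"] recursive_fn_pred[of 3 "\<lambda>xs. xs ! 1"]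
    by (simp add: * recursive_fn.proj)
qed

lemma recursive_fn_triangle:
  assumes "recursive_fn k f"
  shows "recursive_fn k (\<lambda>xs. triangle (f xs))"
proof (rule recursive_fn_comp2[of "\<lambda>a b. triangle a", OF _ assms assms])
  have *: "rec_nat 0 (\<lambda>n r. r + Suc n) a = triangle a" for a by (induction a) auto
  show "recursive_fn 2 (\<lambda>xs. triangle (xs ! 0))"
    using recursive_fn_rec_nat[of "\<lambda>x. 0" "\<lambda>n r _. r + Suc n"]
    by (simp only: *) (simp add: recursive_fn_add recursive_fn_Suc recursive_fn.proj recursive_fn.zero)
qed

lemma recursive_fn_if:
  assumes "recursive_fn k c" "recursive_fn k f" "recursive_fn k g"
  shows "recursive_fn k (\<lambda>xs. if c xs = 0 then f xs else g xs)"
proof -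
  have *: "rec_nat 0 (\<lambda>n r. b) a = (if a = 0 then 0 else b)" for a b :: nat by (cases a) auto
  have mask: "recursive_fn 2 (\<lambda>xs. if xs ! 0 = 0 then 0 else xs ! 1)"
    using recursive_fn_rec_nat[of "\<lambda>x. 0" "\<lambda>n r b. b"]
    by (simp only: *) (simp add: recursive_fn.proj recursive_fn.zero)
  \<comment> \<open>Each branch is masked to \<open>0\<close> where the condition excludes it, and
    the two are added; \<open>1 - c xs\<close> is \<open>0\<close> exactly when \<open>c xs\<close>
    is not.\<close>
  have "recursive_fn k (\<lambda>xs. (if 1 - c xs = 0 then 0 else f xs) + (if c xs = 0 then 0 else g xs))"
    using assms
    by (intro recursive_fn_add recursive_fn_comp2[of "\<lambda>a b. if a = 0 then 0 else b", OF mask]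
        recursive_fn_diff recursive_fn_const)
  then show ?thesis by (rule recursive_fn.ext) auto
qed

lemma recursive_fn_prod_encode:
  assumes "recursive_fn k f" "recursive_fn k g"
  shows "recursive_fn k (\<lambda>xs. prod_encode (f xs, g xs))"
  using assms unfolding prod_encode_def
  by (simp add: recursive_fn_add recursive_fn_triangle)

text \<open>\<open>n = triangle s + i\<close> with \<open>i \<le> s\<close> encodes the pair \<open>(i, s - i)\<close>.\<close>

definition diagonal :: "nat \<Rightarrow> nat" where
  "diagonal n = (LEAST s. Suc n - triangle (Suc s) = 0)"

lemma diagonal_prod_encode: "diagonal (prod_encode (a, b)) = a + b"
  unfolding diagonal_def
proof (rule Least_equality)
  show "Suc (prod_encode (a, b)) - triangle (Suc (a + b)) = 0"
    by (simp add: prod_encode_def)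
  fix s assume s: "Suc (prod_encode (a, b)) - triangle (Suc s) = 0"
  show "a + b \<le> s"
  proof (rule ccontr)
    assume "\<not> a + b \<le> s"
    then have "Suc s \<le> a + b" by simp
    then have "triangle (Suc s) \<le> triangle (a + b)"
      by (rule lift_Suc_mono_le[rotated]) simp
    then show False using s by (simp add: prod_encode_def)
  qed
qed

lemma fst_prod_decode: "fst (prod_decode n) = n - triangle (diagonal n)"
  and snd_prod_decode: "snd (prod_decode n) = diagonal n - (n - triangle (diagonal n))"
proof -
  obtain a b where n: "n = prod_encode (a, b)" by (metis prod_decode_inverse surj_pair)
  show "fst (prod_decode n) = n - triangle (diagonal n)"
    "snd (prod_decode n) = diagonal n - (n - triangle (diagonal n))"
    by (simp_all add: n diagonal_prod_encode) (simp_all add: prod_encode_def)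
qed

lemma le_triangle: "n \<le> triangle n"
  by (induction n) auto

lemma recursive_fn_diagonal:
  assumes "recursive_fn k f"
  shows "recursive_fn k (\<lambda>xs. diagonal (f xs))"
proof (rule recursive_fn_comp1[OF _ assms])
  have "recursive_fn (1 + 1) (\<lambda>xs. Suc (xs ! 1) - triangle (Suc (xs ! 0)))"
    by (intro recursive_fn_diff recursive_fn_triangle recursive_fn_Suc recursive_fn.proj) auto
  then have "recursive_fn 1
      (\<lambda>xs. LEAST n. Suc ((n # xs) ! 1) - triangle (Suc ((n # xs) ! 0)) = 0)"
  proof (rule recursive_fn.mu, intro allI impI exI)
    fix xs :: "nat list"
    show "Suc ((xs ! 0 # xs) ! 1) - triangle (Suc ((xs ! 0 # xs) ! 0)) = 0"
      using le_triangle[of "Suc (xs ! 0)"] by simp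
  qed
  then show "recursive_fn (Suc 0) (\<lambda>xs. diagonal (xs ! 0))" by (simp add: diagonal_def)
qed

lemma recursive_fn_fst_decode:
  "recursive_fn k f \<Longrightarrow> recursive_fn k (\<lambda>xs. fst (prod_decode (f xs)))"
  unfolding fst_prod_decode
  by (intro recursive_fn_diff recursive_fn_triangle recursive_fn_diagonal)

lemma recursive_fn_snd_decode:
  "recursive_fn k f \<Longrightarrow> recursive_fn k (\<lambda>xs. snd (prod_decode (f xs)))"
  unfolding snd_prod_decode
  by (intro recursive_fn_diff recursive_fn_triangle recursive_fn_diagonal)

subsection \<open>Closure properties\<close>

lemma computableI:
  fixes f :: "'a::encodable \<Rightarrow> 'b::encodable"
  assumes "recursive_fn (Suc 0) (\<lambda>xs. F (xs ! 0))" "\<And>x. F (enc x) = enc (f x)"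
  shows "computable f"
proof -
  have "F n = enc (f (dec n))" for n using assms(2)[of "dec n"] by simp
  then show ?thesis using assms(1) by (simp add: computable_def)
qed

lemma computableE:
  assumes "computable f"
  obtains F where "\<And>k g. recursive_fn k g \<Longrightarrow> recursive_fn k (\<lambda>xs. F (g xs))"
    "\<And>x. F (enc x) = enc (f x)"
  using that[of "\<lambda>n. enc (f (dec n))"] assms
    recursive_fn_comp1[of "\<lambda>n. enc (f (dec n))"] unfolding computable_def by simp

lemma recursive_fn_arg: "recursive_fn (Suc 0) (\<lambda>xs. xs ! 0)"
  by (rule recursive_fn.proj) simp

lemma computable_id: "computable (\<lambda>x. x)"
  by (rule computableI[of "\<lambda>n. n"]) (auto intro: recursive_fn_arg)

lemma computable_const: "computable (\<lambda>x. c)"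
  by (rule computableI[of "\<lambda>n. enc c"]) (auto intro: recursive_fn_const)

lemma computable_comp:
  assumes "computable f" "computable g"
  shows "computable (\<lambda>x. f (g x))"
proof -
  obtain F where F: "\<And>k g. recursive_fn k g \<Longrightarrow> recursive_fn k (\<lambda>xs. F (g xs))"
    "\<And>x. F (enc x) = enc (f x)" using computableE[OF assms(1)] by blast
  obtain G where G: "\<And>k g. recursive_fn k g \<Longrightarrow> recursive_fn k (\<lambda>xs. G (g xs))"
    "\<And>x. G (enc x) = enc (g x)" using computableE[OF assms(2)] by blast
  show ?thesis
    by (rule computableI[of "\<lambda>n. F (G n)"]) (auto simp: F G intro!: F(1) G(1) recursive_fn_arg)
qed

lemma computable_Pair:
  assumes f: "computable f" and g: "computable g"
  shows "computable (\<lambda>x. (f x, g x))"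
proof -
  obtain F where F: "\<And>k g. recursive_fn k g \<Longrightarrow> recursive_fn k (\<lambda>xs. F (g xs))"
    "\<And>x. F (enc x) = enc (f x)" using computableE[OF f] by blast
  obtain G where G: "\<And>k g. recursive_fn k g \<Longrightarrow> recursive_fn k (\<lambda>xs. G (g xs))"
    "\<And>x. G (enc x) = enc (g x)" using computableE[OF g] by blast
  show ?thesis
    by (rule computableI[of "\<lambda>n. prod_encode (F n, G n)"])
      (auto simp: F G enc_prod_def intro!: recursive_fn_prod_encode F(1) G(1) recursive_fn_arg)
qed

lemma computable_fst: "computable f \<Longrightarrow> computable (\<lambda>x. fst (f x))"
  by (rule computable_comp[of fst], rule computableI[of "\<lambda>n. fst (prod_decode n)"])
    (auto simp: enc_prod_def intro: recursive_fn_fst_decode recursive_fn_arg)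

lemma computable_snd: "computable f \<Longrightarrow> computable (\<lambda>x. snd (f x))"
  by (rule computable_comp[of snd], rule computableI[of "\<lambda>n. snd (prod_decode n)"])
    (auto simp: enc_prod_def intro: recursive_fn_snd_decode recursive_fn_arg)

lemma computable_comp2:
  assumes "computable (\<lambda>p. f (fst p) (snd p))" "computable g" "computable h"
  shows "computable (\<lambda>x. f (g x) (h x))"
  using computable_comp[OF assms(1) computable_Pair[OF assms(2,3)]] by simp

lemma computable_nat2:
  fixes f :: "nat \<Rightarrow> nat \<Rightarrow> nat"
  assumes F: "\<And>g h. recursive_fn (Suc 0) g \<Longrightarrow> recursive_fn (Suc 0) h \<Longrightarrow> recursive_fn (Suc 0) (\<lambda>xs. f (g xs) (h xs))"
    and gh: "computable g" "computable h"
  shows "computable (\<lambda>x. f (g x) (h x))"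
  by (rule computable_comp2[OF _ gh],
      rule computableI[of "\<lambda>n. f (fst (prod_decode n)) (snd (prod_decode n))"])
    (auto simp: enc_prod_def enc_nat_def
      intro!: F recursive_fn_fst_decode recursive_fn_snd_decode recursive_fn_arg)

lemma computable_add: "computable f \<Longrightarrow> computable g \<Longrightarrow> computable (\<lambda>x. f x + g x :: nat)"
  by (rule computable_nat2[of "(+)"]) (rule recursive_fn_add)

lemma computable_diff: "computable f \<Longrightarrow> computable g \<Longrightarrow> computable (\<lambda>x. f x - g x :: nat)"
  by (rule computable_nat2[of "(-)"]) (rule recursive_fn_diff)

lemma computable_Suc: "computable f \<Longrightarrow> computable (\<lambda>x. Suc (f x))"
  using computable_add[OF _ computable_const[of 1]] by simp

lemma computable_enc: "computable f \<Longrightarrow> computable (\<lambda>x. enc (f x))"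
  by (rule computable_comp[of enc], rule computableI[of "\<lambda>n. n"]) (auto simp: enc_nat_def intro: recursive_fn_arg)

lemma computable_if:
  assumes P: "computable_pred P" and f: "computable f" and g: "computable g"
  shows "computable (\<lambda>x. if P x then f x else g x)"
proof -
  obtain C where C: "\<And>k g. recursive_fn k g \<Longrightarrow> recursive_fn k (\<lambda>xs. C (g xs))"
    "\<And>x. C (enc x) = enc (of_bool (P x) :: nat)"
    using computableE[OF P[unfolded computable_pred_def]] by blast
  obtain F where F: "\<And>k g. recursive_fn k g \<Longrightarrow> recursive_fn k (\<lambda>xs. F (g xs))"
    "\<And>x. F (enc x) = enc (f x)" using computableE[OF f] by blast
  obtain G where G: "\<And>k g. recursive_fn k g \<Longrightarrow> recursive_fn k (\<lambda>xs. G (g xs))"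
    "\<And>x. G (enc x) = enc (g x)" using computableE[OF g] by blast
  show ?thesis
    by (rule computableI[of "\<lambda>n. if C n = 0 then G n else F n"])
      (auto simp: C F G enc_nat_def intro!: recursive_fn_if C(1) F(1) G(1) recursive_fn_arg)
qed

lemma computable_pred_eq:
  assumes "computable f" "computable g"
  shows "computable_pred (\<lambda>x. f x = g x)"
proof -
  have "computable (\<lambda>x. 1 - ((enc (f x) - enc (g x)) + (enc (g x) - enc (f x))))"
    by (intro computable_add computable_diff computable_const computable_enc assms)
  moreover have "1 - ((enc (f x) - enc (g x)) + (enc (g x) - enc (f x))) = of_bool (f x = g x)" for x
    using enc_eq_iff[of "f x" "g x"] by (auto simp del: enc_eq_iff)
  ultimately show ?thesis by (simp add: computable_pred_def)
qed

lemma computable_pred_not: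
  assumes "computable_pred P"
  shows "computable_pred (\<lambda>x. \<not> P x)"
proof -
  have "(\<lambda>x. of_bool (\<not> P x) :: nat) = (\<lambda>x. 1 - of_bool (P x))" by auto
  then show ?thesis
    using computable_diff[OF computable_const[of 1] assms[unfolded computable_pred_def]]
    by (simp only: computable_pred_def)
qed

lemma computable_pred_conj:
  assumes "computable_pred P" "computable_pred Q"
  shows "computable_pred (\<lambda>x. P x \<and> Q x)"
proof -
  have "(\<lambda>x. of_bool (P x \<and> Q x) :: nat) = (\<lambda>x. if P x then of_bool (Q x) else 0)" by auto
  then show ?thesis
    using computable_if[OF assms(1) assms(2)[unfolded computable_pred_def] computable_const[of 0]]
    by (simp only: computable_pred_def)
qed

lemma computable_pred_disj:
  assumes "computable_pred P" "computable_pred Q"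
  shows "computable_pred (\<lambda>x. P x \<or> Q x)"
  using computable_pred_not[OF computable_pred_conj[OF assms[THEN computable_pred_not]]] by simp

lemma computable_rec_nat:
  assumes f: "computable f" and g: "computable (\<lambda>p. g (fst p) (fst (snd p)) (snd (snd p)))"
    and n: "computable n"
  shows "computable (\<lambda>x. rec_nat (f x) (\<lambda>m r. g m r x) (n x))"
proof -
  obtain F where F: "\<And>k g. recursive_fn k g \<Longrightarrow> recursive_fn k (\<lambda>xs. F (g xs))"
    "\<And>x. F (enc x) = enc (f x)" using computableE[OF f] by blast
  obtain G where G: "\<And>k g. recursive_fn k g \<Longrightarrow> recursive_fn k (\<lambda>xs. G (g xs))"
    "\<And>p. G (enc p) = enc (g (fst p) (fst (snd p)) (snd (snd p)))"
    using computableE[OF g] by blast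
  let ?R = "\<lambda>a b. rec_nat (F b) (\<lambda>m r. G (prod_encode (m, prod_encode (r, b)))) a"
  have "recursive_fn 2 (\<lambda>xs. ?R (xs ! 0) (xs ! 1))"
    by (rule recursive_fn_rec_nat)
      (auto intro!: F(1) G(1) recursive_fn_prod_encode recursive_fn.proj)
  note R = recursive_fn_comp2[OF this]
  have eq: "?R m (enc x) = enc (rec_nat (f x) (\<lambda>m r. g m r x) m)" for m x
  proof (induction m)
    case (Suc m)
    then show ?case using G(2)[of "(m, rec_nat (f x) (\<lambda>m r. g m r x) m, x)"]
      by (simp add: enc_prod_def enc_nat_def)
  qed (simp add: F(2))
  have "computable (\<lambda>p. rec_nat (f (snd p)) (\<lambda>m r. g m r (snd p)) (fst p))"
    by (rule computableI[of "\<lambda>n. ?R (fst (prod_decode n)) (snd (prod_decode n))"])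
      (auto simp: enc_prod_def enc_nat_def eq
        intro!: R recursive_fn_fst_decode recursive_fn_snd_decode recursive_fn_arg)
  from computable_comp[OF this computable_Pair[OF n computable_id]] show ?thesis by simp
qed

lemma computable_funpow:
  fixes f :: "'b::encodable \<Rightarrow> 'b"
  assumes "computable f" "computable n" "computable g"
  shows "computable (\<lambda>x. (f ^^ n x) (g x))"
proof -
  have "computable (\<lambda>x. rec_nat (g x) (\<lambda>m r. f r) (n x))"
    by (rule computable_rec_nat)
      (intro assms computable_comp[OF assms(1)] computable_fst computable_snd computable_id)+
  moreover have "rec_nat y (\<lambda>m r. f r) m = (f ^^ m) y" for m y
    by (induction m) auto
  ultimately show ?thesis by simp
qed

text \<open>Minimisation demands a witness for every number; as every number is a code,
  \<open>ex\<close> supplies one.\<close>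

lemma computable_Least:
  fixes P :: "nat \<Rightarrow> 'a::encodable \<Rightarrow> bool"
  assumes P: "computable_pred (\<lambda>p. P (fst p) (snd p))" and ex: "\<And>x. \<exists>n. P n x"
  shows "computable (\<lambda>x. LEAST n. P n x)"
proof -
  obtain C where C: "\<And>k g. recursive_fn k g \<Longrightarrow> recursive_fn k (\<lambda>xs. C (g xs))"
    "\<And>p. C (enc p) = of_bool (P (fst p) (snd p))"
    using computableE[OF P[unfolded computable_pred_def]] by (auto simp: enc_nat_def)
  have "recursive_fn (1 + 1) (\<lambda>xs. 1 - C (prod_encode (xs ! 0, xs ! 1)))"
    by (intro recursive_fn_diff recursive_fn_const C(1) recursive_fn_prod_encode recursive_fn.proj) auto
  then have "recursive_fn 1
      (\<lambda>xs. LEAST n. 1 - C (prod_encode ((n # xs) ! 0, (n # xs) ! 1)) = 0)"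
  proof (rule recursive_fn.mu, intro allI impI)
    fix xs :: "nat list"
    obtain n where "P n (dec (xs ! 0))" using ex by blast
    then have "1 - C (prod_encode ((n # xs) ! 0, (n # xs) ! 1)) = 0"
      using C(2)[of "(n, dec (xs ! 0))"] by (simp add: enc_prod_def enc_nat_def)
    then show "\<exists>n. 1 - C (prod_encode ((n # xs) ! 0, (n # xs) ! 1)) = 0" by blast
  qed
  then have "recursive_fn (Suc 0) (\<lambda>xs. LEAST n. 1 - C (prod_encode (n, xs ! 0)) = 0)" by simp
  moreover have "(LEAST n. 1 - C (prod_encode (n, enc x)) = 0) = (LEAST n. P n x)" for x
    using C(2)[of "(_, x)"] by (auto simp: enc_prod_def enc_nat_def)
  ultimately show ?thesis by (intro computableI) (auto simp: enc_nat_def)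
qed

text \<open>A finite modification of a constant. All knowledge about the monoid enters the algorithm
  through such tables, however hard their entries may be to find.\<close>

lemma computable_table:
  assumes "finite {x. f x \<noteq> c}"
  shows "computable f"
  using assms
proof (induction "{x. f x \<noteq> c}" arbitrary: f rule: finite_induct)
  case empty
  then have "f = (\<lambda>x. c)" by auto
  then show ?case by (simp add: computable_const)
next
  case (insert a A)
  let ?g = "f(a := c)"
  have "A = {x. ?g x \<noteq> c}" using insert by auto
  then have "computable ?g" by (rule insert.hyps(3))
  then have "computable (\<lambda>x. if x = a then f a else ?g x)"
    by (intro computable_if computable_pred_eq computable_const computable_id)
  moreover have "(\<lambda>x. if x = a then f a else ?g x) = f" by auto
  ultimately show ?case by simp
qed

subsection \<open>Lists\<close>

lemma computable_Cons:
  assumes f: "computable f" and g: "computable g"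
  shows "computable (\<lambda>x. f x # g x)"
proof -
  have "computable (\<lambda>p. fst p # snd p)"
    by (rule computableI[of Suc]) (auto simp: enc_Cons intro: recursive_fn_Suc recursive_fn_arg)
  from computable_comp2[OF this f g] show ?thesis .
qed

text \<open>The empty list has code \<open>0\<close>, and a nonempty list the successor of the code
  of head and tail; so this is a zero test followed by a predecessor.\<close>

lemma computable_case_list:
  assumes f: "computable f" and g: "computable (\<lambda>p. g (fst (fst p)) (snd (fst p)) (snd p))"
    and h: "computable h"
  shows "computable (\<lambda>x. case h x of [] \<Rightarrow> f x | y # ys \<Rightarrow> g y ys x)"
proof -
  obtain F where F: "\<And>k g. recursive_fn k g \<Longrightarrow> recursive_fn k (\<lambda>xs. F (g xs))"
    "\<And>x. F (enc x) = enc (f x)" using computableE[OF f] by blast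
  obtain G where G: "\<And>k g. recursive_fn k g \<Longrightarrow> recursive_fn k (\<lambda>xs. G (g xs))"
    "\<And>p. G (enc p) = enc (g (fst (fst p)) (snd (fst p)) (snd p))"
    using computableE[OF g] by blast
  obtain H where H: "\<And>k g. recursive_fn k g \<Longrightarrow> recursive_fn k (\<lambda>xs. H (g xs))"
    "\<And>x. H (enc x) = enc (h x)" using computableE[OF h] by blast
  have G': "G (prod_encode (enc (y, ys), enc x)) = enc (g y ys x)" for y ys x
    using G(2)[of "((y, ys), x)"] by (simp add: enc_prod_def)
  show ?thesis
  proof (rule computableI[of "\<lambda>n. if H n = 0 then F n else G (prod_encode (H n - Suc 0, n))"])
    show "recursive_fn (Suc 0) (\<lambda>xs. if H (xs ! 0) = 0 then F (xs ! 0)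
        else G (prod_encode (H (xs ! 0) - Suc 0, xs ! 0)))"
      by (intro recursive_fn_if F(1) G(1) H(1) recursive_fn_prod_encode recursive_fn_pred
          recursive_fn_arg)
    show "(if H (enc x) = 0 then F (enc x) else G (prod_encode (H (enc x) - Suc 0, enc x))) =
        enc (case h x of [] \<Rightarrow> f x | y # ys \<Rightarrow> g y ys x)" for x
      by (cases "h x") (simp_all add: H(2) F(2) G' enc_Nil enc_Cons)
  qed
qed

text \<open>Bounds the number of iterations of a fold by the code of the list, before the length
  itself is known to be computable.\<close>

lemma length_le_enc: "length xs \<le> enc xs"
proof (induction xs)
  case (Cons x xs)
  then show ?case using le_prod_encode_2[of "enc xs" "enc x"] by (simp add: enc_Cons enc_prod_def)
qed simp

text \<open>Primitive recursion on pairs of remaining list and accumulator. Once the list is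
  exhausted the pair stays fixed, so too many iterations do no harm.\<close>

lemma computable_foldl:
  assumes f: "computable f" and g: "computable (\<lambda>p. g (fst p) (fst (snd p)) (snd (snd p)))"
    and h: "computable h"
  shows "computable (\<lambda>x. foldl (\<lambda>r y. g r y x) (f x) (h x))"
proof -
  define st where "st q x = (case fst q of [] \<Rightarrow> q | y # ys \<Rightarrow> (ys, g (snd q) y x))" for q x
  have st: "computable (\<lambda>p. st (fst p) (snd p))"
    unfolding st_def
    by (rule computable_case_list)
      (intro computable_fst computable_snd computable_id computable_Pair
        computable_comp[OF g, where g = "\<lambda>p. (_ p, _ p, _ p)", simplified])+
  have eq: "snd (rec_nat (ys, r) (\<lambda>m q. st q x) m) = foldl (\<lambda>r y. g r y x) r ys"
    if "length ys \<le> m" for m ys r x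
  proof -
    have "rec_nat (ys, r) (\<lambda>m q. st q x) m =
        (drop m ys, foldl (\<lambda>r y. g r y x) r (take m ys))"
    proof (induction m)
      case (Suc m)
      then show ?case
        by (cases "m < length ys")
          (auto simp: st_def Cons_nth_drop_Suc[symmetric] take_Suc_conv_app_nth)
    qed simp
    then show ?thesis using that by simp
  qed
  have "computable (\<lambda>x. snd (rec_nat (h x, f x) (\<lambda>m q. st q x) (enc (h x))))"
    by (rule computable_snd, rule computable_rec_nat)
      (intro computable_Pair f h computable_enc computable_comp2[OF st] computable_fst
        computable_snd computable_id)+
  then show ?thesis using eq[OF length_le_enc] by simp
qed

lemmas computable_basic =
  computable_id computable_const computable_Pair computable_fst computable_snd computable_Suc
  computable_add computable_diff computable_Cons computable_if computable_pred_eq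
  computable_pred_not computable_pred_conj computable_pred_disj

lemma computable_rev:
  assumes "computable f"
  shows "computable (\<lambda>x. rev (f x))"
proof -
  have "computable (\<lambda>x. foldl (\<lambda>r y. y # r) [] (f x))"
    by (rule computable_foldl) (intro computable_basic assms)+
  then show ?thesis by (simp add: rev_conv_fold foldl_conv_fold)
qed

lemma computable_append:
  assumes "computable f" "computable g"
  shows "computable (\<lambda>x. f x @ g x)"
proof -
  have *: "foldl (\<lambda>r y. y # r) zs ys = rev ys @ zs" for ys zs :: "'b list"
    by (induction ys arbitrary: zs) auto
  have "computable (\<lambda>x. foldl (\<lambda>r y. y # r) (g x) (rev (f x)))"
    by (rule computable_foldl) (intro computable_basic computable_rev assms)+
  then show ?thesis by (simp add: *)
qed

lemma computable_length:
  assumes "computable f"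
  shows "computable (\<lambda>x. length (f x))"
proof -
  have *: "foldl (\<lambda>r y. Suc r) n ys = length ys + n" for ys :: "'b list" and n
    by (induction ys arbitrary: n) auto
  have "computable (\<lambda>x. foldl (\<lambda>r y. Suc r) 0 (f x))"
    by (rule computable_foldl) (intro computable_basic assms)+
  then show ?thesis by (simp add: *)
qed

lemma computable_drop:
  assumes "computable n" "computable f"
  shows "computable (\<lambda>x. drop (n x) (f x))"
proof -
  have tl: "computable (\<lambda>ys :: 'b list. case ys of [] \<Rightarrow> [] | z # zs \<Rightarrow> zs)"
    by (rule computable_case_list) (intro computable_basic)+
  have "((\<lambda>ys. case ys of [] \<Rightarrow> [] | z # zs \<Rightarrow> zs) ^^ m) xs = drop m xs" for m and xs :: "'b list"
    by (induction m) (auto simp: drop_Suc drop_tl split: list.split)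
  with computable_funpow[OF tl assms] show ?thesis by simp
qed

lemma computable_take:
  assumes "computable n" "computable f"
  shows "computable (\<lambda>x. take (n x) (f x))"
proof -
  have "computable (\<lambda>x. rev (drop (length (f x) - n x) (rev (f x))))"
    by (intro computable_rev computable_drop computable_diff computable_length assms)
  moreover have "take (length xs - (length xs - m)) xs = take m xs" for m and xs :: "'b list"
    by (cases "m \<le> length xs") auto
  ultimately show ?thesis by (simp add: drop_rev)
qed

lemma computable_pred_less:
  fixes f g :: "'a::encodable \<Rightarrow> nat"
  assumes "computable f" "computable g"
  shows "computable_pred (\<lambda>x. f x < g x)"
proof -
  have "computable_pred (\<lambda>x. Suc (f x) - g x = 0)"
    by (intro computable_basic assms)
  then show ?thesis by (simp add: Suc_le_eq)
qed

lemma computable_mod2: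
  assumes "computable f"
  shows "computable (\<lambda>x. f x mod 2 :: nat)"
proof -
  have "rec_nat 0 (\<lambda>n r. 1 - r) m = m mod 2" for m :: nat
    by (induction m) (auto simp: mod_Suc)
  moreover have "computable (\<lambda>x. rec_nat 0 (\<lambda>n r. 1 - r) (f x) :: nat)"
    by (rule computable_rec_nat) (intro computable_basic assms)+
  ultimately show ?thesis by simp
qed

lemma computable_nth_default:
  assumes f: "computable f" and n: "computable n"
  shows "computable (\<lambda>x. nth_default d (f x) (n x))"
proof -
  have "computable (\<lambda>x. case drop (n x) (f x) of [] \<Rightarrow> d | y # ys \<Rightarrow> y)"
    by (rule computable_case_list) (intro computable_drop computable_basic f n)+
  moreover have "(case drop m xs of [] \<Rightarrow> d | y # ys \<Rightarrow> y) = nth_default d xs m" for m xs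
    by (cases "m < length xs") (auto simp: nth_default_def Cons_nth_drop_Suc[symmetric])
  ultimately show ?thesis by simp
qed

lemma computable_list_update:
  assumes "computable f" "computable n" "computable g"
  shows "computable (\<lambda>x. (f x)[n x := g x])"
proof -
  have "computable (\<lambda>x. if n x < length (f x)
      then take (n x) (f x) @ g x # drop (Suc (n x)) (f x) else f x)"
    by (intro computable_basic computable_append computable_take computable_drop
        computable_pred_less computable_length assms)
  moreover have "(if m < length xs then take m xs @ y # drop (Suc m) xs else xs) = xs[m := y]"
    for m and xs :: "'b list" and y
    by (simp add: upd_conv_take_nth_drop list_update_beyond)
  ultimately show ?thesis by simp
qed

lemma computable_pred_list_all:
  assumes P: "computable_pred P" and f: "computable f"
  shows "computable_pred (\<lambda>x. \<forall>y\<in>set (f x). P y)"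
proof -
  have "computable (\<lambda>x. foldl (\<lambda>r y. if P y then r else 0) 1 (f x) :: nat)"
    by (rule computable_foldl)
      (intro computable_basic f computable_comp[OF P[unfolded computable_pred_def],
          folded computable_pred_def])+
  moreover have "foldl (\<lambda>r y. if P y then r else 0) r ys = (if \<forall>y\<in>set ys. P y then r else 0)"
    for r :: nat and ys
    by (induction ys arbitrary: r) auto
  ultimately show ?thesis by (simp only: computable_pred_def of_bool_def)
qed

section \<open>Reduction of lists of atom words\<close>

text \<open>
  A multifraction is stored as the list of its entries, each entry being a word over the atoms.
  The states of the transducer \<open>\<delta>\<close> are codes of right basic elements of \<open>lev M p\<close> and of \<open>\<one>\<close>: in
  state \<open>q\<close>, reading an atom \<open>s\<close> with lcm \<open>s q' = q s'\<close>, it moves to state \<open>q'\<close> and writes a word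
  for \<open>s'\<close>. If there is no lcm, it moves to the dead state \<open>0\<close>. Right basic elements being closed
  under this operation, finitely many states suffice. Since \<open>opp M\<close> reverses products, words of
  even index are read backwards.
\<close>

definition run :: "(nat \<times> nat \<times> nat \<Rightarrow> nat \<times> nat list) \<Rightarrow> nat \<Rightarrow> nat \<Rightarrow> nat list \<Rightarrow> nat \<times> nat list" where
  "run \<delta> p k w =
     foldl (\<lambda>r s. (fst (\<delta> (p, fst r, s)), snd r @ snd (\<delta> (p, fst r, s)))) (k, []) w"

definition orient :: "nat \<Rightarrow> 'x list \<Rightarrow> 'x list" where
  "orient p w = (if p = 0 then rev w else w)"

text \<open>\<open>u\<close> is the code of \<open>\<one>\<close>. Final state \<open>u\<close> on
  entry \<open>i + 2\<close> says that the atom divides it, the output being the quotient; a live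
  final state on entry \<open>i + 1\<close> is the remainder, which \<open>\<omega>\<close> spells
  as a word. For \<open>i = 0\<close> that remainder must be \<open>\<one>\<close>.\<close>

definition attempt ::
    "(nat \<times> nat \<times> nat \<Rightarrow> nat \<times> nat list) \<Rightarrow> (nat \<times> nat \<Rightarrow> nat list) \<Rightarrow> (nat \<Rightarrow> nat) \<Rightarrow> nat \<Rightarrow>
     nat \<Rightarrow> nat \<Rightarrow> nat list list \<Rightarrow> nat list list" where
  "attempt \<delta> \<omega> \<sigma> u i x xs =
     (let p = i mod 2;
          r2 = run \<delta> p (\<sigma> x) (orient p (nth_default [] xs (Suc i)));
          r3 = run \<delta> p (\<sigma> x) (orient p (nth_default [] xs (Suc (Suc i))))
      in if Suc (Suc i) < length xs \<and> fst r3 = u \<and> fst r2 \<noteq> 0 \<and> (i \<noteq> 0 \<or> fst r2 = u)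
         then xs[i := orient p (orient p (nth_default [] xs i) @ \<omega> (p, fst r2)),
                 Suc i := orient p (snd r2), Suc (Suc i) := orient p (snd r3)]
         else xs)"

definition sweep where
  "sweep \<delta> \<omega> \<sigma> u n i xs = foldl (\<lambda>ys x. attempt \<delta> \<omega> \<sigma> u i x ys) xs [0..<n]"

definition pass where
  "pass \<delta> \<omega> \<sigma> u n xs = foldl (\<lambda>ys i. sweep \<delta> \<omega> \<sigma> u n i ys) xs [0..<length xs]"

text \<open>Letter \<open>2 * i + 1\<close> is atom \<open>i\<close> and \<open>2 * i\<close> its
  inverse, as in \<open>encode_word\<close>. Letters out of range contribute nothing, which keeps
  this a finite table; \<open>trivial_word\<close> rejects them separately.\<close>

definition initial_entries :: "nat \<Rightarrow> nat \<Rightarrow> nat list list" where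
  "initial_entries n l =
     (if l < 2 * n then if odd l then [[l div 2], []] else [[], [l div 2]] else [])"

definition initial :: "nat \<Rightarrow> nat list \<Rightarrow> nat list list" where
  "initial n w = foldl (\<lambda>r l. r @ initial_entries n l) [[]] w"

text \<open>The search for a fixed point is unbounded; \<open>pass_stabilizes\<close> makes it total
  on the lists that occur.\<close>

definition stable_time where
  "stable_time \<delta> \<omega> \<sigma> u n xs = (LEAST m.
     pass \<delta> \<omega> \<sigma> u n ((pass \<delta> \<omega> \<sigma> u n ^^ m) xs) = (pass \<delta> \<omega> \<sigma> u n ^^ m) xs)"

definition reduce_fully where
  "reduce_fully \<delta> \<omega> \<sigma> u n xs = (pass \<delta> \<omega> \<sigma> u n ^^ stable_time \<delta> \<omega> \<sigma> u n xs) xs"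

lemma computable_initial: "computable (initial n)"
proof -
  have "{l. initial_entries n l \<noteq> []} \<subseteq> {..<2 * n}" by (auto simp: initial_entries_def)
  then have *: "computable (initial_entries n)"
    by (intro computable_table) (rule finite_subset, auto)
  have "computable (\<lambda>w. foldl (\<lambda>r l. r @ initial_entries n l) [[]] w)"
    by (rule computable_foldl)
      (intro computable_append computable_comp[OF *] computable_fst computable_snd
        computable_const computable_id)+
  then show ?thesis by (simp add: initial_def[abs_def])
qed

context
  fixes \<delta> :: "nat \<times> nat \<times> nat \<Rightarrow> nat \<times> nat list" and \<omega> :: "nat \<times> nat \<Rightarrow> nat list"
    and \<sigma> :: "nat \<Rightarrow> nat" and u n :: nat
  assumes \<delta>: "finite {x. \<delta> x \<noteq> (0, [])}" and \<omega>: "finite {x. \<omega> x \<noteq> []}" and \<sigma>: "finite {x. \<sigma> x \<noteq> 0}"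
begin

lemma computable_orient:
  assumes "computable f" "computable g"
  shows "computable (\<lambda>x. orient (f x) (g x))"
  unfolding orient_def by (intro computable_basic computable_rev assms)

lemma computable_run:
  assumes "computable f" "computable g" "computable h"
  shows "computable (\<lambda>x. run \<delta> (f x) (g x) (h x))"
  unfolding run_def
  by (rule computable_foldl)
    (intro computable_basic computable_append computable_comp[OF computable_table[OF \<delta>]] assms
      computable_comp[OF assms(1)])+

lemma computable_attempt:
  assumes "computable f" "computable g" "computable h"
  shows "computable (\<lambda>x. attempt \<delta> \<omega> \<sigma> u (f x) (g x) (h x))"
  unfolding attempt_def Let_def
  by (intro computable_basic computable_append computable_run computable_orient computable_mod2
      computable_nth_default computable_list_update computable_pred_less computable_length assms
      computable_comp[OF computable_table[OF \<omega>]] computable_comp[OF computable_table[OF \<sigma>]])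

lemma computable_pass: "computable (pass \<delta> \<omega> \<sigma> u n)"
proof -
  have sw: "computable (\<lambda>p. sweep \<delta> \<omega> \<sigma> u n (fst p) (snd p))"
    unfolding sweep_def
    by (rule computable_foldl) (intro computable_attempt computable_basic)+
  \<comment> \<open>The range of levels depends on the argument, so this fold becomes primitive
    recursion on the length; in \<open>sweep\<close> the list of atoms is a constant.\<close>
  have "foldl (\<lambda>ys i. g i ys) zs [0..<m] = rec_nat zs (\<lambda>i ys. g i ys) m" for g and zs :: "nat list list" and m
    by (induction m) auto
  then have "pass \<delta> \<omega> \<sigma> u n = (\<lambda>xs. rec_nat xs (\<lambda>i ys. sweep \<delta> \<omega> \<sigma> u n i ys) (length xs))"
    by (simp add: pass_def fun_eq_iff)
  moreover have "computable (\<lambda>xs. rec_nat xs (\<lambda>i ys. sweep \<delta> \<omega> \<sigma> u n i ys) (length xs))"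
    by (rule computable_rec_nat) (intro computable_comp2[OF sw] computable_basic computable_length)+
  ultimately show ?thesis by simp
qed

end

section \<open>Correctness of the transducer and of a single attempt\<close>

definition ev :: "('a, 'b) monoid_scheme \<Rightarrow> 'a list \<Rightarrow> nat list \<Rightarrow> 'a" where
  "ev N gs w = foldr (\<lambda>i p. gs ! i \<otimes>\<^bsub>N\<^esub> p) w \<one>\<^bsub>N\<^esub>"

lemma ev_simps [simp]:
  "ev N gs [] = \<one>\<^bsub>N\<^esub>" "ev N gs (i # w) = gs ! i \<otimes>\<^bsub>N\<^esub> ev N gs w"
  by (simp_all add: ev_def)

lemma (in monoid) ev_closed:
  "set gs \<subseteq> carrier G \<Longrightarrow> set w \<subseteq> {..<length gs} \<Longrightarrow> ev G gs w \<in> carrier G"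
  by (induction w) (auto intro!: m_closed dest: nth_mem)

lemma (in monoid) ev_append:
  assumes "set gs \<subseteq> carrier G" "set v \<subseteq> {..<length gs}" "set w \<subseteq> {..<length gs}"
  shows "ev G gs (v @ w) = ev G gs v \<otimes> ev G gs w"
  using assms(2)
proof (induction v)
  case (Cons i v)
  then have "gs ! i \<in> carrier G" using assms(1) by (auto dest: nth_mem)
  then show ?case using Cons assms(1,3) by (simp add: m_assoc ev_closed)
qed (use assms in \<open>simp add: ev_closed\<close>)

lemma (in gcd_mon) ev_opp:
  assumes "set gs \<subseteq> carrier M" "set w \<subseteq> {..<length gs}"
  shows "ev (opp M) gs w = ev M gs (rev w)"
  using assms(2)
proof (induction w)
  case (Cons i w)
  then have "gs ! i \<in> carrier M" using assms(1) by (auto dest: nth_mem)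
  then show ?case using Cons assms(1) ev_append[of gs "rev w" "[i]"] by simp
qed simp

text \<open>Without nontrivial invertible elements no nonempty product of atoms is
  \<open>\<one>\<close>. The final test therefore only asks whether all words are empty.\<close>

lemma (in gcd_mon) ev_eq_one:
  assumes "set gs \<subseteq> atoms M" "set w \<subseteq> {..<length gs}" "ev M gs w = \<one>"
  shows "w = []"
proof (cases w)
  case (Cons i v)
  have gs: "set gs \<subseteq> carrier M" using assms(1) atomsD by blast
  have i: "gs ! i \<in> atoms M" using assms Cons by (auto dest: nth_mem)
  then have "gs ! i = \<one>"
    using prod_one[of "gs ! i" "ev M gs v"] assms Cons atomsD[OF i] ev_closed[OF gs, of v] by simp
  then show ?thesis using atomsD[OF i] by simp
qed simp

lemma (in gcd_mon) right_basic_carrier: "q \<in> right_basic M \<Longrightarrow> q \<in> carrier M"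
  by (induction rule: right_basic.induct) (auto dest: atomsD)

text \<open>Reading an atom performs exactly the operation under which right basic elements are
  closed, and state \<open>\<one>\<close> stays \<open>\<one>\<close>. Finitely many states thus
  suffice for words of any length.\<close>

lemma (in gcd_mon) right_basic_lcm_sq:
  assumes "s \<in> right_basic M" "q \<in> insert \<one> (right_basic M)" "lcm_sq M s q q' s'"
  shows "q' \<in> insert \<one> (right_basic M)"
proof (cases "q = \<one>")
  case True
  then show ?thesis
    using lcm_sq_unique[OF assms(3)[unfolded True] lcm_sq_one] right_basic_carrier assms(1) by auto
next
  case False
  note D = lcm_sqD[OF assms(3)]
  have "(s \<otimes> q') lcmof q s"
    using lcm_sq_iff_lcmof[of q s s' q'] lcm_sq_sym[OF assms(3)] D by auto
  then have "q' \<in> right_basic M"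
    using right_basic.lcm[of q M s "s \<otimes> q'" q'] False assms(1,2) D by auto
  then show ?thesis by simp
qed

lemma noeth_ore_mon_lev: "noeth_ore_mon M \<Longrightarrow> noeth_ore_mon (lev M i)"
  by (simp add: lev_def noeth_ore_mon_opp)

text \<open>In a proper factorisation both factors have smaller \<open>l\<close>, so splitting ends
  at atoms.\<close>

lemma (in noeth_ore_mon) atom_words:
  assumes gs: "set gs = atoms M" and "a \<in> carrier M"
  shows "\<exists>w. set w \<subseteq> {..<length gs} \<and> ev M gs w = a"
proof -
  have car: "set gs \<subseteq> carrier M" using gs atomsD by blast
  obtain l :: "'a \<Rightarrow> nat" where
    l: "\<And>a b. a \<in> carrier M \<Longrightarrow> b \<in> carrier M \<Longrightarrow> l (a \<otimes> b) \<ge> l a + l b"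
       "\<And>a. a \<in> carrier M \<Longrightarrow> a \<noteq> \<one> \<Longrightarrow> l a > 0"
    using noeth not_unit_iff unfolding strongly_noetherian_def by metis
  show ?thesis
    using assms(2)
  proof (induction "l a" arbitrary: a rule: less_induct)
    case less
    consider "a = \<one>" | "a \<in> atoms M" | "a \<noteq> \<one>" "a \<notin> atoms M" by blast
    then show ?case
    proof cases
      case 1
      then have "set [] \<subseteq> {..<length gs} \<and> ev M gs [] = a" by simp
      then show ?thesis by blast
    next
      case 2
      then obtain i where "i < length gs" "gs ! i = a" using gs by (metis in_set_conv_nth)
      then have "set [i] \<subseteq> {..<length gs} \<and> ev M gs [i] = a" using less.prems by simp
      then show ?thesis by blast
    next
      case 3
      then obtain b c where bc: "b \<in> carrier M" "b \<noteq> \<one>" "c \<in> carrier M" "c \<noteq> \<one>" "a = b \<otimes> c"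
        using less.prems not_unit_iff unfolding atoms_def by blast
      then have "l b < l a" "l c < l a" using l(1)[of b c] l(2)[of b] l(2)[of c] by auto
      then obtain v w where vw: "set v \<subseteq> {..<length gs}" "ev M gs v = b"
        "set w \<subseteq> {..<length gs}" "ev M gs w = c"
        using less.hyps[of b] less.hyps[of c] bc(1,3) by blast
      then have "set (v @ w) \<subseteq> {..<length gs} \<and> ev M gs (v @ w) = a"
        using ev_append[OF car] bc by simp
      then show ?thesis by blast
    qed
  qed
qed

definition entries :: "('a, 'b) monoid_scheme \<Rightarrow> 'a list \<Rightarrow> nat list list \<Rightarrow> nat \<Rightarrow> 'a" where
  "entries M gs xs k = ev M gs (nth_default [] xs k)"

definition states :: "('a, 'b) monoid_scheme \<Rightarrow> nat \<Rightarrow> 'a set" where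
  "states M p = insert \<one>\<^bsub>M\<^esub> (right_basic (lev M p))"

text \<open>Code \<open>0\<close> is reserved for the dead state, so states have positive codes. The
  parity \<open>p\<close> is a separate input of the tables, so \<open>c\<close> has to be injective
  only on the states of each parity.\<close>

locale reduction_tables = noeth_ore_mon M for M :: "('a, 'b) monoid_scheme" (structure) +
  fixes gs :: "'a list" and c :: "'a \<Rightarrow> nat"
    and \<delta> :: "nat \<times> nat \<times> nat \<Rightarrow> nat \<times> nat list" and \<omega> :: "nat \<times> nat \<Rightarrow> nat list"
    and \<sigma> :: "nat \<Rightarrow> nat"
  assumes gs: "set gs = atoms M"
    and c_inj: "p < 2 \<Longrightarrow> inj_on c (states M p)" and c_pos: "p < 2 \<Longrightarrow> q \<in> states M p \<Longrightarrow> c q \<noteq> 0"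
    and \<delta>_dead: "\<delta> (p, 0, s) = (0, [])"
    and \<delta>_none: "\<lbrakk>p < 2; q \<in> states M p; s < length gs; \<And>q' s'. \<not> lcm_sq (lev M p) (gs ! s) q q' s'\<rbrakk> \<Longrightarrow>
      \<delta> (p, c q, s) = (0, [])"
    and \<delta>_some: "\<lbrakk>p < 2; q \<in> states M p; s < length gs; lcm_sq (lev M p) (gs ! s) q q' s'\<rbrakk> \<Longrightarrow>
      \<exists>w. \<delta> (p, c q, s) = (c q', w) \<and> set w \<subseteq> {..<length gs} \<and> ev (lev M p) gs w = s'"
    and \<omega>: "p < 2 \<Longrightarrow> q \<in> states M p \<Longrightarrow>
      set (\<omega> (p, c q)) \<subseteq> {..<length gs} \<and> ev (lev M p) gs (\<omega> (p, c q)) = q"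
    and \<sigma>: "x < length gs \<Longrightarrow> \<sigma> x = c (gs ! x)"
begin

abbreviation n where "n \<equiv> length gs"

lemma gs_carrier: "set gs \<subseteq> carrier M"
  using gs atomsD by blast

lemma nth_gs: "x < n \<Longrightarrow> gs ! x \<in> atoms M"
  using gs nth_mem by blast

lemma nth_gs_states: "x < n \<Longrightarrow> gs ! x \<in> states M p"
  unfolding states_def using nth_gs by (auto simp: lev_def intro: right_basic.atom)

lemma run_simps:
  "run \<delta> p k [] = (k, [])"
  "run \<delta> p k (s # w) =
     (fst (run \<delta> p (fst (\<delta> (p, k, s))) w), snd (\<delta> (p, k, s)) @ snd (run \<delta> p (fst (\<delta> (p, k, s))) w))"
proof -
  let ?F = "\<lambda>r s. (fst (\<delta> (p, fst r, s)), snd r @ snd (\<delta> (p, fst r, s)))"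
  have "foldl ?F (k, v) w = (fst (foldl ?F (k, []) w), v @ snd (foldl ?F (k, []) w))" for k v w
  proof (induction w arbitrary: k v)
    case (Cons s w)
    show ?case
      using Cons[of "fst (\<delta> (p, k, s))" "v @ snd (\<delta> (p, k, s))"]
        Cons[of "fst (\<delta> (p, k, s))" "snd (\<delta> (p, k, s))"] by simp
  qed simp
  from this[of "fst (\<delta> (p, k, s))" "snd (\<delta> (p, k, s))" w] show
    "run \<delta> p k (s # w) =
     (fst (run \<delta> p (fst (\<delta> (p, k, s))) w), snd (\<delta> (p, k, s)) @ snd (run \<delta> p (fst (\<delta> (p, k, s))) w))"
    by (simp add: run_def)
qed (simp add: run_def)

lemma run_dead: "run \<delta> p 0 w = (0, [])"
  by (induction w) (simp_all add: run_simps \<delta>_dead)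

text \<open>By \<open>lcm_sq_split\<close> an lcm with the whole word yields one with its first
  letter and one with the rest; by \<open>lcm_sq_paste\<close> a failure later on is a failure for
  the whole word.\<close>

lemma run_correct:
  assumes p: "p < 2" and "q \<in> states M p" "set w \<subseteq> {..<n}"
  shows "(\<forall>q' b. lcm_sq (lev M p) (ev (lev M p) gs w) q q' b \<longrightarrow>
      q' \<in> states M p \<and> (\<exists>v. run \<delta> p (c q) w = (c q', v) \<and> set v \<subseteq> {..<n} \<and> ev (lev M p) gs v = b)) \<and>
    ((\<forall>q' b. \<not> lcm_sq (lev M p) (ev (lev M p) gs w) q q' b) \<longrightarrow> fst (run \<delta> p (c q) w) = 0)"
  using assms(2,3)
proof (induction w arbitrary: q)
  case Nil
  interpret L: gcd_mon "lev M p" using gcd_mon_axioms by (rule gcd_mon_lev)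
  have q: "q \<in> carrier M" using Nil L.right_basic_carrier by (auto simp: states_def)
  have sq: "lcm_sq (lev M p) \<one> q q \<one>"
    using lcm_sq_sym[OF L.lcm_sq_one[of q]] q by simp
  then have "q' = q \<and> b = \<one>" if "lcm_sq (lev M p) \<one> q q' b" for q' b
    using L.lcm_sq_unique[OF that sq] by simp
  then show ?case using sq Nil(1) by (auto simp: run_simps)
next
  case (Cons s w)
  interpret L: gcd_mon "lev M p" using gcd_mon_axioms by (rule gcd_mon_lev)
  have s: "s < n" and w: "set w \<subseteq> {..<n}" using Cons by auto
  have sc: "gs ! s \<in> carrier M" using nth_gs[OF s] atomsD by blast
  have wc: "ev (lev M p) gs w \<in> carrier M"
    using L.ev_closed[of gs w] gs_carrier w by simp
  have sb: "gs ! s \<in> right_basic (lev M p)"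
    using nth_gs[OF s] by (auto simp: lev_def intro: right_basic.atom)
  show ?case
  proof (intro conjI allI impI)
    fix q' b
    assume sq: "lcm_sq (lev M p) (ev (lev M p) gs (s # w)) q q' b"
    obtain x1 d e where 1: "lcm_sq (lev M p) (gs ! s) q x1 d"
      "lcm_sq (lev M p) (ev (lev M p) gs w) x1 q' e" "b = d \<otimes>\<^bsub>lev M p\<^esub> e"
      using L.lcm_sq_split[of "gs ! s" "ev (lev M p) gs w" q q' b] sq sc wc by auto
    have x1: "x1 \<in> states M p"
      using L.right_basic_lcm_sq[OF sb _ 1(1)] Cons.prems(1) by (simp add: states_def)
    obtain v1 where v1: "\<delta> (p, c q, s) = (c x1, v1)" "set v1 \<subseteq> {..<n}" "ev (lev M p) gs v1 = d"
      using \<delta>_some[OF p Cons.prems(1) s 1(1)] by blast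
    obtain v2 where v2: "q' \<in> states M p" "run \<delta> p (c x1) w = (c q', v2)" "set v2 \<subseteq> {..<n}"
      "ev (lev M p) gs v2 = e"
      using Cons.IH[OF x1 w] 1(2) by blast
    have "ev (lev M p) gs (v1 @ v2) = b"
      using L.ev_append[of gs v1 v2] gs_carrier v1 v2 1(3) by simp
    then show "q' \<in> states M p"
      "\<exists>v. run \<delta> p (c q) (s # w) = (c q', v) \<and> set v \<subseteq> {..<n} \<and> ev (lev M p) gs v = b"
      using v1 v2 by (auto simp: run_simps)
  next
    assume none: "\<forall>q' b. \<not> lcm_sq (lev M p) (ev (lev M p) gs (s # w)) q q' b"
    show "fst (run \<delta> p (c q) (s # w)) = 0"
    proof (cases "\<exists>x1 d. lcm_sq (lev M p) (gs ! s) q x1 d")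
      case True
      then obtain x1 d where 1: "lcm_sq (lev M p) (gs ! s) q x1 d" by blast
      have x1: "x1 \<in> states M p"
        using L.right_basic_lcm_sq[OF sb _ 1] Cons.prems(1) by (simp add: states_def)
      obtain v1 where v1: "\<delta> (p, c q, s) = (c x1, v1)"
        using \<delta>_some[OF p Cons.prems(1) s 1] by blast
      have "\<not> lcm_sq (lev M p) (ev (lev M p) gs w) x1 q' b" for q' b
        using L.lcm_sq_paste[OF 1, of "ev (lev M p) gs w" q' b] none by auto
      then show ?thesis using Cons.IH[OF x1 w] v1 by (simp add: run_simps)
    next
      case False
      then show ?thesis using \<delta>_none[OF p Cons.prems(1) s] by (simp add: run_simps run_dead)
    qed
  qed
qed

definition valid :: "nat \<Rightarrow> nat list list \<Rightarrow> bool" where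
  "valid m xs \<longleftrightarrow> length xs = m \<and> (\<forall>w\<in>set xs. set w \<subseteq> {..<n}) \<and> entries M gs xs 0 = \<one>"

lemma lev_mod2: "lev M (i mod 2) = lev M i"
  by (simp add: lev_def)

lemma ev_orient: "set w \<subseteq> {..<n} \<Longrightarrow> ev (lev M i) gs (orient (i mod 2) w) = ev M gs w"
  using ev_opp[OF gs_carrier, of "rev w"] by (auto simp: lev_def orient_def even_iff_mod_2_eq_zero)

lemma set_orient [simp]: "set (orient p w) = set w"
  by (simp add: orient_def)

lemma orient_orient [simp]: "orient p (orient p w) = w"
  by (simp add: orient_def)

lemma set_nth_default: "valid m xs \<Longrightarrow> set (nth_default [] xs k) \<subseteq> {..<n}"
  by (auto simp: valid_def nth_default_def dest: nth_mem)

lemma entries_mf: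
  assumes "valid m xs"
  shows "entries M gs xs \<in> mf M m"
  using assms ev_closed[OF gs_carrier set_nth_default[OF assms]]
  by (auto simp: mf_def entries_def) (auto simp: valid_def nth_default_def entries_def)

lemma entries_update:
  "k < length xs \<Longrightarrow> entries M gs (xs[k := w]) = (entries M gs xs)(k := ev M gs w)"
  by (auto simp: entries_def nth_default_def fun_eq_iff)

abbreviation att where "att \<equiv> attempt \<delta> \<omega> \<sigma> (c \<one>)"

text \<open>The transducer finds every existing remainder, so an unsuccessful attempt proves that no
  step with this atom exists. Fixed points of all attempts are then irreducible with respect to
  atoms.\<close>

lemma attempt_cases:
  assumes xs: "valid m xs" and x: "x < n"
  shows "valid m (att i x xs) \<and>
    (att i x xs = xs \<and> (Suc (Suc i) < m \<longrightarrow> (\<forall>b. \<not> step M i (gs ! x) (entries M gs xs) b)) \<or>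
     red M (entries M gs xs) (entries M gs (att i x xs)))"
proof -
  define p where "p = i mod 2"
  have p: "p < 2" "lev M p = lev M i" by (simp_all add: p_def lev_mod2)
  interpret L: gcd_mon "lev M i" using gcd_mon_axioms by (rule gcd_mon_lev)
  let ?X = "gs ! x"
  let ?w = "\<lambda>k. nth_default [] xs k"
  let ?o = "\<lambda>k. orient p (?w k)"
  let ?a = "entries M gs xs"
  define r2 where "r2 = run \<delta> p (\<sigma> x) (?o (Suc i))"
  define r3 where "r3 = run \<delta> p (\<sigma> x) (?o (Suc (Suc i)))"
  define cond where "cond \<longleftrightarrow> Suc (Suc i) < length xs \<and> fst r3 = c \<one> \<and> fst r2 \<noteq> 0 \<and>
    (i \<noteq> 0 \<or> fst r2 = c \<one>)"
  have att: "att i x xs = (if cond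
     then xs[i := orient p (?o i @ \<omega> (p, fst r2)), Suc i := orient p (snd r2),
             Suc (Suc i) := orient p (snd r3)] else xs)"
    unfolding attempt_def Let_def cond_def r2_def r3_def p_def by simp
  have w: "set (?w k) \<subseteq> {..<n}" for k using xs by (rule set_nth_default)
  have ev: "ev (lev M i) gs (?o k) = ?a k" for k
    unfolding p_def entries_def by (rule ev_orient[OF w])
  have X: "?X \<in> carrier M" "?X \<noteq> \<one>" using nth_gs[OF x] atomsD by blast+
  have one: "\<one> \<in> states M p" by (simp add: states_def)
  have correct: "(\<forall>q' b. lcm_sq (lev M i) (?a k) ?X q' b \<longrightarrow>
      q' \<in> states M p \<and> (\<exists>v. run \<delta> p (\<sigma> x) (?o k) = (c q', v) \<and> set v \<subseteq> {..<n} \<and> ev (lev M i) gs v = b)) \<and>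
    ((\<forall>q' b. \<not> lcm_sq (lev M i) (?a k) ?X q' b) \<longrightarrow> fst (run \<delta> p (\<sigma> x) (?o k)) = 0)" for k
    using run_correct[OF p(1) nth_gs_states[OF x, of p], of "?o k"] w[of k] \<sigma>[OF x]
    by (simp add: p(2) ev)
  have a: "?a k \<in> carrier M" for k using entries_mf[OF xs] by (simp add: mf_def)
  show ?thesis
  proof (cases cond)
    case True
    then have len: "Suc (Suc i) < length xs" and r3: "fst r3 = c \<one>" and r2: "fst r2 \<noteq> 0"
      "i = 0 \<Longrightarrow> fst r2 = c \<one>" by (auto simp: cond_def)
    obtain q3 b3 where q3: "lcm_sq (lev M i) (?a (Suc (Suc i))) ?X q3 b3"
      using correct[of "Suc (Suc i)"] r3 c_pos[OF p(1) one] unfolding r3_def by metis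
    then obtain v3 where v3: "q3 \<in> states M p" "r3 = (c q3, v3)" "set v3 \<subseteq> {..<n}" "ev (lev M i) gs v3 = b3"
      using correct[of "Suc (Suc i)"] unfolding r3_def by blast
    \<comment> \<open>Injectivity of \<open>c\<close> turns the comparison of codes into
      divisibility by the atom.\<close>
    have "q3 = \<one>" using c_inj[OF p(1)] r3 v3 one by (simp add: inj_on_eq_iff)
    then have a3: "?a (Suc (Suc i)) = ?X \<otimes>\<^bsub>lev M i\<^esub> b3"
      using lcm_sqD[OF q3] L.r_one[of "?a (Suc (Suc i))"] a by simp
    obtain q2 b2 where q2: "lcm_sq (lev M i) (?a (Suc i)) ?X q2 b2"
      using correct[of "Suc i"] r2 unfolding r2_def by metis
    then obtain v2 where v2: "q2 \<in> states M p" "r2 = (c q2, v2)" "set v2 \<subseteq> {..<n}" "ev (lev M i) gs v2 = b2"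
      using correct[of "Suc i"] unfolding r2_def by blast
    have q2_one: "q2 = \<one>" if "i = 0"
      using c_inj[OF p(1)] r2(2)[OF that] v2 one by (simp add: inj_on_eq_iff)
    note \<omega>2 = \<omega>[OF p(1) v2(1), unfolded p(2)]
    let ?u = "orient p (?o i @ \<omega> (p, c q2))"
    have eq: "att i x xs = xs[i := ?u, Suc i := orient p v2, Suc (Suc i) := orient p v3]"
      using att True v2 v3 by simp
    have ev': "ev M gs (orient p v) = ev (lev M i) gs v" if "set v \<subseteq> {..<n}" for v
      using ev_orient[of "orient p v" i] that by (simp add: p_def)
    have u: "ev M gs ?u = ?a i \<otimes>\<^bsub>lev M i\<^esub> q2" "set ?u \<subseteq> {..<n}"
      using ev'[of "?o i @ \<omega> (p, c q2)"] L.ev_append[of gs "?o i" "\<omega> (p, c q2)"] \<omega>2 w[of i] gs_carrier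
      by (simp_all add: ev)
    have st: "step M i ?X ?a (entries M gs (att i x xs))"
    proof (rule stepI[OF q2 _ a3])
      show "b3 \<in> carrier M" using lcm_sqD(4)[OF q3] by simp
      show "entries M gs (att i x xs) =
          ?a(i := ?a i \<otimes>\<^bsub>lev M i\<^esub> q2, Suc i := b2, Suc (Suc i) := b3)"
        using len u(1) ev' v2 v3 by (simp add: eq entries_update)
    qed (rule q2_one)
    \<comment> \<open>For \<open>i = 0\<close> the word of the dummy is rewritten as well; that its
      value stays \<open>\<one>\<close> is a property of steps.\<close>
    have att0: "entries M gs (att i x xs) 0 = \<one>"
      using step_mf[OF entries_mf[OF xs] st] by (simp add: mf_def)
    have "set (att i x xs) \<subseteq>
        insert (orient p v3) (insert (orient p v2) (insert ?u (set xs)))"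
      unfolding eq by (intro order_trans[OF set_update_subset_insert] insert_mono) simp
    moreover have "\<forall>w\<in>insert (orient p v3) (insert (orient p v2) (insert ?u (set xs))). set w \<subseteq> {..<n}"
    proof -
      have "set (orient p v3) \<subseteq> {..<n}" "set (orient p v2) \<subseteq> {..<n}" "\<forall>w\<in>set xs. set w \<subseteq> {..<n}"
        using v2(3) v3(3) xs by (simp_all add: valid_def)
      then show ?thesis using u(2) by blast
    qed
    ultimately have "\<forall>w\<in>set (att i x xs). set w \<subseteq> {..<n}" by blast
    then have "valid m (att i x xs)"
      using xs att0 by (simp add: valid_def eq)
    then show ?thesis using st X(2) by (auto simp: red_def)
  next
    case False
    have "\<not> step M i ?X ?a b" if len: "Suc (Suc i) < m" for b
    proof
      assume "step M i ?X ?a b"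
      then show False
      proof cases
        case (1 x' b' c')
        have "lcm_sq (lev M i) (?a (Suc (Suc i))) ?X \<one> c'"
          using L.lcm_sq_divides[of ?X c'] X 1 by simp
        then have "fst r3 = c \<one>" using correct[of "Suc (Suc i)"] unfolding r3_def by fastforce
        moreover have "x' \<in> states M p" "fst r2 = c x'"
          using correct[of "Suc i"] 1(2) unfolding r2_def by fastforce+
        ultimately have cond
          using len xs c_pos[OF p(1), of x'] 1(5) by (auto simp: cond_def valid_def)
        then show False using False by simp
      qed
    qed
    then show ?thesis using att False xs by simp
  qed
qed

end

text \<open>Moves that stand still or descend in a strict order cannot return to their start. So an
  unchanged result certifies that every single move stood still.\<close>

lemma foldl_progress:
  assumes "\<And>x y. x \<in> V \<Longrightarrow> y \<in> set L \<Longrightarrow> g x y \<in> V \<and> (g x y = x \<or> R x (g x y))"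
    and "transp R" "\<And>x. x \<in> V \<Longrightarrow> \<not> R x x" "x \<in> V"
  shows "foldl g x L \<in> V \<and>
    (foldl g x L = x \<and> (\<forall>y\<in>set L. g x y = x) \<or> R x (foldl g x L))"
  using assms(1,4)
proof (induction L arbitrary: x)
  case (Cons y L)
  have 1: "g x y \<in> V" "g x y = x \<or> R x (g x y)" using Cons.prems by auto
  then show ?case
    using Cons.IH[OF Cons.prems(1), of "g x y"] assms(2) by (auto dest: transpD)
qed simp

section \<open>Repeated passes reach an irreducible list\<close>

context reduction_tables
begin

text \<open>The second argument is the smaller one: it is a proper reduct of the first. Lists are
  compared through their multifractions, so that well-foundedness is inherited from
  \<open>wf_red\<close>.\<close>

definition less_mf :: "nat list list \<Rightarrow> nat list list \<Rightarrow> bool" where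
  "less_mf xs ys \<longleftrightarrow> (entries M gs ys, entries M gs xs) \<in> {(b, a). a \<in> mfs M \<and> red M a b}\<^sup>+"

lemma entries_mfs: "valid m xs \<Longrightarrow> entries M gs xs \<in> mfs M"
  using entries_mf by (auto simp: mfs_def)

lemma transp_less_mf: "transp less_mf"
  by (auto simp: transp_def less_mf_def)

lemma not_less_mf_self: "\<not> less_mf xs xs"
  using wf_trancl[OF wf_red] unfolding less_mf_def by (blast dest: wf_not_refl)

lemma sweep_progress:
  fixes i :: nat
  assumes "valid m xs"
  defines "ys \<equiv> sweep \<delta> \<omega> \<sigma> (c \<one>) n i xs"
  shows "valid m ys \<and> (ys = xs \<and> (\<forall>x<n. att i x xs = xs) \<or> less_mf xs ys)"
proof -
  have st: "att i x xs \<in> Collect (valid m) \<and> (att i x xs = xs \<or> less_mf xs (att i x xs))"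
    if "xs \<in> Collect (valid m)" "x \<in> set [0..<n]" for xs x
    using attempt_cases[of m xs x i] that entries_mfs[of m xs]
    by (auto simp: less_mf_def intro!: r_into_trancl)
  have "ys \<in> Collect (valid m) \<and>
      (ys = xs \<and> (\<forall>x\<in>set [0..<n]. att i x xs = xs) \<or> less_mf xs ys)"
    unfolding ys_def sweep_def
    by (rule foldl_progress, rule st, assumption+, rule transp_less_mf, rule not_less_mf_self)
      (use assms(1) in simp)
  then show ?thesis by auto
qed

lemma pass_progress:
  assumes "valid m xs"
  defines "ys \<equiv> pass \<delta> \<omega> \<sigma> (c \<one>) n xs"
  shows "valid m ys \<and> (ys = xs \<and> (\<forall>i<m. \<forall>x<n. att i x xs = xs) \<or> less_mf xs ys)"
proof -
  let ?s = "\<lambda>xs i. sweep \<delta> \<omega> \<sigma> (c \<one>) n i xs"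
  have st: "?s xs i \<in> Collect (valid m) \<and> (?s xs i = xs \<or> less_mf xs (?s xs i))"
    if "xs \<in> Collect (valid m)" "i \<in> set [0..<m]" for xs i
    using sweep_progress[of m xs i] that by auto
  have m: "length xs = m" using assms(1) by (simp add: valid_def)
  have "ys \<in> Collect (valid m) \<and>
      (ys = xs \<and> (\<forall>i\<in>set [0..<m]. ?s xs i = xs) \<or> less_mf xs ys)"
    unfolding ys_def pass_def m
    by (rule foldl_progress, rule st, assumption+, rule transp_less_mf, rule not_less_mf_self)
      (use assms(1) in simp)
  then have "valid m ys" "ys = xs \<and> (\<forall>i<m. ?s xs i = xs) \<or> less_mf xs ys" by auto
  moreover have "att i x xs = xs" if "?s xs i = xs" "x < n" for i x
    using sweep_progress[OF assms(1), of i] that not_less_mf_self by auto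
  ultimately show ?thesis by blast
qed

lemma wf_less_mf: "wf {(ys, xs). less_mf xs ys}"
  using wf_inv_image[OF wf_trancl[OF wf_red], of "entries M gs"]
  by (simp add: inv_image_def less_mf_def)

text \<open>A pass that changes the list descends in a well-founded order. This is the witness that
  the minimisation in \<open>stable_time\<close> requires.\<close>

lemma pass_stabilizes:
  assumes "valid m xs"
  shows "\<exists>k. pass \<delta> \<omega> \<sigma> (c \<one>) n ((pass \<delta> \<omega> \<sigma> (c \<one>) n ^^ k) xs) = (pass \<delta> \<omega> \<sigma> (c \<one>) n ^^ k) xs"
  using assms
proof (induction xs rule: wf_induct_rule[OF wf_less_mf])
  case (1 xs)
  let ?P = "pass \<delta> \<omega> \<sigma> (c \<one>) n"
  consider "?P xs = xs" | "less_mf xs (?P xs)" using pass_progress[OF 1(2)] by blast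
  then show ?case
  proof cases
    case 1
    then have "?P ((?P ^^ 0) xs) = (?P ^^ 0) xs" by simp
    then show ?thesis by blast
  next
    case 2
    then obtain k where "?P ((?P ^^ k) (?P xs)) = (?P ^^ k) (?P xs)"
      using 1 pass_progress[OF 1(2)] by blast
    then have "?P ((?P ^^ Suc k) xs) = (?P ^^ Suc k) xs" by (simp add: funpow_swap1)
    then show ?thesis by blast
  qed
qed

lemma funpow_pass:
  assumes "valid m xs"
  shows "valid m ((pass \<delta> \<omega> \<sigma> (c \<one>) n ^^ k) xs) \<and>
    (red M)\<^sup>*\<^sup>* (entries M gs xs) (entries M gs ((pass \<delta> \<omega> \<sigma> (c \<one>) n ^^ k) xs))"
proof (induction k)
  case (Suc k)
  let ?P = "pass \<delta> \<omega> \<sigma> (c \<one>) n"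
  have "(red M)\<^sup>*\<^sup>* a b" if "(b, a) \<in> {(b, a). a \<in> mfs M \<and> red M a b}\<^sup>+" for a b
    using that by (induction rule: trancl_induct) (auto intro: converse_rtranclp_into_rtranclp)
  then have "(red M)\<^sup>*\<^sup>* (entries M gs ((?P ^^ k) xs)) (entries M gs (?P ((?P ^^ k) xs)))"
    using pass_progress[of m "(?P ^^ k) xs"] Suc by (auto simp: less_mf_def)
  then show ?case using pass_progress[of m "(?P ^^ k) xs"] Suc by (auto intro: rtranclp_trans)
qed (use assms in simp)

text \<open>\<open>x\<close> has a leading atom. The lcm with \<open>x\<close> is a common multiple
  for that atom too, and the atom's remainder divides \<open>x'\<close>, so the restriction at level
  0 is inherited.\<close>

lemma step_atom:
  assumes a: "a \<in> mf M m" and "step M i x a b" "x \<noteq> \<one>"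
  shows "Suc (Suc i) \<le> m \<and> (\<exists>k<n. \<exists>b. step M i (gs ! k) a b)"
  using assms(2)
proof cases
  case (1 x' bx cx)
  interpret L: noeth_ore_mon "lev M i" using noeth_ore_mon_axioms by (rule noeth_ore_mon_lev)
  note D = lcm_sqD[OF 1(2), simplified]
  have car: "a k \<in> carrier M" for k using a by (simp add: mf_def)
  have "a (Suc (Suc i)) \<noteq> \<one>" using L.prod_one[of x cx] D 1 assms(3) by auto
  then have le: "Suc (Suc i) \<le> m" using a unfolding mf_def by (auto simp: not_le[symmetric])
  have at: "set gs = atoms (lev M i)" using gs by (simp add: lev_def)
  obtain w where w: "set w \<subseteq> {..<n}" "ev (lev M i) gs w = x"
    using L.atom_words[OF at, of x] D by auto
  then obtain k v where k: "w = k # v" using assms(3) by (cases w) auto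
  have kn: "k < n" "set v \<subseteq> {..<n}" using w k by auto
  let ?X = "gs ! k" and ?y = "ev (lev M i) gs v"
  have X: "?X \<in> carrier M" using nth_gs[OF kn(1)] atomsD by blast
  have y: "?y \<in> carrier M" using L.ev_closed[of gs v] gs_carrier kn by simp
  have x: "x = ?X \<otimes>\<^bsub>lev M i\<^esub> ?y" using w k by simp
  have eq: "a (Suc i) \<otimes>\<^bsub>lev M i\<^esub> x' = ?X \<otimes>\<^bsub>lev M i\<^esub> (?y \<otimes>\<^bsub>lev M i\<^esub> bx)"
    using D x X y by (simp add: L.m_assoc)
  obtain u b1 where u: "lcm_sq (lev M i) (a (Suc i)) ?X u b1"
    using eq L.ex_lcm_sq[of "a (Suc i)" ?X x' "?y \<otimes>\<^bsub>lev M i\<^esub> bx"] D X y car L.m_closed by auto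
  obtain t where t: "t \<in> carrier M" "x' = u \<otimes>\<^bsub>lev M i\<^esub> t"
    using lcm_sq_least[OF u _ _ eq] D(3,4) y L.m_closed by auto
  have "u = \<one>" if "i = 0" using L.prod_one[of u t] t 1(5) that lcm_sqD(3)[OF u] by simp
  moreover have "?y \<otimes>\<^bsub>lev M i\<^esub> cx \<in> carrier M" using L.m_closed[of ?y cx] y 1 by simp
  moreover have "a (Suc (Suc i)) = ?X \<otimes>\<^bsub>lev M i\<^esub> (?y \<otimes>\<^bsub>lev M i\<^esub> cx)"
    using 1 x X y L.m_assoc by simp
  ultimately have "\<exists>b. step M i ?X a b"
    using step.intros[where a = a and i = i, OF u] by blast
  then show ?thesis using le kn by blast
qed

lemma reduce_fully_correct:
  assumes xs: "valid m xs"
  defines "ys \<equiv> reduce_fully \<delta> \<omega> \<sigma> (c \<one>) n xs"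
  shows "joinable M (entries M gs xs) (\<lambda>_. \<one>) \<longleftrightarrow> (\<forall>w\<in>set ys. w = [])"
proof -
  let ?P = "pass \<delta> \<omega> \<sigma> (c \<one>) n"
  have fix': "?P ys = ys"
    using LeastI_ex[OF pass_stabilizes[OF xs]] by (simp add: ys_def reduce_fully_def stable_time_def)
  have ys: "valid m ys" "(red M)\<^sup>*\<^sup>* (entries M gs xs) (entries M gs ys)"
    using funpow_pass[OF xs] by (auto simp: ys_def reduce_fully_def)
  have id: "att i x ys = ys" if "i < m" "x < n" for i x
    using pass_progress[OF ys(1)] fix' not_less_mf_self that by auto
  have "\<not> red M (entries M gs ys) b" for b
  proof
    assume "red M (entries M gs ys) b"
    then obtain i x where ix: "x \<noteq> \<one>" "step M i x (entries M gs ys) b" by (auto simp: red_def)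
    have "m \<noteq> 0"
    proof
      assume "m = 0"
      then show False using step_atom[OF entries_mf[OF ys(1)] ix(2,1)] by simp
    qed
    \<comment> \<open>A list of length \<open>m\<close> has its last entry at index
      \<open>m - 1\<close>. The sharper bound puts \<open>i + 2\<close> inside the list, as
      \<open>attempt\<close> requires.\<close>
    then have mf: "entries M gs ys \<in> mf M (m - 1)"
      using entries_mf[OF ys(1)] ys(1) by (auto simp: mf_def valid_def entries_def nth_default_def)
    obtain k b' where k: "Suc (Suc i) \<le> m - 1" "k < n" "step M i (gs ! k) (entries M gs ys) b'"
      using step_atom[OF mf ix(2,1)] by blast
    have "\<not> red M (entries M gs ys) (entries M gs (att i k ys))"
      using id[of i k] k \<open>m \<noteq> 0\<close> not_less_mf_self[of ys] entries_mfs[OF ys(1)]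
      by (auto simp: less_mf_def)
    then show False using attempt_cases[OF ys(1) k(2), of i] k \<open>m \<noteq> 0\<close> by auto
  qed
  then have "joinable M (entries M gs xs) (\<lambda>_. \<one>) \<longleftrightarrow> entries M gs ys = (\<lambda>_. \<one>)"
    using joinable_ones_iff[OF entries_mfs[OF xs] ys(2)] by blast
  also have "\<dots> \<longleftrightarrow> (\<forall>w\<in>set ys. w = [])"
  proof
    assume ones: "entries M gs ys = (\<lambda>_. \<one>)"
    show "\<forall>w\<in>set ys. w = []"
    proof
      fix w assume "w \<in> set ys"
      then obtain k where k: "k < length ys" "w = ys ! k" by (metis in_set_conv_nth)
      then have "ev M gs w = \<one>" using fun_cong[OF ones, of k] by (simp add: entries_def nth_default_def)
      then show "w = []" using ev_eq_one[of gs w] gs ys(1) \<open>w \<in> set ys\<close> by (auto simp: valid_def)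
    qed
  next
    assume "\<forall>w\<in>set ys. w = []"
    then have "nth_default [] ys k = []" for k
      using nth_mem[of k ys] by (auto simp: nth_default_def)
    then show "entries M gs ys = (\<lambda>_. \<one>)" by (simp add: entries_def fun_eq_iff)
  qed
  finally show ?thesis .
qed

lemma initial_eq: "initial n w = [] # concat (map (initial_entries n) w)"
proof -
  have "foldl (\<lambda>r l. r @ initial_entries n l) zs w = zs @ concat (map (initial_entries n) w)" for zs
    by (induction w arbitrary: zs) auto
  then show ?thesis by (simp add: initial_def)
qed

lemma valid_initial: "valid (length (initial n w)) (initial n w)"
  by (auto simp: valid_def entries_def initial_eq initial_entries_def split: if_splits)

lemma entries_initial:
  assumes "set w \<subseteq> {..<2 * n}"
  shows "entries M gs (initial n w) = word_mf M (map (\<lambda>l. (gs ! (l div 2), odd l)) w)"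
  using assms
proof (induction w)
  case Nil
  then show ?case by (auto simp: initial_eq entries_def nth_default_def fun_eq_iff)
next
  case (Cons l w)
  let ?r = "concat (map (initial_entries n) w)"
  have l: "l < 2 * n" "l div 2 < n" using Cons.prems by auto
  have car: "gs ! (l div 2) \<in> carrier M" using nth_gs[OF l(2)] atomsD by blast
  have push: "entries M gs ([] # u # v # ?r) = push M (ev M gs u) (ev M gs v) (entries M gs ([] # ?r))"
    for u v
  proof
    fix k
    consider "k = 0" | "k = 1" | "k = 2" | j where "k = Suc (Suc (Suc j))"
      by (metis One_nat_def Suc_1 not0_implies_Suc)
    then show "entries M gs ([] # u # v # ?r) k =
        push M (ev M gs u) (ev M gs v) (entries M gs ([] # ?r)) k"
      by cases (simp_all add: entries_def push_def nth_default_def numeral_2_eq_2)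
  qed
  have "initial n (l # w) = [] # (if odd l then [l div 2] else []) # (if odd l then [] else [l div 2]) # ?r"
    using l by (simp add: initial_eq initial_entries_def)
  moreover have "entries M gs ([] # ?r) = word_mf M (map (\<lambda>l. (gs ! (l div 2), odd l)) w)"
    using Cons by (simp add: initial_eq)
  ultimately show ?case using car by (simp add: push)
qed

definition trivial_word :: "nat list \<Rightarrow> bool" where
  "trivial_word w \<longleftrightarrow> (\<forall>l\<in>set w. l < 2 * n) \<and>
     (\<forall>v\<in>set (reduce_fully \<delta> \<omega> \<sigma> (c \<one>) n (initial n w)). v = [])"

lemma trivial_word_iff:
  "trivial_word w \<longleftrightarrow> set w \<subseteq> {..<2 * n} \<and>
     joinable M (word_mf M (map (\<lambda>l. (gs ! (l div 2), odd l)) w)) (\<lambda>_. \<one>)"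
proof (cases "set w \<subseteq> {..<2 * n}")
  case True
  then have "\<forall>l\<in>set w. l < 2 * n" by auto
  then show ?thesis
    using True reduce_fully_correct[OF valid_initial[of w]] entries_initial[OF True]
    by (simp add: trivial_word_def)
qed (auto simp: trivial_word_def)

lemma computable_trivial_word:
  assumes "finite {x. \<delta> x \<noteq> (0, [])}" "finite {x. \<omega> x \<noteq> []}" "finite {x. \<sigma> x \<noteq> 0}"
  shows "computable_pred trivial_word"
proof -
  let ?P = "pass \<delta> \<omega> \<sigma> (c \<one>) n"
  note P = computable_pass[OF assms, of "c \<one>" n]
  have pw: "computable (\<lambda>x. (?P ^^ f x) (initial n (g x)))" if "computable f" "computable g" for f g
    by (intro computable_funpow P computable_comp[OF computable_initial] that)
  have "computable_pred (\<lambda>p. ?P ((?P ^^ fst p) (initial n (snd p))) = (?P ^^ fst p) (initial n (snd p)))"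
    by (intro computable_pred_eq computable_comp[OF P] pw computable_fst computable_snd computable_id)
  then have "computable (\<lambda>w. stable_time \<delta> \<omega> \<sigma> (c \<one>) n (initial n w))"
    unfolding stable_time_def
    by (rule computable_Least) (rule pass_stabilizes[OF valid_initial])
  then have "computable (\<lambda>w. reduce_fully \<delta> \<omega> \<sigma> (c \<one>) n (initial n w))"
    unfolding reduce_fully_def by (intro pw computable_id)
  then have "computable_pred (\<lambda>w. \<forall>v\<in>set (reduce_fully \<delta> \<omega> \<sigma> (c \<one>) n (initial n w)). v = [])"
    by (intro computable_pred_list_all computable_pred_eq computable_id computable_const)
  moreover have "computable_pred (\<lambda>w. \<forall>l\<in>set w. l < 2 * n)"
    by (intro computable_pred_list_all computable_pred_less computable_id computable_const)
  ultimately show ?thesis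
    unfolding trivial_word_def[abs_def] by (intro computable_pred_conj)
qed

end

section \<open>Existence of finite tables\<close>

lemma (in noeth_ore_mon) ex_transducer:
  assumes gs: "set gs = atoms M" and fin: "finite Q" and Q: "Q = insert \<one> (right_basic M)"
    and c: "inj_on c Q" "\<And>q. q \<in> Q \<Longrightarrow> c q \<noteq> (0::nat)"
  shows "\<exists>d :: nat \<times> nat \<Rightarrow> nat \<times> nat list. finite {x. d x \<noteq> (0, [])} \<and> (\<forall>s. d (0, s) = (0, [])) \<and>
    (\<forall>q\<in>Q. \<forall>s<length gs.
      ((\<forall>q' s'. \<not> lcm_sq M (gs ! s) q q' s') \<longrightarrow> d (c q, s) = (0, [])) \<and>
      (\<forall>q' s'. lcm_sq M (gs ! s) q q' s' \<longrightarrow>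
        (\<exists>w. d (c q, s) = (c q', w) \<and> set w \<subseteq> {..<length gs} \<and> ev M gs w = s')))"
proof -
  define P where "P q s r \<longleftrightarrow> ((\<forall>q' s'. \<not> lcm_sq M (gs ! s) q q' s') \<longrightarrow> r = (0, [])) \<and>
      (\<forall>q' s'. lcm_sq M (gs ! s) q q' s' \<longrightarrow>
        (\<exists>w. r = (c q', w) \<and> set w \<subseteq> {..<length gs} \<and> ev M gs w = s'))" for q s r
  have "\<exists>r. P q s r" for q s
  proof (cases "\<exists>q' s'. lcm_sq M (gs ! s) q q' s'")
    case True
    then obtain q' s' where sq: "lcm_sq M (gs ! s) q q' s'" by blast
    obtain w where w: "set w \<subseteq> {..<length gs}" "ev M gs w = s'"
      using atom_words[OF gs] lcm_sqD(4)[OF sq] by blast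
    have "P q s (c q', w)" unfolding P_def using lcm_sq_unique[OF sq] w sq by blast
    then show ?thesis by blast
  next
    case False
    then have "P q s (0, [])" by (simp add: P_def)
    then show ?thesis by blast
  qed
  then obtain g where "\<And>q s. P q s (g q s)" by metis
  note g = this[unfolded P_def]
  \<comment> \<open>Sending everything that is not a state code with a valid letter to the dead
    state keeps the table finite.\<close>
  define d where "d = (\<lambda>(k, s). if k \<in> c ` Q \<and> s < length gs then g (inv_into Q c k) s else (0, []))"
  have "{x. d x \<noteq> (0, [])} \<subseteq> c ` Q \<times> {..<length gs}" by (auto simp: d_def split: if_splits)
  then have "finite {x. d x \<noteq> (0, [])}" by (rule finite_subset) (use fin in simp)
  moreover have "0 \<notin> c ` Q" using c(2) by force
  then have "d (0, s) = (0, [])" for s by (simp add: d_def)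
  moreover have "d (c q, s) = g q s" if "q \<in> Q" "s < length gs" for q s
    using that c(1) by (simp add: d_def)
  ultimately show ?thesis using g by (intro exI[of _ d]) auto
qed

lemma (in noeth_ore_mon) ex_reduction_tables:
  assumes gs: "set gs = atoms M" and fin: "finite (basic_elements M)"
  obtains c \<delta> \<omega> \<sigma> where "reduction_tables M gs c \<delta> \<omega> \<sigma>"
    "finite {x. \<delta> x \<noteq> (0, [])}" "finite {x. \<omega> x \<noteq> []}" "finite {x. \<sigma> x \<noteq> 0}"
proof -
  \<comment> \<open>Odd levels use the right basic elements of \<open>M\<close>, even levels those
    of \<open>opp M\<close>, which are the left basic elements; \<open>basic_elements\<close>
    contains both.\<close>
  have fin: "finite (states M p)" for p
    using fin by (auto simp: states_def lev_def basic_elements_def)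
  let ?S = "states M 0 \<union> states M 1"
  obtain f :: "'a \<Rightarrow> nat" where f: "inj_on f ?S"
    using finite_imp_inj_to_nat_seg[of ?S] fin by auto
  \<comment> \<open>The successor keeps \<open>0\<close> free for the dead state.\<close>
  define c where "c = Suc \<circ> f"
  have c: "inj_on c (states M p)" "c q \<noteq> 0" if "p < 2" for p q
    using that f by (auto simp: c_def inj_on_Un less_2_cases_iff intro!: comp_inj_on)
  define D :: "nat \<Rightarrow> (nat \<times> nat \<Rightarrow> nat \<times> nat list) \<Rightarrow> bool"
    where "D p d \<longleftrightarrow> finite {x. d x \<noteq> (0, [])} \<and> (\<forall>s. d (0, s) = (0, [])) \<and>
    (\<forall>q\<in>states M p. \<forall>s<length gs.
      ((\<forall>q' s'. \<not> lcm_sq (lev M p) (gs ! s) q q' s') \<longrightarrow> d (c q, s) = (0, [])) \<and>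
      (\<forall>q' s'. lcm_sq (lev M p) (gs ! s) q q' s' \<longrightarrow>
        (\<exists>w. d (c q, s) = (c q', w) \<and> set w \<subseteq> {..<length gs} \<and> ev (lev M p) gs w = s')))" for p d
  have atoms: "set gs = atoms (lev M p)" for p using gs by (simp add: lev_def)
  have "\<exists>d. D p d" if "p < 2" for p
  proof -
    interpret L: noeth_ore_mon "lev M p" using noeth_ore_mon_axioms by (rule noeth_ore_mon_lev)
    show ?thesis
      unfolding D_def by (rule L.ex_transducer[OF atoms fin]) (use c[OF that] in \<open>auto simp: states_def\<close>)
  qed
  then obtain d where "\<And>p. p < 2 \<Longrightarrow> D p (d p)" by metis
  note d = this[unfolded D_def]
  define \<delta> where "\<delta> = (\<lambda>(p, k, s). if p < 2 then d p (k, s) else (0, []))"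
  have "{x. \<delta> x \<noteq> (0, [])} \<subseteq> (\<Union>p\<in>{..<2}. Pair p ` {x. d p x \<noteq> (0, [])})"
    by (auto simp: \<delta>_def split: if_splits)
  moreover have "finite (\<Union>p\<in>{..<2}. Pair p ` {x. d p x \<noteq> (0, [])})"
    by (intro finite_UN_I finite_imageI) (use d in simp_all)
  ultimately have \<delta>: "finite {x. \<delta> x \<noteq> (0, [])}" by (rule finite_subset)
  have ex: "\<exists>w. set w \<subseteq> {..<length gs} \<and> ev (lev M p) gs w = q" if "q \<in> states M p" for p q
  proof -
    interpret L: noeth_ore_mon "lev M p" using noeth_ore_mon_axioms by (rule noeth_ore_mon_lev)
    show ?thesis
      using L.atom_words[OF atoms] that L.right_basic_carrier by (auto simp: states_def)
  qed
  define h where "h p q = (SOME w. set w \<subseteq> {..<length gs} \<and> ev (lev M p) gs w = q)" for p q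
  have h: "set (h p q) \<subseteq> {..<length gs} \<and> ev (lev M p) gs (h p q) = q" if "q \<in> states M p" for p q
    unfolding h_def by (rule someI_ex[OF ex[OF that]])
  define \<omega> where "\<omega> = (\<lambda>(p, k). if p < 2 \<and> k \<in> c ` states M p
    then h p (inv_into (states M p) c k) else [])"
  have "{x. \<omega> x \<noteq> []} \<subseteq> (\<Union>p\<in>{..<2}. Pair p ` c ` states M p)"
    by (auto simp: \<omega>_def split: if_splits)
  then have \<omega>: "finite {x. \<omega> x \<noteq> []}" by (rule finite_subset) (use fin in auto)
  define \<sigma> where "\<sigma> x = (if x < length gs then c (gs ! x) else 0)" for x
  have "{x. \<sigma> x \<noteq> 0} \<subseteq> {..<length gs}" by (auto simp: \<sigma>_def)
  then have \<sigma>: "finite {x. \<sigma> x \<noteq> 0}" by (rule finite_subset) simp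
  have "reduction_tables M gs c \<delta> \<omega> \<sigma>"
  proof
    show "\<delta> (p, 0, s) = (0, [])" for p s using d by (simp add: \<delta>_def)
    show "set (\<omega> (p, c q)) \<subseteq> {..<length gs} \<and> ev (lev M p) gs (\<omega> (p, c q)) = q"
      if "p < 2" "q \<in> states M p" for p q
      using that h c(1) by (simp add: \<omega>_def)
  qed (use gs c d in \<open>auto simp: \<delta>_def \<sigma>_def\<close>)
  then show thesis using that \<delta> \<omega> \<sigma> by blast
qed

section \<open>Generation by atoms and decidability of the word problem\<close>

lemma word_value_nth:
  assumes "set w \<subseteq> {..<length gs} \<times> UNIV"
  shows "word_value G ((!) (map f gs)) w = word_value G f (map (\<lambda>(i, e). (gs ! i, e)) w)"
  using assms by (induction w) (auto simp: word_value_def letter_value_def)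

lemma (in noeth_ore_mon) generate_atoms:
  assumes "finite (atoms M)"
  shows "generate (enveloping_group M) (env_map M ` atoms M) = carrier (enveloping_group M)"
proof
  interpret E: group "enveloping_group M" by (rule group_enveloping_group[OF monoid_axioms])
  let ?H = "generate (enveloping_group M) (env_map M ` atoms M)"
  note hom = env_map_hom[OF monoid_axioms]
  have incl: "env_map M ` atoms M \<subseteq> carrier (enveloping_group M)"
    using hom_in_carrier[OF hom] atomsD by blast
  show "?H \<subseteq> carrier (enveloping_group M)" by (rule E.generate_incl[OF incl])
  obtain gs where gs: "set gs = atoms M" using finite_list[OF assms] by blast
  have car: "set gs \<subseteq> carrier M" using gs atomsD by blast
  have "env_map M (ev M gs w) \<in> ?H" if "set w \<subseteq> {..<length gs}" for w
    using that
  proof (induction w)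
    case Nil
    then show ?case
      using hom_one_group[OF E.is_group hom] by (simp add: generate.one)
  next
    case (Cons i w)
    then have i: "gs ! i \<in> atoms M" using gs nth_mem by auto
    have "env_map M (ev M gs (i # w)) =
        env_map M (gs ! i) \<otimes>\<^bsub>enveloping_group M\<^esub> env_map M (ev M gs w)"
      using hom_mult[OF hom] atomsD[OF i] ev_closed[OF car, of w] Cons.prems by simp
    then show ?case using Cons i by (auto intro: generate.eng generate.incl)
  qed
  then have gen: "env_map M a \<in> ?H" if "a \<in> carrier M" for a
    using atom_words[OF gs that] by blast
  have "word_value (enveloping_group M) (env_map M) w \<in> ?H" if "set w \<subseteq> carrier M \<times> UNIV" for w
    using that
  proof (induction w)
    case (Cons x w)
    then have "letter_value (enveloping_group M) (env_map M) x \<in> ?H"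
      using gen E.generate_m_inv_closed[OF incl] by (cases x) (auto simp: letter_value_def)
    then show ?case using Cons by (auto simp: word_value_def intro: generate.eng)
  qed (simp add: word_value_def generate.one)
  then show "carrier (enveloping_group M) \<subseteq> ?H"
    using word_value_enveloping by (auto elim!: enveloping_carrierE)
qed

lemma (in noeth_ore_mon) decidable_word_problem:
  assumes gs: "set gs = atoms M" and fin: "finite (basic_elements M)"
  shows "decidable_set (encode_word ` word_problem (enveloping_group M) (map (env_map M) gs))"
proof -
  obtain c \<delta> \<omega> \<sigma> where "reduction_tables M gs c \<delta> \<omega> \<sigma>"
    and fin: "finite {x. \<delta> x \<noteq> (0, [])}" "finite {x. \<omega> x \<noteq> []}" "finite {x. \<sigma> x \<noteq> 0}"
    by (rule ex_reduction_tables[OF gs fin])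
  then interpret T: reduction_tables M gs c \<delta> \<omega> \<sigma> by simp
  let ?code = "\<lambda>(i :: nat, e). 2 * i + of_bool e :: nat"
  let ?W = "word_problem (enveloping_group M) (map (env_map M) gs)"
  have word_iff: "w \<in> ?W \<longleftrightarrow> set w \<subseteq> {..<length gs} \<times> UNIV \<and>
      joinable M (word_mf M (map (\<lambda>(i, e). (gs ! i, e)) w)) (\<lambda>_. \<one>)" for w
  proof -
    have "set (map (\<lambda>(i, e). (gs ! i, e)) w) \<subseteq> carrier M \<times> UNIV"
      if "set w \<subseteq> {..<length gs} \<times> UNIV"
      using that T.gs_carrier by (fastforce dest: nth_mem)
    then show ?thesis
      using word_value_one_iff[of "map (\<lambda>(i, e). (gs ! i, e)) w"]
        word_value_nth[of w gs "enveloping_group M" "env_map M"]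
      by (cases "set w \<subseteq> {..<length gs} \<times> UNIV") (simp_all add: word_problem_def)
  qed
  have trivial_code: "T.trivial_word (map ?code w) \<longleftrightarrow> w \<in> ?W" for w
  proof -
    have "map ((\<lambda>l. (gs ! (l div 2), odd l)) \<circ> ?code) w = map (\<lambda>(i, e). (gs ! i, e)) w"
      by auto
    moreover have "set (map ?code w) \<subseteq> {..<2 * length gs} \<longleftrightarrow> set w \<subseteq> {..<length gs} \<times> UNIV"
    proof -
      have *: "?code x < 2 * length gs \<longleftrightarrow> x \<in> {..<length gs} \<times> UNIV" for x
        by (cases x; cases "snd x") auto
      have "set (map ?code w) \<subseteq> {..<2 * length gs} \<longleftrightarrow> (\<forall>x\<in>set w. ?code x < 2 * length gs)"
        by (simp only: set_map image_subset_iff lessThan_iff)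
      also have "\<dots> \<longleftrightarrow> set w \<subseteq> {..<length gs} \<times> UNIV" by (simp only: * subset_eq)
      finally show ?thesis .
    qed
    ultimately show ?thesis
      by (simp only: T.trivial_word_iff word_iff map_map)
  qed
  \<comment> \<open>Letter codes exhaust the numbers, and \<open>encode_word\<close> is the list
    code of the letter codes; hence every \<open>k\<close> is the code of exactly one word and the
    equivalence needs no side condition.\<close>
  have mem: "k \<in> encode_word ` ?W \<longleftrightarrow> T.trivial_word (dec k)" for k
  proof -
    have enc: "encode_word w = enc (map ?code w)" for w
      by (simp add: encode_word_def enc_list_def enc_nat_def[abs_def] o_def)
    define w where "w = map (\<lambda>l. (l div 2, odd l)) (dec k :: nat list)"
    have "?code (l div 2, odd l) = l" for l
      by (cases "even l") auto
    then have w: "map ?code w = dec k" by (simp add: w_def map_idI)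
    then have k: "k = encode_word w" by (simp add: enc)
    have "k \<in> encode_word ` ?W \<longleftrightarrow> w \<in> ?W"
      unfolding k by (rule inj_image_mem_iff[OF inj_encode_word])
    also have "\<dots> \<longleftrightarrow> T.trivial_word (dec k)"
      by (simp only: trivial_code[symmetric] w)
    finally show ?thesis .
  qed
  have "recursive_fn 1 (\<lambda>xs. of_bool (T.trivial_word (dec (xs ! 0))))"
    using T.computable_trivial_word[OF fin]
    by (simp add: computable_pred_def computable_def enc_nat_def)
  then show ?thesis
    unfolding decidable_set_def by (intro exI conjI) (auto simp: mem)
qed

theorem theorem5p18:
  fixes M :: "('a, 'b) monoid_scheme"
  assumes "gcd_monoid M"
    and "strongly_noetherian M"
    and "three_Ore M"
    and "finite (basic_elements M)"
  shows "word_problem_decidable (enveloping_group M) (atoms M) (env_map M)"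
proof -
  interpret noeth_ore_mon M
    using assms by unfold_locales
  have "atoms M \<subseteq> basic_elements M"
    by (auto simp: basic_elements_def intro: right_basic.atom)
  then have fin: "finite (atoms M)" using assms(4) by (rule finite_subset)
  moreover have "env_map M ` atoms M \<subseteq> carrier (enveloping_group M)"
    using hom_in_carrier[OF env_map_hom[OF monoid_axioms]] atomsD by blast
  ultimately show ?thesis
    using generate_atoms[OF fin] decidable_word_problem assms(4)
    by (simp add: word_problem_decidable_def)
qed

end
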